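(* The 120-cell has exactly $2^{29}$ fifteen-fold parity proofs. Moreover, they are all obtained by the following algorithm. Consider the 29 words of even length $$jq,\ jr',\ js',\ no,\ np,\ uv,\ uw,$$ $$cdjy,\ ceja',\ cfjb',\ cgjc',\ dejf',\ dfjg',\ dgji',\ efjl',\ egjm',\ fgjo',$$ $$abdekr,\ abfglt,\ bcklsx,\ ahklmsuh',$$ $$abhijlmnsq',\ acdefgklmz,\ acfghimsud',\ bcfghimnse',\ fghijlmsup',$$ $$abfghijkmnsj',\ bdefgiklmnsk',\ defghijkmsun'.$$ Take the symmetric difference of the letter sets of the words in an arbitrary subset of these 29 words (the empty subset giving the empty word), and then take the symmetric difference of the result with $\{j\}$. The resulting words are exactly the words representing the fifteen-fold parity proofs of the 120-cell, distinct subsets giving distinct proofs.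
   Context: The 120-cell is the regular polytope $\{5,3,3\}$ in $\mathbb{R}^4$ with 600 vertices, centered at the origin. Its rays are the 300 undirected lines through antipodal pairs of vertices, and a basis is a set of four mutually orthogonal rays; there are 675 bases. In the triacontagonal projection (projection to the Coxeter plane of $H_4$) the rays, represented by one of each pair of antipodal vertices, lie at the vertices of twenty concentric regular 15-gons (pentadecagons). These are labeled in order of decreasing circumradius (a common letter meaning a common circumcircle), and the rays are numbered counterclockwise around each pentadecagon, starting from the ray on or just above the positive $x$-axis: $A$: 1–15, $B_1$: 16–30, $B_2$: 31–45, $C$: 46–60, $D_1$: 61–75, $D_2$: 76–90, $E_1$: 91–105, $E_2$: 106–120, $F_1$: 121–135, $F_2$: 136–150, $G_1$: 151–165, $G_2$: 166–180, $H_1$: 181–195, $H_2$: 196–210, $I_1$: 211–225, $I_2$: 226–240, $J$: 241–255, $K_1$: 256–270, $K_2$: 271–285, $L$: 286–300. Rotation by $24^\circ$ in the projection plane is induced by a symmetry $g$ of the 120-cell that sends each ray to the ray numbered one higher, with wraparound inside its pentadecagon (e.g. $15\mapsto 1$, $30\mapsto 16$). With this numbering, the 675 bases are the 45 distinct $g$-orbits (fifteen bases each) of the following 45 generators: $a=\{1,20,274,296\}$, $b=\{1,42,268,291\}$, $c=\{1,50,245,286\}$, $d=\{1,65,222,289\}$, $e=\{1,87,230,298\}$, $f=\{1,95,207,292\}$, $g=\{1,117,185,295\}$, $h=\{1,155,192,215\}$, $i=\{1,177,200,237\}$, $j=\{16,20,265,266\}$, $k=\{16,65,228,275\}$, $l=\{16,102,193,280\}$,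 $m=\{16,117,221,246\}$, $n=\{16,139,178,259\}$, $o=\{16,140,176,268\}$, $p=\{16,147,177,256\}$, $q=\{31,35,280,281\}$, $r=\{31,87,224,267\}$, $s=\{31,95,231,244\}$, $t=\{31,110,199,262\}$, $u=\{31,125,155,271\}$, $v=\{31,132,156,274\}$, $w=\{31,133,154,283\}$, $x=\{46,65,183,269\}$, $y=\{46,64,224,253\}$, $z=\{46,79,201,280\}$, $a'=\{46,80,235,244\}$, $b'=\{46,94,200,247\}$, $c'=\{46,110,184,250\}$, $d'=\{46,125,168,246\}$, $e'=\{46,139,156,251\}$, $f'=\{61,80,212,229\}$, $g'=\{61,94,209,215\}$, $h'=\{61,118,131,298\}$, $i'=\{61,116,193,224\}$, $j'=\{61,140,162,234\}$, $k'=\{76,94,141,289\}$, $l'=\{76,96,199,228\}$, $m'=\{76,118,183,237\}$, $n'=\{76,132,170,218\}$, $o'=\{91,116,187,200\}$, $p'=\{91,124,172,192\}$, $q'=\{106,148,160,200\}$, $r'=\{121,123,156,163\}$, $s'=\{136,138,171,178\}$. (The letter $g$ naming a generator is unrelated to the symmetry $g$.) A word in distinct letters from this list represents the union of the $g$-orbits of the corresponding generators; its length is its number of letters. Primed letters are single letters. A parity proof is a set of bases consisting of an odd number of bases such that each ray occurs in an even number (possibly zero) of the bases of the set. It is fifteen-fold if it is invariant under the symmetry $g$; a fifteen-fold parity proof is thus represented by a unique word (up to the order of its letters). *)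

theory Defs
  imports "HOL-Analysis.Analysis" "HOL-Combinatorics.Permutations"
begin

definition golden :: real where
  "golden = (1 + sqrt 5) / 2"

definition signed_perms :: "real^4 \<Rightarrow> (real^4) set" where
  "signed_perms c = {\<chi> i. s i * c $ \<pi> i | s \<pi>.
     (\<forall>i. s i = 1 \<or> s i = -1) \<and> \<pi> permutes UNIV}"

definition signed_even_perms :: "real^4 \<Rightarrow> (real^4) set" where
  "signed_even_perms c = {\<chi> i. s i * c $ \<pi> i | s \<pi>.
     (\<forall>i. s i = 1 \<or> s i = -1) \<and> \<pi> permutes UNIV \<and> evenperm \<pi>}"

text \<open>The standard coordinates (Coxeter, Regular Polytopes) of the 600 vertices of the regular
  polytope \<open>{5,3,3}\<close> centred at the origin, with circumradius \<open>sqrt 8\<close>.\<close>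

definition vertices :: "(real^4) set" where
  "vertices =
     signed_perms (vector [0, 0, 2, 2]) \<union>
     signed_perms (vector [1, 1, 1, sqrt 5]) \<union>
     signed_perms (vector [1 / golden^2, golden, golden, golden]) \<union>
     signed_perms (vector [1 / golden, 1 / golden, 1 / golden, golden^2]) \<union>
     signed_even_perms (vector [0, 1 / golden^2, 1, golden^2]) \<union>
     signed_even_perms (vector [0, 1 / golden, golden, sqrt 5]) \<union>
     signed_even_perms (vector [1 / golden, 1, golden, 2])"

definition ray :: "real^4 \<Rightarrow> (real^4) set" where
  "ray v = span {v}"

definition rays :: "(real^4) set set" where
  "rays = ray ` vertices"

definition orthogonal_rays :: "(real^4) set \<Rightarrow> (real^4) set \<Rightarrow> bool" where
  "orthogonal_rays r s \<longleftrightarrow> (\<forall>x\<in>r. \<forall>y\<in>s. orthogonal x y)"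

definition bases :: "(real^4) set set set" where
  "bases = {B. B \<subseteq> rays \<and> card B = 4 \<and> pairwise orthogonal_rays B}"

definition symmetry :: "(real^4 \<Rightarrow> real^4) \<Rightarrow> bool" where
  "symmetry f \<longleftrightarrow> orthogonal_transformation f \<and> f ` vertices = vertices"

definition reflection :: "real^4 \<Rightarrow> real^4 \<Rightarrow> real^4" where
  "reflection r x = x - (2 * (r \<bullet> x) / (r \<bullet> r)) *\<^sub>R r"

text \<open>Unit simple roots of the symmetry group \<open>H\<^sub>4\<close> of the 120-cell: reflections in
  them are symmetries, and their Gram matrix is that of the Coxeter diagram with edge labels
  5, 3, 3.\<close>

definition simple_roots :: "real^4 \<Rightarrow> real^4 \<Rightarrow> real^4 \<Rightarrow> real^4 \<Rightarrow> bool" where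
  "simple_roots a b c d \<longleftrightarrow>
     (\<forall>r\<in>{a, b, c, d}. norm r = 1 \<and> symmetry (reflection r)) \<and>
     a \<bullet> b = - cos (pi / 5) \<and> b \<bullet> c = - cos (pi / 3) \<and> c \<bullet> d = - cos (pi / 3) \<and>
     a \<bullet> c = 0 \<and> a \<bullet> d = 0 \<and> b \<bullet> d = 0"

definition plane_proj :: "real^4 \<Rightarrow> real^4 \<Rightarrow> real^4 \<Rightarrow> complex" where
  "plane_proj p q x = Complex (p \<bullet> x) (q \<bullet> x)"

text \<open>\<open>p, q\<close> is an orthonormal frame of a Coxeter plane: the plane on which a Coxeter element
  (a product of the four simple reflections) acts as the rotation by \<open>2 * pi\<close> divided by the
  Coxeter number 30. The frame fixes the positive axes, hence the meaning of
  ``counterclockwise''.\<close>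

definition coxeter_frame :: "real^4 \<Rightarrow> real^4 \<Rightarrow> bool" where
  "coxeter_frame p q \<longleftrightarrow>
     norm p = 1 \<and> norm q = 1 \<and> p \<bullet> q = 0 \<and>
     (\<exists>a b c d. simple_roots a b c d \<and>
        (\<forall>x. plane_proj p q ((reflection a \<circ> reflection b \<circ> reflection c \<circ> reflection d) x)
             = cis (2 * pi / 30) * plane_proj p q x))"

text \<open>The pentadecagons A, B1, B2, C, D1, D2, ..., J, K1, K2, L are indexed by \<open>k < 20\<close>;
  \<open>circle k\<close> is the position (from the outside) of the circle carrying the \<open>k\<close>-th one, that is,
  its letter.\<close>

definition circle :: "nat \<Rightarrow> nat" where
  "circle k = [0, 1, 1, 2, 3, 3, 4, 4, 5, 5, 6, 6, 7, 7, 8, 8, 9, 10, 10, 11] ! k"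

text \<open>\<open>u n\<close> is the vertex chosen to represent the ray with number \<open>n\<close>, for \<open>n = 1, ..., 300\<close>, and
  \<open>R k\<close> and \<open>\<theta> k\<close> are the circumradius of the \<open>k\<close>-th pentadecagon and the argument of its first
  vertex; \<open>0 \<le> \<theta> k < 2 * pi / 15\<close> says that this is the vertex on or just above the positive
  x-axis.\<close>

definition triacontagonal_numbering ::
  "real^4 \<Rightarrow> real^4 \<Rightarrow> (nat \<Rightarrow> real^4) \<Rightarrow> bool" where
  "triacontagonal_numbering p q u \<longleftrightarrow>
     coxeter_frame p q \<and>
     u ` {1..300} \<subseteq> vertices \<and> bij_betw (\<lambda>n. ray (u n)) {1..300} rays \<and>
     (\<exists>R \<theta>.
        (\<forall>k<20. 0 < R k \<and> 0 \<le> \<theta> k \<and> \<theta> k < 2 * pi / 15) \<and>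
        (\<forall>k<20. \<forall>i<15.
           plane_proj p q (u (15 * k + i + 1)) = rcis (R k) (\<theta> k + real i * (2 * pi / 15))) \<and>
        (\<forall>k<20. \<forall>l<20. (circle k = circle l \<longrightarrow> R k = R l) \<and>
                        (circle k < circle l \<longrightarrow> R l < R k)))"

definition rotation_symmetry ::
  "real^4 \<Rightarrow> real^4 \<Rightarrow> (nat \<Rightarrow> real^4) \<Rightarrow> (real^4 \<Rightarrow> real^4) \<Rightarrow> bool" where
  "rotation_symmetry p q u g \<longleftrightarrow>
     symmetry g \<and>
     (\<forall>x. plane_proj p q (g x) = cis (2 * pi / 15) * plane_proj p q x) \<and>
     (\<forall>k<20. \<forall>i<15. g ` ray (u (15 * k + i + 1)) = ray (u (15 * k + (i + 1) mod 15 + 1)))"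

datatype letter =
    La | Lb | Lc | Ld | Le | Lf | Lg | Lh | Li | Lj | Lk | Ll | Lm | Ln | Lo | Lp
  | Lq | Lr | Ls | Lt | Lu | Lv | Lw | Lx | Ly | Lz | La' | Lb' | Lc' | Ld' | Le'
  | Lf' | Lg' | Lh' | Li' | Lj' | Lk' | Ll' | Lm' | Ln' | Lo' | Lp' | Lq' | Lr' | Ls'

fun generator :: "letter \<Rightarrow> nat set" where
    "generator La = {1, 20, 274, 296}"
  | "generator Lb = {1, 42, 268, 291}"
  | "generator Lc = {1, 50, 245, 286}"
  | "generator Ld = {1, 65, 222, 289}"
  | "generator Le = {1, 87, 230, 298}"
  | "generator Lf = {1, 95, 207, 292}"
  | "generator Lg = {1, 117, 185, 295}"
  | "generator Lh = {1, 155, 192, 215}"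
  | "generator Li = {1, 177, 200, 237}"
  | "generator Lj = {16, 20, 265, 266}"
  | "generator Lk = {16, 65, 228, 275}"
  | "generator Ll = {16, 102, 193, 280}"
  | "generator Lm = {16, 117, 221, 246}"
  | "generator Ln = {16, 139, 178, 259}"
  | "generator Lo = {16, 140, 176, 268}"
  | "generator Lp = {16, 147, 177, 256}"
  | "generator Lq = {31, 35, 280, 281}"
  | "generator Lr = {31, 87, 224, 267}"
  | "generator Ls = {31, 95, 231, 244}"
  | "generator Lt = {31, 110, 199, 262}"
  | "generator Lu = {31, 125, 155, 271}"
  | "generator Lv = {31, 132, 156, 274}"
  | "generator Lw = {31, 133, 154, 283}"
  | "generator Lx = {46, 65, 183, 269}"
  | "generator Ly = {46, 64, 224, 253}"
  | "generator Lz = {46, 79, 201, 280}"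
  | "generator La' = {46, 80, 235, 244}"
  | "generator Lb' = {46, 94, 200, 247}"
  | "generator Lc' = {46, 110, 184, 250}"
  | "generator Ld' = {46, 125, 168, 246}"
  | "generator Le' = {46, 139, 156, 251}"
  | "generator Lf' = {61, 80, 212, 229}"
  | "generator Lg' = {61, 94, 209, 215}"
  | "generator Lh' = {61, 118, 131, 298}"
  | "generator Li' = {61, 116, 193, 224}"
  | "generator Lj' = {61, 140, 162, 234}"
  | "generator Lk' = {76, 94, 141, 289}"
  | "generator Ll' = {76, 96, 199, 228}"
  | "generator Lm' = {76, 118, 183, 237}"
  | "generator Ln' = {76, 132, 170, 218}"
  | "generator Lo' = {91, 116, 187, 200}"
  | "generator Lp' = {91, 124, 172, 192}"
  | "generator Lq' = {106, 148, 160, 200}"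
  | "generator Lr' = {121, 123, 156, 163}"
  | "generator Ls' = {136, 138, 171, 178}"

definition move_basis :: "(real^4 \<Rightarrow> real^4) \<Rightarrow> (real^4) set set \<Rightarrow> (real^4) set set" where
  "move_basis g B = (\<lambda>r. g ` r) ` B"

definition basis_orbit ::
  "(real^4 \<Rightarrow> real^4) \<Rightarrow> (nat \<Rightarrow> real^4) \<Rightarrow> letter \<Rightarrow> (real^4) set set set" where
  "basis_orbit g u l = {(move_basis g ^^ m) ((\<lambda>n. ray (u n)) ` generator l) | m. True}"

definition word_bases ::
  "(real^4 \<Rightarrow> real^4) \<Rightarrow> (nat \<Rightarrow> real^4) \<Rightarrow> letter set \<Rightarrow> (real^4) set set set" where
  "word_bases g u w = (\<Union>l\<in>w. basis_orbit g u l)"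

text \<open>The geometric conventions above leave open the exact position of the x-axis, the choice
  between the two antipodal pentadecagons representing the same fifteen rays, and the order of the
  two pentadecagons on a common circle. The numbering meant is the one for which the bases are
  those given by the table of generators.\<close>

definition numbering ::
  "real^4 \<Rightarrow> real^4 \<Rightarrow> (nat \<Rightarrow> real^4) \<Rightarrow> (real^4 \<Rightarrow> real^4) \<Rightarrow> bool" where
  "numbering p q u g \<longleftrightarrow>
     triacontagonal_numbering p q u \<and> rotation_symmetry p q u g \<and>
     bases = word_bases g u UNIV"

definition parity_proof :: "(real^4) set set set \<Rightarrow> bool" where
  "parity_proof S \<longleftrightarrow> S \<subseteq> bases \<and> odd (card S) \<and> (\<forall>r\<in>rays. even (card {B \<in> S. r \<in> B}))"

definition fifteen_fold_parity_proof ::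
  "(real^4 \<Rightarrow> real^4) \<Rightarrow> (real^4) set set set \<Rightarrow> bool" where
  "fifteen_fold_parity_proof g S \<longleftrightarrow> parity_proof S \<and> move_basis g ` S = S"

definition even_words :: "letter set set" where
  "even_words = {
    {Lj, Lq},
    {Lj, Lr'},
    {Lj, Ls'},
    {Ln, Lo},
    {Ln, Lp},
    {Lu, Lv},
    {Lu, Lw},
    {Lc, Ld, Lj, Ly},
    {Lc, Le, Lj, La'},
    {Lc, Lf, Lj, Lb'},
    {Lc, Lg, Lj, Lc'},
    {Ld, Le, Lj, Lf'},
    {Ld, Lf, Lj, Lg'},
    {Ld, Lg, Lj, Li'},
    {Le, Lf, Lj, Ll'},
    {Le, Lg, Lj, Lm'},
    {Lf, Lg, Lj, Lo'},
    {La, Lb, Ld, Le, Lk, Lr},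
    {La, Lb, Lf, Lg, Ll, Lt},
    {Lb, Lc, Lk, Ll, Ls, Lx},
    {La, Lh, Lk, Ll, Lm, Ls, Lu, Lh'},
    {La, Lb, Lh, Li, Lj, Ll, Lm, Ln, Ls, Lq'},
    {La, Lc, Ld, Le, Lf, Lg, Lk, Ll, Lm, Lz},
    {La, Lc, Lf, Lg, Lh, Li, Lm, Ls, Lu, Ld'},
    {Lb, Lc, Lf, Lg, Lh, Li, Lm, Ln, Ls, Le'},
    {Lf, Lg, Lh, Li, Lj, Ll, Lm, Ls, Lu, Lp'},
    {La, Lb, Lf, Lg, Lh, Li, Lj, Lk, Lm, Ln, Ls, Lj'},
    {Lb, Ld, Le, Lf, Lg, Li, Lk, Ll, Lm, Ln, Ls, Lk'},
    {Ld, Le, Lf, Lg, Lh, Li, Lj, Lk, Lm, Ls, Lu, Ln'}}"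

definition algorithm_word :: "letter set set \<Rightarrow> letter set" where
  "algorithm_word T = sym_diff (Finite_Set.fold sym_diff {} T) {Lj}"

end

(* The 120-cell has coordinates in Z[golden], so the orthogonality of rays is decided by integer
   arithmetic, and so are the orthogonality graph and the orbits of the symmetry g, which is the
   square of a Coxeter element c. The Coxeter plane is an eigenspace of c + c^-1; since
   2 cos(pi/15) is quadratic over Q(golden), the angles and radii of the projected vertices are
   compared by computations in a ring of rank 4 over Z.

   A set of bases that is invariant under g is a union of orbits, and the orbit of a basis covers
   each ray of a pentadecagon as often as the basis meets that pentadecagon. Being a parity proof is
   therefore a system of linear equations over GF(2) for the letters of the word: one equation for
   each pentadecagon, and odd length. Its solutions are {j} plus those of the homogeneous system. The
   29 even words are a basis of the latter in echelon form: the last letter of each word occurs in no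
   other word, and a homogeneous solution without such letters is empty. *)

theory Submission
  imports Defs
begin

section \<open>Orbits of bases\<close>

text \<open>The geometry is needed only to show that a numbering exists. The count holds for an
  arbitrary numbering and uses three facts about it: the rays are in bijection with 1 to 300,
  \<open>g\<close> acts on them by a cyclic shift, and the table lists all bases.

  What shapes the first half is that the finite facts are established by rewriting with
  \<open>code_simp\<close>, so their number has to be kept small. Rotational symmetry reduces every
  check on pairs of rays to pairs containing the first ray of a pentadecagon. Quadruples are never
  enumerated: a ray orthogonal to a given one lies with it in a basis of the table that already
  contains every ray orthogonal to both.

  The element \<open>c\<close> turns the plane by 12 degrees. Since 180 + 12 = 8 * 24, it sends each
  representative to the negative of the one 8 places ahead, and \<open>c^2\<close> advances by 16,
  that is by 1 modulo 15.

  The letter \<open>j\<close> alone is a parity proof because its basis has two rays in each of two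
  pentadecagons. The ray equations do not see it; only the length does.\<close>

lemma UNIV_letter: "(UNIV :: letter set) = {La, Lb, Lc, Ld, Le, Lf, Lg, Lh, Li, Lj, Lk, Ll, Lm, Ln,
  Lo, Lp, Lq, Lr, Ls, Lt, Lu, Lv, Lw, Lx, Ly, Lz, La', Lb', Lc', Ld', Le', Lf', Lg', Lh', Li', Lj',
  Lk', Ll', Lm', Ln', Lo', Lp', Lq', Lr', Ls'}"
proof -
  have "l \<in> {La, Lb, Lc, Ld, Le, Lf, Lg, Lh, Li, Lj, Lk, Ll, Lm, Ln,
  Lo, Lp, Lq, Lr, Ls, Lt, Lu, Lv, Lw, Lx, Ly, Lz, La', Lb', Lc', Ld', Le', Lf', Lg', Lh', Li', Lj',
  Lk', Ll', Lm', Ln', Lo', Lp', Lq', Lr', Ls'}" for l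
    by (cases l) simp_all
  then show ?thesis by blast
qed

lemma finite_letter [simp]: "finite (w :: letter set)"
  by (rule finite_subset[OF subset_UNIV]) (simp add: UNIV_letter)

section \<open>Ray numbers under the rotation\<close>

definition pent :: "nat \<Rightarrow> nat" where
  "pent n = (n - 1) div 15"

text \<open>The action of \<open>g ^^ m\<close> on ray numbers. Numbers start at 1, so the position
  in a pentadecagon is read from \<open>n - 1\<close>.\<close>

definition shift :: "nat \<Rightarrow> nat \<Rightarrow> nat" where
  "shift m n = 15 * pent n + ((n - 1) mod 15 + m) mod 15 + 1"

definition index_orbit :: "letter \<Rightarrow> nat set set" where
  "index_orbit l = (\<lambda>m. shift m ` generator l) ` {..<15}"

lemma pent_shift [simp]: "pent (shift m n) = pent n"
  by (simp add: pent_def shift_def)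

lemma shift_shift: "shift m (shift m' n) = shift (m + m') n"
proof -
  have "((x + m') mod 15 + m) mod 15 = (x + (m + m')) mod 15" for x
    by (simp add: mod_simps ac_simps)
  then show ?thesis
    by (simp add: shift_def pent_def del: One_nat_def)
qed

lemma shift_mod: "shift (m mod 15) n = shift m n"
  by (simp add: shift_def mod_simps)

lemma shift_0: "0 < n \<Longrightarrow> shift 0 n = n"
  using div_mult_mod_eq[of "n - 1" 15] by (simp add: shift_def pent_def)

lemma shift_15: "0 < n \<Longrightarrow> shift 15 n = n"
  using shift_mod[of 15 n] by (simp add: shift_0)

lemma shift_in: "n \<in> {1..300} \<Longrightarrow> shift m n \<in> {1..300}"
proof -
  assume "n \<in> {1..300}"
  then have "pent n < 20" by (auto simp: pent_def)
  moreover have "((n - 1) mod 15 + m) mod 15 < 15" by simp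
  ultimately show ?thesis unfolding shift_def by (auto simp del: mod_less_divisor)
qed

lemma add_mod_15_eq_iff:
  fixes i j :: nat
  assumes "i < 15" "j < 15"
  shows "{m. m < 15 \<and> (i + m) mod 15 = j} = {(j + (15 - i)) mod 15}"
proof -
  \<comment> \<open>All sums that occur are below 30, so \<open>mod\<close> becomes a case
    distinction and the rest is linear.\<close>
  have small: "k mod 15 = (if k < 15 then k else k - 15)" if "k < 30" for k :: nat
    using that by (auto simp: mod_if)
  have "m < 15 \<and> (i + m) mod 15 = j \<longleftrightarrow> m = (j + (15 - i)) mod 15" for m
  proof (cases "m < 15")
    case True
    have "(i + m) mod 15 = (if i + m < 15 then i + m else i + m - 15)"
      "(j + (15 - i)) mod 15 = (if j + (15 - i) < 15 then j + (15 - i) else j + (15 - i) - 15)"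
      by (rule small, use True assms in linarith)+
    then show ?thesis using True assms by (simp del: mod_less) linarith
  next
    case False
    then show ?thesis by (auto simp: not_less)
  qed
  then show ?thesis by auto
qed

text \<open>The fifteen shifts act simply transitively on each pentadecagon. This turns counting
  bases through a ray into counting rays of a generator by pentadecagon.\<close>

lemma card_shift_eq:
  assumes "0 < a" "0 < n"
  shows "card {m. m < 15 \<and> shift m a = n} = of_bool (pent a = pent n)"
proof (cases "pent a = pent n")
  case True
  let ?i = "(a - 1) mod 15" and ?j = "(n - 1) mod 15"
  have n: "n = 15 * pent n + ?j + 1"
    using \<open>0 < n\<close> div_mult_mod_eq[of "n - 1" 15] by (simp add: pent_def)
  have "shift m a = n \<longleftrightarrow> (?i + m) mod 15 = ?j" for m
    using True n by (auto simp: shift_def)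
  then have "{m. m < 15 \<and> shift m a = n} = {m. m < 15 \<and> (?i + m) mod 15 = ?j}" by auto
  also have "\<dots> = {(?j + (15 - ?i)) mod 15}"
    by (intro add_mod_15_eq_iff) simp_all
  finally show ?thesis using True by simp
next
  case False
  then have "{m. m < 15 \<and> shift m a = n} = {}" by auto
  then show ?thesis using False by simp
qed

section \<open>The 675 translates of the generators are distinct\<close>

lemma finite_generator [simp]: "finite (generator l)"
  by (cases l) simp_all

lemma generator_range: "generator l \<subseteq> {1..300}"
  by (cases l) simp_all

lemma generator_pos: "a \<in> generator l \<Longrightarrow> 0 < a"
  using generator_range by force

text \<open>A copy of the table in lists of integers, which are evaluated in binary and without set
  operations.\<close>

primrec generator_list :: "letter \<Rightarrow> int list" where
    "generator_list La = [1, 20, 274, 296]"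
  | "generator_list Lb = [1, 42, 268, 291]"
  | "generator_list Lc = [1, 50, 245, 286]"
  | "generator_list Ld = [1, 65, 222, 289]"
  | "generator_list Le = [1, 87, 230, 298]"
  | "generator_list Lf = [1, 95, 207, 292]"
  | "generator_list Lg = [1, 117, 185, 295]"
  | "generator_list Lh = [1, 155, 192, 215]"
  | "generator_list Li = [1, 177, 200, 237]"
  | "generator_list Lj = [16, 20, 265, 266]"
  | "generator_list Lk = [16, 65, 228, 275]"
  | "generator_list Ll = [16, 102, 193, 280]"
  | "generator_list Lm = [16, 117, 221, 246]"
  | "generator_list Ln = [16, 139, 178, 259]"
  | "generator_list Lo = [16, 140, 176, 268]"
  | "generator_list Lp = [16, 147, 177, 256]"
  | "generator_list Lq = [31, 35, 280, 281]"
  | "generator_list Lr = [31, 87, 224, 267]"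
  | "generator_list Ls = [31, 95, 231, 244]"
  | "generator_list Lt = [31, 110, 199, 262]"
  | "generator_list Lu = [31, 125, 155, 271]"
  | "generator_list Lv = [31, 132, 156, 274]"
  | "generator_list Lw = [31, 133, 154, 283]"
  | "generator_list Lx = [46, 65, 183, 269]"
  | "generator_list Ly = [46, 64, 224, 253]"
  | "generator_list Lz = [46, 79, 201, 280]"
  | "generator_list La' = [46, 80, 235, 244]"
  | "generator_list Lb' = [46, 94, 200, 247]"
  | "generator_list Lc' = [46, 110, 184, 250]"
  | "generator_list Ld' = [46, 125, 168, 246]"
  | "generator_list Le' = [46, 139, 156, 251]"
  | "generator_list Lf' = [61, 80, 212, 229]"
  | "generator_list Lg' = [61, 94, 209, 215]"
  | "generator_list Lh' = [61, 118, 131, 298]"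
  | "generator_list Li' = [61, 116, 193, 224]"
  | "generator_list Lj' = [61, 140, 162, 234]"
  | "generator_list Lk' = [76, 94, 141, 289]"
  | "generator_list Ll' = [76, 96, 199, 228]"
  | "generator_list Lm' = [76, 118, 183, 237]"
  | "generator_list Ln' = [76, 132, 170, 218]"
  | "generator_list Lo' = [91, 116, 187, 200]"
  | "generator_list Lp' = [91, 124, 172, 192]"
  | "generator_list Lq' = [106, 148, 160, 200]"
  | "generator_list Lr' = [121, 123, 156, 163]"
  | "generator_list Ls' = [136, 138, 171, 178]"

definition shift_int :: "int \<Rightarrow> int \<Rightarrow> int" where
  "shift_int m n = 15 * ((n - 1) div 15) + ((n - 1) mod 15 + m) mod 15 + 1"

lemma int_shift: "0 < n \<Longrightarrow> int (shift m n) = shift_int (int m) (int n)"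
  by (simp add: shift_def shift_int_def pent_def zdiv_int zmod_int of_nat_diff)

definition letters :: "letter list" where
  "letters = [La, Lb, Lc, Ld, Le, Lf, Lg, Lh, Li, Lj, Lk, Ll, Lm, Ln, Lo, Lp, Lq, Lr, Ls, Lt, Lu, Lv,
    Lw, Lx, Ly, Lz, La', Lb', Lc', Ld', Le', Lf', Lg', Lh', Li', Lj', Lk', Ll', Lm', Ln', Lo', Lp',
    Lq', Lr', Ls']"

text \<open>Every list starts with the first ray \<open>a\<close> of a pentadecagon, which a shift
  by \<open>d < 15\<close> moves to \<open>a + d\<close> without wraparound. If the shifted
  generator equals another one, then \<open>d = y - a\<close> for some member \<open>y\<close> of
  the latter, so only these differences are tried.\<close>

lemma generator_list_shifts:
  "list_all (\<lambda>l. let xs = generator_list l; a = hd xs in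
     list_all (\<lambda>l'. let ys = generator_list l' in list_all (\<lambda>y.
       let d = y - a in
         d < 0 \<or> 14 < d \<or> d = 0 \<and> l = l' \<or> \<not> list_all (\<lambda>x. List.member ys (shift_int d x)) xs)
     ys) letters) letters"
  by code_simp

lemma set_letters: "set letters = UNIV"
  by (simp add: letters_def UNIV_letter)

lemma generator_list: "int ` generator l = set (generator_list l)"
  by (cases l) simp_all


lemma shift_int_aligned: "shift_int d x = x + d" if "x mod 15 = 1" "0 \<le> d" "d < 15"
proof -
  from that(1) obtain k where "x = 15 * k + 1" by (metis mult_div_mod_eq)
  then show ?thesis using that(2,3) by (simp add: shift_int_def)
qed

lemma shift_generator_eqD:
  assumes "shift d ` generator l = generator l'" "d < 15"
  shows "d = 0 \<and> l = l'"
proof -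
  define xs where "xs = generator_list l"
  define ys where "ys = generator_list l'"
  have ne: "xs \<noteq> []" unfolding xs_def by (cases l) simp_all
  have gen: "int ` generator l = set xs" "int ` generator l' = set ys"
    by (simp_all add: generator_list xs_def ys_def)
  have sh: "shift_int (int d) x \<in> set ys" if "x \<in> set xs" for x
  proof -
    have "x \<in> int ` generator l" using that gen(1) by simp
    then obtain a where a: "a \<in> generator l" "x = int a" by blast
    then have "shift d a \<in> generator l'" using assms(1) by blast
    then show ?thesis using a gen int_shift[OF generator_pos[OF a(1)], of d] by force
  qed
  have hd: "hd xs mod 15 = 1" unfolding xs_def by (cases l) simp_all
  from hd have "shift_int (int d) (hd xs) = hd xs + int d"
    using \<open>d < 15\<close> by (intro shift_int_aligned) simp_all
  then have *: "hd xs + int d \<in> set ys" using sh[of "hd xs"] ne by simp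
  have L: "\<forall>l l'. \<forall>y\<in>set (generator_list l'). let d = y - hd (generator_list l) in
      d < 0 \<or> 14 < d \<or> d = 0 \<and> l = l' \<or>
      \<not> list_all (\<lambda>x. List.member (generator_list l') (shift_int d x)) (generator_list l)"
    using generator_list_shifts unfolding list_all_iff[of _ letters] set_letters Let_def
    by (simp add: list_all_iff[of _ "generator_list _"])
  have "let d' = hd xs + int d - hd xs in d' < 0 \<or> 14 < d' \<or> d' = 0 \<and> l = l' \<or>
      \<not> list_all (\<lambda>x. List.member ys (shift_int d' x)) xs"
    using L * unfolding xs_def ys_def by blast
  then show ?thesis
    using sh \<open>d < 15\<close> by (auto simp: list_all_iff Let_def)
qed

lemma shift_image_shift: "shift m ` shift m' ` A = shift (m + m') ` A"
  by (simp add: image_image shift_shift)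

lemma index_orbit_inj:
  assumes eq: "shift m ` generator l = shift m' ` generator l'" and "m < 15" "m' < 15"
  shows "m = m' \<and> l = l'"
proof -
  \<comment> \<open>Undoing the shift by \<open>m'\<close> on both sides leaves an unshifted
    generator on the right.\<close>
  have "shift ((15 - m' + m) mod 15) ` generator l = shift (15 - m' + m) ` generator l"
    by (simp add: shift_mod)
  also have "\<dots> = shift (15 - m') ` shift m' ` generator l'"
    by (simp add: shift_image_shift flip: eq)
  also have "\<dots> = shift 15 ` generator l'" using \<open>m' < 15\<close> by (simp add: shift_image_shift)
  also have "\<dots> = generator l'" using generator_pos[of _ l'] by (force simp: shift_15)
  finally have "(15 - m' + m) mod 15 = 0 \<and> l = l'" by (rule shift_generator_eqD) simp
  then have "(15 - m' + m) mod 15 = 0" "l = l'" by simp_all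
  from this(1) obtain k where k: "15 - m' + m = 15 * k" by auto
  \<comment> \<open>The multiple of 15 lies strictly between 0 and 30.\<close>
  then have "k = 1" using \<open>m < 15\<close> \<open>m' < 15\<close> by linarith
  with k show ?thesis using \<open>l = l'\<close> \<open>m' < 15\<close> by simp
qed

text \<open>Fifteen shifts are the identity, so \<open>shift (14 * m)\<close> inverts
  \<open>shift m\<close>. Zero is excluded because truncated subtraction gives it the same image as
  1.\<close>

lemma inj_shift: "inj_on (shift m) {0<..}"
proof (rule inj_onI)
  fix a b assume ab: "a \<in> {0<..}" "b \<in> {0<..}" "shift m a = shift m b"
  have "shift (15 * m) a = shift (14 * m) (shift m a)"
    "shift (15 * m) b = shift (14 * m) (shift m b)" by (simp_all add: shift_shift)
  then have "shift (15 * m mod 15) a = shift (15 * m mod 15) b"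
    using ab(3) unfolding shift_mod by simp
  then show "a = b" using ab(1,2) by (simp add: shift_0)
qed

text \<open>By distinctness, the translates containing \<open>n\<close> correspond to pairs of a
  letter and a shift. A ray of the generator is carried to \<open>n\<close> by exactly one shift if
  it lies in the pentadecagon of \<open>n\<close>, and by none otherwise.\<close>

lemma card_index_orbits:
  assumes "n \<in> {1..300}"
  shows "card {A \<in> \<Union> (index_orbit ` w). n \<in> A} =
    (\<Sum>l\<in>w. \<Sum>a\<in>generator l. of_bool (pent a = pent n))"
proof -
  let ?f = "\<lambda>(l, m). shift m ` generator l"
  let ?X = "SIGMA l:w. {m. m < 15 \<and> n \<in> shift m ` generator l}"
  have "{A \<in> \<Union> (index_orbit ` w). n \<in> A} = ?f ` ?X"
    by (auto simp: index_orbit_def image_iff)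
  moreover have "inj_on ?f ?X"
    by (auto simp: inj_on_def dest: index_orbit_inj)
  ultimately have "card {A \<in> \<Union> (index_orbit ` w). n \<in> A} = card ?X"
    by (simp add: card_image)
  also have "\<dots> = (\<Sum>l\<in>w. card {m. m < 15 \<and> n \<in> shift m ` generator l})"
    by (intro card_SigmaI) auto
  also have "\<dots> = (\<Sum>l\<in>w. \<Sum>a\<in>generator l. of_bool (pent a = pent n))"
  proof (intro sum.cong refl)
    fix l
    have "{m. m < 15 \<and> n \<in> shift m ` generator l}
        = (\<Union>a\<in>generator l. {m. m < 15 \<and> shift m a = n})" by auto
    also have "card \<dots> = (\<Sum>a\<in>generator l. card {m. m < 15 \<and> shift m a = n})"
    proof (rule card_UN_disjoint)
      show "\<forall>a\<in>generator l. \<forall>b\<in>generator l. a \<noteq> b \<longrightarrow>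
          {m. m < 15 \<and> shift m a = n} \<inter> {m. m < 15 \<and> shift m b = n} = {}"
        using inj_shift generator_pos[of _ l] unfolding inj_on_def by fastforce
    qed auto
    also have "\<dots> = (\<Sum>a\<in>generator l. of_bool (pent a = pent n))"
      using assms generator_pos[of _ l] by (intro sum.cong refl) (simp add: card_shift_eq)
    finally show "card {m. m < 15 \<and> n \<in> shift m ` generator l} = \<dots>" .
  qed
  finally show ?thesis .
qed

lemma card_index_orbits_total: "card (\<Union> (index_orbit ` w)) = 15 * card w"
proof -
  let ?f = "\<lambda>(l, m). shift m ` generator l"
  have "\<Union> (index_orbit ` w) = ?f ` (w \<times> {..<15})"
    by (auto simp: index_orbit_def image_iff)
  moreover have "inj_on ?f (w \<times> {..<15})"
    by (auto simp: inj_on_def dest: index_orbit_inj)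
  ultimately show ?thesis by (simp add: card_image card_cartesian_product)
qed

definition incidence :: "nat \<Rightarrow> letter \<Rightarrow> nat" where
  "incidence k l = (\<Sum>a\<in>generator l. of_bool (pent a = k))"

text \<open>The linear system modulo 2. The number of bases of a word is 15 times its length and so
  has the same parity.\<close>

definition parity_word :: "letter set \<Rightarrow> bool" where
  "parity_word w \<longleftrightarrow> odd (card w) \<and> (\<forall>k<20. even (\<Sum>l\<in>w. incidence k l))"

lemma in_index_orbit_range: "A \<in> index_orbit l \<Longrightarrow> A \<subseteq> {1..300}"
  using generator_range shift_in unfolding index_orbit_def by blast

lemma index_orbit_eq: "index_orbit l = range (\<lambda>m. shift m ` generator l)"
proof -
  have "shift m ` generator l \<in> (\<lambda>m. shift m ` generator l) ` {..<15}" for m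
    by (rule image_eqI[of _ _ "m mod 15"]) (simp_all add: shift_mod)
  then show ?thesis by (auto simp: index_orbit_def)
qed

lemma shift_pos: "0 < shift m n"
  by (simp add: shift_def)

lemma shift_index_orbit: "(`) (shift 1) ` index_orbit l = index_orbit l"
proof -
  \<comment> \<open>Shifting 14 places further supplies a preimage under
    \<open>shift 1\<close>.\<close>
  have "shift m ` generator l = shift 1 ` shift (m + 14) ` generator l" for m
  proof -
    have "shift m ` generator l = shift 15 ` shift m ` generator l"
      unfolding image_image by (rule image_cong) (simp_all add: shift_15 shift_pos)
    then show ?thesis by (simp add: shift_image_shift)
  qed
  note eq = this
  show ?thesis
  proof (intro set_eqI iffI)
    fix A assume "A \<in> (`) (shift 1) ` index_orbit l"
    then obtain m where "A = shift 1 ` shift m ` generator l" unfolding index_orbit_eq by blast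
    then show "A \<in> index_orbit l" unfolding index_orbit_eq shift_image_shift by blast
  next
    fix A assume "A \<in> index_orbit l"
    then obtain m where "A = shift m ` generator l" unfolding index_orbit_eq by blast
    then have "A = shift 1 ` shift (m + 14) ` generator l" using eq[of m] by (rule trans)
    then show "A \<in> (`) (shift 1) ` index_orbit l" unfolding index_orbit_eq by blast
  qed
qed

section \<open>From ray numbers to bases of rays\<close>

definition ray_of :: "(nat \<Rightarrow> real^4) \<Rightarrow> nat \<Rightarrow> (real^4) set" where
  "ray_of u n = ray (u n)"

text \<open>These two assumptions, together with the completeness of the table in the inner context,
  are all that the count takes from a numbering.\<close>

context
  fixes u :: "nat \<Rightarrow> real^4" and g :: "real^4 \<Rightarrow> real^4"
  assumes bij: "bij_betw (\<lambda>n. ray (u n)) {1..300} rays"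
    and rot: "\<And>n. n \<in> {1..300} \<Longrightarrow> g ` ray (u n) = ray (u (shift 1 n))"
begin

lemma move_basis_R:
  assumes "A \<subseteq> {1..300}"
  shows "move_basis g (ray_of u ` A) = ray_of u ` shift 1 ` A"
  unfolding move_basis_def image_image
proof (rule image_cong)
  fix n assume "n \<in> A"
  then have "n \<in> {1..300}" using assms by blast
  then show "g ` ray_of u n = ray_of u (shift 1 n)" unfolding ray_of_def by (rule rot)
qed simp

lemma move_basis_iterate:
  "A \<subseteq> {1..300} \<Longrightarrow> (move_basis g ^^ m) (ray_of u ` A) = ray_of u ` shift m ` A"
proof (induction m)
  case 0
  then have "shift 0 ` A = A" by (force simp: shift_0)
  then show ?case by simp
next
  case (Suc m)
  have "shift m ` A \<subseteq> {1..300}" using Suc.prems shift_in by blast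
  then show ?case using Suc by (simp add: move_basis_R shift_image_shift)
qed

lemma basis_orbit_eq: "basis_orbit g u l = (`) (ray_of u) ` index_orbit l"
  unfolding basis_orbit_def index_orbit_eq
  using move_basis_iterate[OF generator_range, of _ l] by (auto simp: ray_of_def)

lemma word_bases_eq: "word_bases g u w = (`) (ray_of u) ` \<Union> (index_orbit ` w)"
  by (auto simp: word_bases_def basis_orbit_eq)

lemma inj_R: "inj_on (ray_of u) {1..300}" and rays_R: "rays = ray_of u ` {1..300}"
  using bij by (simp_all add: bij_betw_def ray_of_def[abs_def])

lemma inj_image_R: "inj_on ((`) (ray_of u)) (Pow {1..300})"
  using inj_R by (rule inj_on_image_Pow)

lemma orbits_range: "\<Union> (index_orbit ` w) \<subseteq> Pow {1..300}"
  using in_index_orbit_range by blast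

lemma card_word_bases: "card (word_bases g u w) = 15 * card w"
  unfolding word_bases_eq
  using card_image[OF inj_on_subset[OF inj_image_R orbits_range]] card_index_orbits_total by simp

lemma card_word_bases_ray:
  assumes "n \<in> {1..300}"
  shows "card {B \<in> word_bases g u w. ray_of u n \<in> B} = (\<Sum>l\<in>w. incidence (pent n) l)"
proof -
  have "{B \<in> word_bases g u w. ray_of u n \<in> B} = (`) (ray_of u) ` {A \<in> \<Union> (index_orbit ` w). n \<in> A}"
  proof -
    have "ray_of u n \<in> ray_of u ` A \<longleftrightarrow> n \<in> A" if "A \<in> \<Union> (index_orbit ` w)" for A
      using that orbits_range[of w] by (intro inj_on_image_mem_iff[OF inj_R assms]) auto
    then show ?thesis unfolding word_bases_eq by auto
  qed
  moreover have "inj_on ((`) (ray_of u)) {A \<in> \<Union> (index_orbit ` w). n \<in> A}"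
    using orbits_range[of w] by (intro inj_on_subset[OF inj_image_R]) auto
  ultimately show ?thesis
    using card_index_orbits[OF assms, of w] by (simp add: card_image incidence_def)
qed

lemma move_word_bases: "move_basis g ` word_bases g u w = word_bases g u w"
proof -
  have "move_basis g ` (`) (ray_of u) ` index_orbit l = (`) (ray_of u) ` ((`) (shift 1) ` index_orbit l)" for l
    unfolding image_image[of "move_basis g"] image_image[of "(`) (ray_of u)"]
    by (intro image_cong refl move_basis_R in_index_orbit_range)
  then show ?thesis
    by (simp add: image_UN shift_index_orbit word_bases_def basis_orbit_eq del: One_nat_def)
qed

lemma pent_image: "pent ` {1..300} = {..<20}"
proof
  show "{..<20} \<subseteq> pent ` {1..300}"
  proof
    fix k :: nat assume "k \<in> {..<20}"
    then show "k \<in> pent ` {1..300}"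
      by (intro image_eqI[of _ _ "15 * k + 1"]) (auto simp: pent_def)
  qed
qed (auto simp: pent_def)

context
  assumes bases: "bases = word_bases g u UNIV"
begin

text \<open>Invariance under \<open>g\<close> is automatic for a union of orbits. The number of
  bases through a ray depends only on its pentadecagon, and all twenty pentadecagons occur.\<close>

lemma fifteen_fold_word_bases:
  "fifteen_fold_parity_proof g (word_bases g u w) \<longleftrightarrow> parity_word w"
proof -
  have "word_bases g u w \<subseteq> bases" unfolding bases by (auto simp: word_bases_def)
  moreover have "(\<forall>r\<in>rays. even (card {B \<in> word_bases g u w. r \<in> B})) \<longleftrightarrow>
      (\<forall>k\<in>pent ` {1..300}. even (\<Sum>l\<in>w. incidence k l))"
    by (simp add: rays_R card_word_bases_ray)
  ultimately show ?thesis
    unfolding fifteen_fold_parity_proof_def parity_proof_def parity_word_def pent_image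
    by (auto simp: card_word_bases move_word_bases)
qed

lemma generator_in_orbit_iff: "generator l \<in> index_orbit l' \<longleftrightarrow> l = l'"
proof -
  have "shift 0 ` generator l = generator l"
    using generator_pos[of _ l] by (force simp: shift_0)
  then have "l = l'" if "generator l = shift m ` generator l'" "m < 15" for m
    using index_orbit_inj[of 0 l m l'] that by simp
  moreover have "generator l \<in> index_orbit l"
    unfolding index_orbit_def
    by (rule image_eqI[of _ _ 0]) (simp_all add: \<open>shift 0 ` generator l = generator l\<close>)
  ultimately show ?thesis by (auto simp: index_orbit_def)
qed

text \<open>A word can be read off from its set of bases by testing the generators; this gives
  uniqueness of the word.\<close>

lemma word_bases_generator: "ray_of u ` generator l \<in> word_bases g u w \<longleftrightarrow> l \<in> w"
proof -
  have "ray_of u ` generator l \<in> word_bases g u w \<longleftrightarrow> generator l \<in> \<Union> (index_orbit ` w)"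
    unfolding word_bases_eq
    using inj_on_image_mem_iff[OF inj_image_R, of "generator l"] orbits_range generator_range by simp
  then show ?thesis by (auto simp: generator_in_orbit_iff)
qed

lemma inj_word_bases: "inj (word_bases g u)"
  by (rule injI) (metis word_bases_generator set_eqI)

text \<open>An invariant set contains either all translates of a generator or none: shifts lead from
  the generator to any translate, and 14 times the same shift leads back.\<close>

lemma fifteen_fold_is_word:
  assumes "fifteen_fold_parity_proof g S"
  shows "S = word_bases g u {l. ray_of u ` generator l \<in> S}"
proof -
  have S: "S \<subseteq> word_bases g u UNIV" and inv: "move_basis g ` S = S"
    using assms by (auto simp: fifteen_fold_parity_proof_def parity_proof_def bases)
  have step: "ray_of u ` shift m ` A \<in> S" if "ray_of u ` A \<in> S" "A \<subseteq> {1..300}" for A m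
  proof -
    have "(move_basis g ^^ m) B \<in> S" if "B \<in> S" for B
      using that inv by (induction m) auto
    then show ?thesis using that by (simp flip: move_basis_iterate)
  qed
  have "ray_of u ` shift m ` generator l \<in> S \<longleftrightarrow> ray_of u ` generator l \<in> S" for l m
  proof
    assume *: "ray_of u ` shift m ` generator l \<in> S"
    have "ray_of u ` shift (14 * m) ` shift m ` generator l \<in> S"
      using generator_range[of l] shift_in by (intro step[OF *]) blast
    also have "shift (14 * m) ` shift m ` generator l = shift (15 * m mod 15) ` generator l"
      unfolding shift_image_shift shift_mod by simp
    also have "\<dots> = generator l" using generator_pos[of _ l] by (force simp: shift_0)
    finally show "ray_of u ` generator l \<in> S" .
  next
    assume "ray_of u ` generator l \<in> S"
    then show "ray_of u ` shift m ` generator l \<in> S" using generator_range by (rule step)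
  qed
  note iff = this
  show ?thesis
  proof (intro set_eqI iffI)
    fix B assume "B \<in> S"
    then obtain l m where "B = ray_of u ` shift m ` generator l"
      using S unfolding word_bases_eq index_orbit_eq by blast
    then show "B \<in> word_bases g u {l. ray_of u ` generator l \<in> S}"
      using \<open>B \<in> S\<close> iff unfolding word_bases_eq index_orbit_eq by blast
  next
    fix B assume "B \<in> word_bases g u {l. ray_of u ` generator l \<in> S}"
    then show "B \<in> S" using iff unfolding word_bases_eq index_orbit_eq by blast
  qed
qed

lemma bij_word_bases:
  "bij_betw (word_bases g u) {w. parity_word w} {S. fifteen_fold_parity_proof g S}"
proof (rule bij_betwI')
  fix S assume "S \<in> {S. fifteen_fold_parity_proof g S}"
  then have S: "fifteen_fold_parity_proof g S" by simp
  let ?w = "{l. ray_of u ` generator l \<in> S}"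
  have eq: "S = word_bases g u ?w" using S by (rule fifteen_fold_is_word)
  then have "parity_word ?w" using S fifteen_fold_word_bases[of ?w] by metis
  with eq show "\<exists>w\<in>{w. parity_word w}. S = word_bases g u w" by blast
qed (auto simp: fifteen_fold_word_bases inj_eq[OF inj_word_bases])

end

end

section \<open>Linear algebra over the field with two elements\<close>

text \<open>Each even word is indexed by its pivot, the letter that it shares with no other. The
  catch-all value for the remaining letters is a filler.\<close>

fun pivot_word :: "letter \<Rightarrow> letter set" where
   "pivot_word Lq = {Lj, Lq}"
 | "pivot_word Lr' = {Lj, Lr'}"
 | "pivot_word Ls' = {Lj, Ls'}"
 | "pivot_word Lo = {Ln, Lo}"
 | "pivot_word Lp = {Ln, Lp}"
 | "pivot_word Lv = {Lu, Lv}"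
 | "pivot_word Lw = {Lu, Lw}"
 | "pivot_word Ly = {Lc, Ld, Lj, Ly}"
 | "pivot_word La' = {Lc, Le, Lj, La'}"
 | "pivot_word Lb' = {Lc, Lf, Lj, Lb'}"
 | "pivot_word Lc' = {Lc, Lg, Lj, Lc'}"
 | "pivot_word Lf' = {Ld, Le, Lj, Lf'}"
 | "pivot_word Lg' = {Ld, Lf, Lj, Lg'}"
 | "pivot_word Li' = {Ld, Lg, Lj, Li'}"
 | "pivot_word Ll' = {Le, Lf, Lj, Ll'}"
 | "pivot_word Lm' = {Le, Lg, Lj, Lm'}"
 | "pivot_word Lo' = {Lf, Lg, Lj, Lo'}"
 | "pivot_word Lr = {La, Lb, Ld, Le, Lk, Lr}"
 | "pivot_word Lt = {La, Lb, Lf, Lg, Ll, Lt}"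
 | "pivot_word Lx = {Lb, Lc, Lk, Ll, Ls, Lx}"
 | "pivot_word Lh' = {La, Lh, Lk, Ll, Lm, Ls, Lu, Lh'}"
 | "pivot_word Lq' = {La, Lb, Lh, Li, Lj, Ll, Lm, Ln, Ls, Lq'}"
 | "pivot_word Lz = {La, Lc, Ld, Le, Lf, Lg, Lk, Ll, Lm, Lz}"
 | "pivot_word Ld' = {La, Lc, Lf, Lg, Lh, Li, Lm, Ls, Lu, Ld'}"
 | "pivot_word Le' = {Lb, Lc, Lf, Lg, Lh, Li, Lm, Ln, Ls, Le'}"
 | "pivot_word Lp' = {Lf, Lg, Lh, Li, Lj, Ll, Lm, Ls, Lu, Lp'}"
 | "pivot_word Lj' = {La, Lb, Lf, Lg, Lh, Li, Lj, Lk, Lm, Ln, Ls, Lj'}"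
 | "pivot_word Lk' = {Lb, Ld, Le, Lf, Lg, Li, Lk, Ll, Lm, Ln, Ls, Lk'}"
 | "pivot_word Ln' = {Ld, Le, Lf, Lg, Lh, Li, Lj, Lk, Lm, Ls, Lu, Ln'}"
 | "pivot_word _ = {}"

definition pivots :: "letter set" where
  "pivots = {Lq, Lr', Ls', Lo, Lp, Lv, Lw, Ly, La', Lb', Lc', Lf', Lg', Li', Ll', Lm',
    Lo', Lr, Lt, Lx, Lh', Lq', Lz, Ld', Le', Lp', Lj', Lk', Ln'}"

text \<open>Certificates that the columns of the 16 letters that are not pivots are independent:
  rows of a left inverse of these columns modulo 2, each given by the equations to be added. The
  length equation enters only for \<open>Lj\<close>, because every pentadecagon equation has an even
  coefficient there.\<close>

fun dual_pents :: "letter \<Rightarrow> int set" where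
   "dual_pents La = {0, 3, 5, 7, 9, 13, 14, 17}"
 | "dual_pents Lb = {9, 17}"
 | "dual_pents Lc = {3}"
 | "dual_pents Ld = {0, 1, 3, 4, 5, 8, 10, 12, 13, 14, 17}"
 | "dual_pents Le = {5}"
 | "dual_pents Lf = {0, 1, 2, 3, 4, 5, 6, 7, 9, 10, 13}"
 | "dual_pents Lg = {0, 1, 3, 4, 5, 7, 12, 13, 17}"
 | "dual_pents Lh = {8, 10}"
 | "dual_pents Li = {0, 1, 2, 3, 4, 5, 6, 7, 9, 10}"
 | "dual_pents Lj = {1, 2, 3, 5, 7, 13, 14}"
 | "dual_pents Lk = {0, 1, 3, 5, 8, 10, 12, 13, 14, 17}"
 | "dual_pents Ll = {0, 1, 3, 4, 5, 7, 8, 10, 13, 17}"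
 | "dual_pents Lm = {0, 1, 3, 4, 5, 12, 13, 17}"
 | "dual_pents Ln = {9}"
 | "dual_pents Ls = {2, 8, 9, 17}"
 | "dual_pents Lu = {8}"
 | "dual_pents _ = {}"

lemma even_words_eq: "even_words = pivot_word ` pivots"
  by (simp add: even_words_def pivots_def)

lemma pivot_in_word: "l \<in> pivots \<Longrightarrow> l' \<in> pivots \<Longrightarrow> l \<in> pivot_word l' \<longleftrightarrow> l = l'"
  unfolding pivots_def by (elim insertE emptyE; simp)

lemma pivot_word_inj: "inj_on pivot_word pivots"
  by (rule inj_onI) (metis pivot_in_word)

lemma not_pivot: "Lj \<notin> pivots" by (simp add: pivots_def)

section \<open>The even words solve the homogeneous system\<close>

definition pent_list :: "letter \<Rightarrow> int list" where
  "pent_list l = map (\<lambda>x. (x - 1) div 15) (generator_list l)"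

lemma incidence_count: "incidence k l = count_list (pent_list l) (int k)"
  by (cases l) (simp_all add: incidence_def pent_def pent_list_def eq_commute[of _ k] eq_commute[of _ "int k"]
    del: sum_of_bool_eq)

lemma pivot_words_even:
  "list_all (\<lambda>p. even (card (pivot_word p)) \<and>
     list_all (\<lambda>k. even (\<Sum>l\<in>pivot_word p. count_list (pent_list l) k)) [0..19])
   [Lq, Lr', Ls', Lo, Lp, Lv, Lw, Ly, La', Lb', Lc', Lf', Lg', Li', Ll', Lm',
    Lo', Lr, Lt, Lx, Lh', Lq', Lz, Ld', Le', Lp', Lj', Lk', Ln']"
  by code_simp

lemma incidence_even_word:
  assumes "W \<in> even_words"
  shows "even (card W)" "k < 20 \<Longrightarrow> even (\<Sum>l\<in>W. incidence k l)"
proof -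
  obtain p where p: "p \<in> pivots" "W = pivot_word p" using assms by (auto simp: even_words_eq)
  have *: "\<forall>p\<in>pivots. even (card (pivot_word p)) \<and>
     (\<forall>k\<in>{0..19}. even (\<Sum>l\<in>pivot_word p. count_list (pent_list l) k))"
    using pivot_words_even unfolding list_all_iff pivots_def by (simp only: set_upto list.set)
  show "even (card W)" using * p by blast
  show "even (\<Sum>l\<in>W. incidence k l)" if "k < 20"
  proof -
    have "int k \<in> {0..19}" using that by simp
    then show ?thesis using * p unfolding incidence_count by blast
  qed
qed

text \<open>Letters of \<open>A \<inter> B\<close> are counted twice on the right, so the parity of
  a weighted sum over letters is additive.\<close>

lemma even_sum_sym_diff:
  fixes f :: "letter \<Rightarrow> nat"
  shows "even (\<Sum>l\<in>sym_diff A B. f l) \<longleftrightarrow> even ((\<Sum>l\<in>A. f l) + (\<Sum>l\<in>B. f l))"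
proof -
  have "sum f (sym_diff A B) = sum f (A - B) + sum f (B - A)"
    by (rule sum.union_disjoint) auto
  moreover have "sum f A = sum f (A - B) + sum f (A \<inter> B)" "sum f B = sum f (B - A) + sum f (A \<inter> B)"
    by (subst sum.union_disjoint[symmetric]; auto intro: sum.cong)+
  ultimately show ?thesis by auto
qed

interpretation sym_diff: comp_fun_commute "sym_diff :: letter set \<Rightarrow> _"
  by standard (auto simp: fun_eq_iff)

lemma in_fold_sym_diff:
  fixes T :: "letter set set"
  shows "finite T \<Longrightarrow> l \<in> Finite_Set.fold sym_diff {} T \<longleftrightarrow> odd (card {W \<in> T. l \<in> W})"
proof (induction T rule: finite_induct)
  case (insert W T)
  have "{V \<in> insert W T. l \<in> V} = (if l \<in> W then insert W {V \<in> T. l \<in> V} else {V \<in> T. l \<in> V})"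
    by auto
  moreover have "Finite_Set.fold sym_diff {} (insert W T) =
      sym_diff W (Finite_Set.fold sym_diff {} T)"
    using insert.hyps by simp
  then have "l \<in> Finite_Set.fold sym_diff {} (insert W T) \<longleftrightarrow>
      (l \<in> W) \<noteq> (l \<in> Finite_Set.fold sym_diff {} T)" by blast
  ultimately show ?case using insert by simp
qed simp

lemma even_sum_fold_sym_diff:
  fixes f :: "letter \<Rightarrow> nat"
  assumes "finite T" "\<And>W. W \<in> T \<Longrightarrow> even (\<Sum>l\<in>W. f l)"
  shows "even (\<Sum>l\<in>Finite_Set.fold sym_diff {} T. f l)"
  using assms
proof (induction T rule: finite_induct)
  case (insert W T)
  then show ?case by (simp add: even_sum_sym_diff)
qed simp

lemma finite_even_words: "finite even_words"
  by (simp add: even_words_def)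

text \<open>A functional modulo 2 that vanishes on the even words has the same value on every word
  of the algorithm as on \<open>{Lj}\<close>. It is applied to the length and to the twenty
  incidences.\<close>

lemma even_sum_algorithm_word:
  fixes f :: "letter \<Rightarrow> nat"
  assumes "T \<subseteq> even_words" "\<And>W. W \<in> even_words \<Longrightarrow> even (\<Sum>l\<in>W. f l)"
  shows "even (\<Sum>l\<in>algorithm_word T. f l) \<longleftrightarrow> even (f Lj)"
proof -
  have "even (\<Sum>l\<in>Finite_Set.fold sym_diff {} T. f l)"
    using assms finite_even_words by (intro even_sum_fold_sym_diff) (auto dest: finite_subset)
  then show ?thesis by (simp add: algorithm_word_def even_sum_sym_diff del: Un_iff)
qed

text \<open>The pivots in the output reveal the chosen subset. This gives injectivity, and it
  dictates the subset for a given word.\<close>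

lemma pivot_in_algorithm_word:
  assumes "T \<subseteq> even_words" "l \<in> pivots"
  shows "l \<in> algorithm_word T \<longleftrightarrow> pivot_word l \<in> T"
proof -
  have "{W \<in> T. l \<in> W} = (if pivot_word l \<in> T then {pivot_word l} else {})"
    using assms pivot_in_word by (auto simp: even_words_eq)
  then have "odd (card {W \<in> T. l \<in> W}) \<longleftrightarrow> pivot_word l \<in> T" by simp
  moreover have "finite T" using assms(1) finite_even_words by (rule finite_subset)
  moreover have "l \<noteq> Lj" using assms(2) not_pivot by auto
  ultimately show ?thesis by (simp add: algorithm_word_def in_fold_sym_diff)
qed

lemma parity_algorithm_word:
  assumes "T \<subseteq> even_words"
  shows "parity_word (algorithm_word T)"
proof -
  have "odd (\<Sum>l\<in>algorithm_word T. 1::nat)"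
    using even_sum_algorithm_word[OF assms, of "\<lambda>_. 1"] incidence_even_word by simp
  \<comment> \<open>The value at \<open>Lj\<close> is 0 or 2 for every pentadecagon.\<close>
  moreover have "even (\<Sum>l\<in>algorithm_word T. incidence k l)" if "k < 20" for k
    using even_sum_algorithm_word[OF assms, of "incidence k"] incidence_even_word(2) that
    by (simp add: incidence_count pent_list_def)
  ultimately show ?thesis by (simp add: parity_word_def)
qed

text \<open>The pentadecagons in \<open>dual_pents l\<close>, together with the length of the word if \<open>l = Lj\<close>, form
  a functional on words that, among the letters that are not pivots, is odd on \<open>l\<close> only. Hence the
  pivots determine a word all of whose functionals are even.\<close>

lemma dual_functional_list:
  "list_all (\<lambda>l. list_all (\<lambda>l'.
     odd (length (filter (\<lambda>k. k \<in> dual_pents l) (pent_list l'))) \<noteq> (l = Lj) \<longleftrightarrow> l = l')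
    [La, Lb, Lc, Ld, Le, Lf, Lg, Lh, Li, Lj, Lk, Ll, Lm, Ln, Ls, Lu])
   [La, Lb, Lc, Ld, Le, Lf, Lg, Lh, Li, Lj, Lk, Ll, Lm, Ln, Ls, Lu]"
  by code_simp

lemma sum_count_list: "finite K \<Longrightarrow> (\<Sum>k\<in>K. count_list xs k) = length (filter (\<lambda>x. x \<in> K) xs)"
proof (induction xs)
  case (Cons x xs)
  have "(\<Sum>k\<in>K. count_list (x # xs) k) = (\<Sum>k\<in>K. count_list xs k + (if x = k then 1 else 0))"
    by (intro sum.cong) auto
  then show ?case using Cons by (simp add: sum.distrib)
qed simp

lemma dual_functional:
  assumes "l \<notin> pivots" "l' \<notin> pivots"
  shows "odd ((\<Sum>k\<in>dual_pents l. count_list (pent_list l') k) + of_bool (l = Lj)) \<longleftrightarrow> l = l'"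
proof -
  have "{l. l \<notin> pivots} = set [La, Lb, Lc, Ld, Le, Lf, Lg, Lh, Li, Lj, Lk, Ll, Lm, Ln, Ls, Lu]"
    using UNIV_letter by (auto simp: pivots_def)
  then have "l \<in> set [La, Lb, Lc, Ld, Le, Lf, Lg, Lh, Li, Lj, Lk, Ll, Lm, Ln, Ls, Lu]" "l' \<in> set [La, Lb, Lc, Ld, Le, Lf, Lg, Lh, Li, Lj, Lk, Ll, Lm, Ln, Ls, Lu]"
    using assms by blast+
  then have "odd (length (filter (\<lambda>k. k \<in> dual_pents l) (pent_list l'))) \<noteq> (l = Lj) \<longleftrightarrow> l = l'"
    using dual_functional_list unfolding list_all_iff by blast
  moreover have "finite (dual_pents l)" by (cases l) simp_all
  ultimately show ?thesis by (auto simp: sum_count_list)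
qed

text \<open>Suppose \<open>l\<close> is a letter of \<open>w\<close> and evaluate its dual
  functional on \<open>w\<close>. As a sum of equations that \<open>w\<close> satisfies it is even;
  summed letter by letter it is odd, since \<open>l\<close> alone contributes an odd value.\<close>

lemma homogeneous_solution_empty:
  assumes "even (card w)" "\<forall>k<20. even (\<Sum>l\<in>w. incidence k l)" "w \<inter> pivots = {}"
  shows "w = {}"
proof (rule ccontr)
  assume "w \<noteq> {}"
  then obtain l where l: "l \<in> w" "l \<notin> pivots" using assms(3) by blast
  let ?K = "dual_pents l" and ?e = "of_bool (l = Lj) :: nat"
  let ?f = "\<lambda>l'. (\<Sum>k\<in>?K. count_list (pent_list l') k) + ?e"
  have "even (\<Sum>l'\<in>w. count_list (pent_list l') k)" if "k \<in> ?K" for k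
  proof -
    have "0 \<le> k \<and> k < 20" using that by (cases l) auto
    then have "nat k < 20" "k = int (nat k)" by linarith+
    then show ?thesis using assms(2) unfolding incidence_count by metis
  qed
  then have "even (\<Sum>k\<in>?K. \<Sum>l'\<in>w. count_list (pent_list l') k)" by (rule dvd_sum)
  also have "(\<Sum>k\<in>?K. \<Sum>l'\<in>w. count_list (pent_list l') k) =
      (\<Sum>l'\<in>w. \<Sum>k\<in>?K. count_list (pent_list l') k)"
    by (rule sum.swap)
  finally have "even ((\<Sum>l'\<in>w. \<Sum>k\<in>?K. count_list (pent_list l') k) + card w * ?e)"
    using assms(1) by simp
  then have "even (\<Sum>l'\<in>w. ?f l')" by (simp only: sum.distrib sum_constant of_nat_id)
  moreover have "(\<Sum>l'\<in>w. ?f l') = ?f l + (\<Sum>l'\<in>w - {l}. ?f l')"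
    using l by (intro sum.remove) simp_all
  moreover have "even (\<Sum>l'\<in>w - {l}. ?f l')"
  proof (rule dvd_sum)
    fix l' assume "l' \<in> w - {l}"
    then show "even (?f l')" using dual_functional[of l l'] l assms(3) by blast
  qed
  moreover have "odd (?f l)" using dual_functional[of l l] l by blast
  ultimately show False by simp
qed

lemma bij_algorithm_word: "bij_betw algorithm_word (Pow even_words) {w. parity_word w}"
proof (rule bij_betwI')
  fix T T' assume TT: "T \<in> Pow even_words" "T' \<in> Pow even_words"
  show "algorithm_word T = algorithm_word T' \<longleftrightarrow> T = T'"
  proof
    assume eq: "algorithm_word T = algorithm_word T'"
    have "pivot_word l \<in> T \<longleftrightarrow> pivot_word l \<in> T'" if "l \<in> pivots" for l
      using that TT pivot_in_algorithm_word[of T l] pivot_in_algorithm_word[of T' l] eq by simp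
    then show "T = T'" using TT by (auto simp: even_words_eq)
  qed simp
next
  fix T assume "T \<in> Pow even_words"
  then show "algorithm_word T \<in> {w. parity_word w}" by (simp add: parity_algorithm_word)
next
  fix w assume "w \<in> {w. parity_word w}"
  then have w: "odd (card w)" "\<forall>k<20. even (\<Sum>l\<in>w. incidence k l)" by (simp_all add: parity_word_def)
  \<comment> \<open>The pivots of \<open>w\<close> force this choice. The difference between
    \<open>w\<close> and the resulting word is a homogeneous solution without pivots.\<close>
  define T where "T = pivot_word ` (w \<inter> pivots)"
  have T: "T \<subseteq> even_words" by (auto simp: T_def even_words_eq)
  have a: "odd (card (algorithm_word T))" "\<forall>k<20. even (\<Sum>l\<in>algorithm_word T. incidence k l)"
    using parity_algorithm_word[OF T] by (simp_all add: parity_word_def)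
  have "pivot_word l \<in> T \<longleftrightarrow> l \<in> w" if "l \<in> pivots" for l
    using that inj_onD[OF pivot_word_inj] by (auto simp: T_def)
  then have "l \<in> algorithm_word T \<longleftrightarrow> l \<in> w" if "l \<in> pivots" for l
    using that T by (simp add: pivot_in_algorithm_word)
  then have "sym_diff w (algorithm_word T) \<inter> pivots = {}" by auto
  note pivots = this
  have "even (card (sym_diff w (algorithm_word T)))"
    using even_sum_sym_diff[of "\<lambda>_. 1" w "algorithm_word T"] w(1) a(1) by simp
  moreover have "\<forall>k<20. even (\<Sum>l\<in>sym_diff w (algorithm_word T). incidence k l)"
    using w(2) a(2) unfolding even_sum_sym_diff by (blast intro: dvd_add)
  ultimately have "sym_diff w (algorithm_word T) = {}"
    using pivots by (rule homogeneous_solution_empty)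
  then show "\<exists>T\<in>Pow even_words. w = algorithm_word T" using T by (intro bexI[of _ T]) auto
qed

lemma card_even_words: "card even_words = 29"
  by (simp add: even_words_eq card_image[OF pivot_word_inj]) (simp add: pivots_def)

section \<open>The vertices\<close>

lemma golden_sq: "golden * golden = golden + 1"
  by (simp add: golden_def field_simps)

lemma golden_pos: "golden > 0" by (simp add: golden_def add_pos_pos)

lemma inverse_golden: "1 / golden = golden - 1" "1 / golden^2 = 2 - golden" "golden^2 = golden + 1"
  "sqrt 5 = 2 * golden - 1"
proof -
  have g: "golden \<noteq> 0" using golden_pos by simp
  show 1: "1 / golden = golden - 1" using g golden_sq by (simp add: field_simps)
  show 3: "golden^2 = golden + 1" using golden_sq by (simp add: power2_eq_square)
  have "(2 - golden) * golden^2 = 1" using golden_sq by (simp add: power2_eq_square algebra_simps)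
  then show "1 / golden^2 = 2 - golden" using g by (simp add: field_simps)
  show "sqrt 5 = 2 * golden - 1" by (simp add: golden_def field_simps)
qed

section \<open>Permutations of four coordinates as explicit lists\<close>

definition even_arrangements :: "'a \<Rightarrow> 'a \<Rightarrow> 'a \<Rightarrow> 'a \<Rightarrow> ('a \<times> 'a \<times> 'a \<times> 'a) list" where
  "even_arrangements a b c d =
    [(a,b,c,d), (a,c,d,b), (a,d,b,c), (b,a,d,c), (b,c,a,d), (b,d,c,a),
     (c,a,b,d), (c,b,d,a), (c,d,a,b), (d,a,c,b), (d,b,a,c), (d,c,b,a)]"

text \<open>Exchanging the first two entries turns the 12 even arrangements into the 12 odd
  ones.\<close>

definition arrangements :: "'a \<Rightarrow> 'a \<Rightarrow> 'a \<Rightarrow> 'a \<Rightarrow> ('a \<times> 'a \<times> 'a \<times> 'a) list" where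
  "arrangements a b c d = even_arrangements a b c d @ even_arrangements b a c d"

lemma neq_4: "(1::4) \<noteq> 2" "(1::4) \<noteq> 3" "(1::4) \<noteq> 4" "(2::4) \<noteq> 3" "(2::4) \<noteq> 4" "(3::4) \<noteq> 4"
  by simp_all

lemma distinct_4_iff:
  "distinct [a, b, c, d] \<longleftrightarrow> (a, b, c, d) \<in> set (arrangements 1 2 3 (4::4))"
proof -
  have "\<forall>a b c d. distinct [a, b, c, d] \<longleftrightarrow> (a, b, c, d) \<in> set (arrangements 1 2 3 (4::4))"
    by (simp only: forall_4 arrangements_def even_arrangements_def distinct.simps list.set append.simps
      insert_iff empty_iff prod.inject neq_4 neq_4[symmetric] simp_thms)
  then show ?thesis by blast
qed

lemma permutes_4_iff:
  "\<pi> permutes (UNIV :: 4 set) \<longleftrightarrow> (\<pi> 1, \<pi> 2, \<pi> 3, \<pi> 4) \<in> set (arrangements 1 2 3 4)"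
proof -
  have "\<pi> permutes UNIV \<longleftrightarrow> inj \<pi>"
    by (metis bij_imp_permutes bij_betw_def finite finite_UNIV_inj_surj permutes_inj UNIV_I)
  also have "\<dots> \<longleftrightarrow> distinct [\<pi> 1, \<pi> 2, \<pi> 3, \<pi> 4]"
    by (auto simp: inj_def forall_4)
  also have "\<dots> \<longleftrightarrow> (\<pi> 1, \<pi> 2, \<pi> 3, \<pi> 4) \<in> set (arrangements 1 2 3 4)"
    by (rule distinct_4_iff)
  finally show ?thesis .
qed

text \<open>Three transpositions sort the permutation into the identity. Each flips the parity
  unless it is trivial, so the parity is determined by which of them are trivial.\<close>

lemma evenperm_4_iff:
  assumes "\<pi> permutes (UNIV :: 4 set)"
  shows "evenperm \<pi> \<longleftrightarrow> (\<pi> 1, \<pi> 2, \<pi> 3, \<pi> 4) \<in> set (even_arrangements 1 2 3 4)"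
proof -
  define \<pi>1 where "\<pi>1 = Transposition.transpose 1 (\<pi> 1) \<circ> \<pi>"
  define \<pi>2 where "\<pi>2 = Transposition.transpose 2 (\<pi>1 2) \<circ> \<pi>1"
  define \<pi>3 where "\<pi>3 = Transposition.transpose 3 (\<pi>2 3) \<circ> \<pi>2"
  have p: "permutation \<pi>" "permutation \<pi>1" "permutation \<pi>2" "permutation \<pi>3"
    using permutes_imp_permutation[OF finite assms] unfolding \<pi>1_def \<pi>2_def \<pi>3_def
    by (simp_all add: permutation_compose permutation_swap_id)
  have e: "evenperm (Transposition.transpose a b \<circ> \<rho>) \<longleftrightarrow> (a = b) = evenperm \<rho>" if "permutation \<rho>" for \<rho> and a b :: 4
    using that by (simp add: evenperm_comp permutation_swap_id evenperm_swap)
  have *: "evenperm \<pi>3 \<longleftrightarrow> (3 = \<pi>2 3) = ((2 = \<pi>1 2) = ((1 = \<pi> 1) = evenperm \<pi>))"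
    unfolding \<pi>3_def e[OF p(3)] unfolding \<pi>2_def e[OF p(2)] unfolding \<pi>1_def e[OF p(1)] by simp
  have "\<pi>3 = id \<and> ((3 = \<pi>2 3) = ((2 = \<pi>1 2) = (1 = \<pi> 1)) \<longleftrightarrow>
      (\<pi> 1, \<pi> 2, \<pi> 3, \<pi> 4) \<in> set (even_arrangements 1 2 3 4))"
    using assms
    unfolding permutes_4_iff arrangements_def even_arrangements_def set_append list.set Un_iff insert_iff
      empty_iff prod.inject simp_thms
    by (elim disjE conjE; simp add: \<pi>1_def \<pi>2_def \<pi>3_def fun_eq_iff forall_4 Transposition.transpose_def)
  then show ?thesis using * by auto
qed

lemma arrangements_map:
  "even_arrangements (f a) (f b) (f c) (f d) =
     map (\<lambda>(i, j, k, l). (f i, f j, f k, f l)) (even_arrangements a b c d)"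
  "arrangements (f a) (f b) (f c) (f d) =
     map (\<lambda>(i, j, k, l). (f i, f j, f k, f l)) (arrangements a b c d)"
  by (simp_all add: arrangements_def even_arrangements_def)

definition signs :: "real set" where "signs = {1, -1}"

definition signed :: "(real \<times> real \<times> real \<times> real) list \<Rightarrow> (real^4) set" where
  "signed xs = (\<Union>(a, b, c, d)\<in>set xs. {vector [s1 * a, s2 * b, s3 * c, s4 * d] | s1 s2 s3 s4.
     s1 \<in> signs \<and> s2 \<in> signs \<and> s3 \<in> signs \<and> s4 \<in> signs})"

lemma vector_4_nth [simp]:
  "(vector [a, b, c, d] :: real^4) $ 1 = a" "(vector [a, b, c, d] :: real^4) $ 2 = b"
  "(vector [a, b, c, d] :: real^4) $ 3 = c" "(vector [a, b, c, d] :: real^4) $ 4 = d"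
  unfolding vector_def by simp_all

lemma vec_4_eq_iff: "(x :: real^4) = y \<longleftrightarrow> x $ 1 = y $ 1 \<and> x $ 2 = y $ 2 \<and> x $ 3 = y $ 3 \<and> x $ 4 = y $ 4"
  by (simp add: vec_eq_iff forall_4)

lemma in_signed_iff:
  "x \<in> signed xs \<longleftrightarrow> (\<exists>(a, b, c, d)\<in>set xs. (\<exists>s\<in>signs. x $ 1 = s * a) \<and>
     (\<exists>s\<in>signs. x $ 2 = s * b) \<and> (\<exists>s\<in>signs. x $ 3 = s * c) \<and> (\<exists>s\<in>signs. x $ 4 = s * d))"
proof -
  have "x \<in> {vector [s1 * a, s2 * b, s3 * c, s4 * d] | s1 s2 s3 s4.
      s1 \<in> signs \<and> s2 \<in> signs \<and> s3 \<in> signs \<and> s4 \<in> signs} \<longleftrightarrow> (\<exists>s\<in>signs. x $ 1 = s * a) \<and>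
     (\<exists>s\<in>signs. x $ 2 = s * b) \<and> (\<exists>s\<in>signs. x $ 3 = s * c) \<and> (\<exists>s\<in>signs. x $ 4 = s * d)" for a b c d
    unfolding mem_Collect_eq vec_4_eq_iff vector_4_nth by blast
  then show ?thesis unfolding signed_def UN_iff by (intro bex_cong refl) (simp only: case_prod_beta)
qed

text \<open>One argument for all permutations and for the even ones: \<open>P\<close> is any
  condition that is decided by the four values of the permutation.\<close>

lemma signed_eq:
  assumes "\<And>\<pi>. P \<pi> \<longleftrightarrow> (\<pi> 1, \<pi> 2, \<pi> 3, \<pi> 4) \<in> set xs"
  shows "{\<chi> i. s i * c $ \<pi> i | s \<pi>. (\<forall>i. s i = 1 \<or> s i = -1) \<and> P \<pi>} =
    signed (map (\<lambda>(i, j, k, l). (c $ i, c $ j, c $ k, c $ l)) xs)" (is "?L = ?R")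
proof (intro set_eqI iffI)
  fix x :: "real^4" assume "x \<in> ?L"
  then obtain s \<pi> where x: "x = (\<chi> i. s i * c $ \<pi> i)" "\<forall>i. s i = 1 \<or> s i = -1" "P \<pi>" by blast
  have s: "s i \<in> signs" for i using x(2) by (simp add: signs_def)
  show "x \<in> ?R" unfolding in_signed_iff set_map
  proof (rule bexI)
    show "(case (c $ \<pi> 1, c $ \<pi> 2, c $ \<pi> 3, c $ \<pi> 4) of (a, b, c, d) \<Rightarrow>
       (\<exists>s\<in>signs. x $ 1 = s * a) \<and> (\<exists>s\<in>signs. x $ 2 = s * b) \<and>
       (\<exists>s\<in>signs. x $ 3 = s * c) \<and> (\<exists>s\<in>signs. x $ 4 = s * d))"
      using s unfolding x(1) vec_lambda_beta case_prod_conv by blast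
    show "(c $ \<pi> 1, c $ \<pi> 2, c $ \<pi> 3, c $ \<pi> 4) \<in> (\<lambda>(i, j, k, l). (c $ i, c $ j, c $ k, c $ l)) ` set xs"
      using x(3) unfolding assms by force
  qed
next
  fix x :: "real^4" assume "x \<in> ?R"
  then obtain i j k l s1 s2 s3 s4 where x: "(i, j, k, l) \<in> set xs"
    "s1 \<in> signs" "s2 \<in> signs" "s3 \<in> signs" "s4 \<in> signs"
    "x $ 1 = s1 * c $ i" "x $ 2 = s2 * c $ j" "x $ 3 = s3 * c $ k" "x $ 4 = s4 * c $ l"
    unfolding in_signed_iff set_map by auto
  \<comment> \<open>Both the signs and the permutation are rebuilt as functions from their four
    values.\<close>
  let ?f = "\<lambda>a b c d i. if i = 1 then a else if i = 2 then b else if i = (3::4) then c else d"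
  have "x = (\<chi> n. ?f s1 s2 s3 s4 n * c $ ?f i j k l n)"
    by (simp add: x(6-9) vec_4_eq_iff)
  moreover have "\<forall>n. ?f s1 s2 s3 s4 n = 1 \<or> ?f s1 s2 s3 s4 n = -1" using x(2-5) by (simp add: signs_def)
  moreover have "P (?f i j k l)" using x(1) by (simp add: assms)
  ultimately show "x \<in> ?L" unfolding mem_Collect_eq by (intro exI conjI)
qed

lemma signed_perms_eq: "signed_perms c = signed (arrangements (c $ 1) (c $ 2) (c $ 3) (c $ 4))"
  unfolding signed_perms_def arrangements_map[of "($) c"] by (rule signed_eq) (rule permutes_4_iff)

lemma permutes_evenperm_4_iff:
  "\<pi> permutes (UNIV :: 4 set) \<and> evenperm \<pi> \<longleftrightarrow> (\<pi> 1, \<pi> 2, \<pi> 3, \<pi> 4) \<in> set (even_arrangements 1 2 3 4)"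
  using evenperm_4_iff[of \<pi>] permutes_4_iff[of \<pi>] by (auto simp: arrangements_def)

lemma signed_even_perms_eq:
  "signed_even_perms c = signed (even_arrangements (c $ 1) (c $ 2) (c $ 3) (c $ 4))"
  unfolding signed_even_perms_def arrangements_map[of "($) c"]
  by (rule signed_eq) (rule permutes_evenperm_4_iff)

lemma signed_append: "signed (xs @ ys) = signed xs \<union> signed ys"
  by (simp add: signed_def UN_Un)

section \<open>Integer codes of the vertices\<close>

definition zphi :: "int \<Rightarrow> int \<Rightarrow> real" where
  "zphi a b = of_int a + of_int b * golden"

text \<open>Vectors with coordinates in \<open>\<int>[golden]\<close>, with two integers for each coordinate.\<close>

datatype zvec = ZV int int int int int int int int

primrec vec_of :: "zvec \<Rightarrow> real^4" where
  "vec_of (ZV a b c d e f g h) = vector [zphi a b, zphi c d, zphi e f, zphi g h]"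

text \<open>The absolute values of the coordinates of the vertices are numbered from 0 to 7.\<close>

definition magnitude :: "int \<Rightarrow> real" where
  "magnitude m = (if m = 1 then 2 else if m = 2 then 1 else if m = 3 then sqrt 5
     else if m = 4 then 1 / golden^2 else if m = 5 then golden else if m = 6 then 1 / golden
     else if m = 7 then golden^2 else 0)"

definition magnitude_codes :: "int \<Rightarrow> (int \<times> int) list" where
  "magnitude_codes m = (if m = 1 then [(2,0), (-2,0)] else if m = 2 then [(1,0), (-1,0)]
     else if m = 3 then [(-1,2), (1,-2)] else if m = 4 then [(2,-1), (-2,1)]
     else if m = 5 then [(0,1), (0,-1)] else if m = 6 then [(-1,1), (1,-1)]
     else if m = 7 then [(1,1), (-1,-1)] else [(0,0)])"

definition shapes :: "(int \<times> int \<times> int \<times> int) list" where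
  "shapes = arrangements 0 0 1 1 @ arrangements 2 2 2 3 @ arrangements 4 5 5 5 @
     arrangements 6 6 6 7 @ even_arrangements 0 4 2 7 @ even_arrangements 0 6 5 3 @
     even_arrangements 6 2 5 1"

fun shape_codes :: "int \<times> int \<times> int \<times> int \<Rightarrow> zvec list" where
  "shape_codes (i, j, k, l) = [ZV (fst p) (snd p) (fst q) (snd q) (fst r) (snd r) (fst s) (snd s).
     p \<leftarrow> magnitude_codes i, q \<leftarrow> magnitude_codes j, r \<leftarrow> magnitude_codes k, s \<leftarrow> magnitude_codes l]"

text \<open>Repeated shapes are removed, and zero has a single code, so that the length is exactly
  600. It is later the upper bound on the number of vertices.\<close>

definition vertex_codes :: "zvec list" where
  "vertex_codes = concat (map shape_codes (remdups shapes))"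

lemma vertices_shapes:
  "vertices = signed (map (\<lambda>(i, j, k, l). (magnitude i, magnitude j, magnitude k, magnitude l)) shapes)"
proof -
  have m: "magnitude 0 = 0" "magnitude 1 = 2" "magnitude 2 = 1" "magnitude 3 = sqrt 5"
    "magnitude 4 = 1 / golden^2" "magnitude 5 = golden" "magnitude 6 = 1 / golden" "magnitude 7 = golden^2"
    by (simp_all add: magnitude_def)
  show ?thesis
    unfolding shapes_def map_append arrangements_map[symmetric, of magnitude] m signed_append
      vertices_def signed_perms_eq signed_even_perms_eq vector_4_nth by blast
qed

lemma magnitude_codes: "(\<exists>s\<in>signs. x = s * magnitude m) \<longleftrightarrow> x \<in> (\<lambda>(a, b). zphi a b) ` set (magnitude_codes m)"
  \<comment> \<open>The last rule catches \<open>1 / golden^2\<close> once its denominator has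
    become \<open>golden + 1\<close>.\<close>
  by (auto simp: signs_def magnitude_def magnitude_codes_def zphi_def inverse_golden inverse_golden(2)[unfolded inverse_golden(3)])

lemma vertices_eq: "vertices = vec_of ` set vertex_codes"
proof -
  let ?C = "\<lambda>m. (\<lambda>(a, b). zphi a b) ` set (magnitude_codes m)"
  let ?Q = "\<lambda>x (i, j, k, l). x $ 1 \<in> ?C i \<and> x $ 2 \<in> ?C j \<and> x $ 3 \<in> ?C k \<and> x $ 4 \<in> ?C l"
  have "x \<in> vertices \<longleftrightarrow> (\<exists>t\<in>set shapes. ?Q x t)" for x
    unfolding vertices_shapes in_signed_iff set_map bex_simps magnitude_codes[symmetric]
    by (intro bex_cong refl) (simp only: case_prod_beta fst_conv snd_conv)
  moreover have "x \<in> vec_of ` set vertex_codes \<longleftrightarrow> (\<exists>t\<in>set shapes. ?Q x t)" for x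
  proof -
    have "x \<in> vec_of ` set (shape_codes (i, j, k, l)) \<longleftrightarrow> ?Q x (i, j, k, l)" for i j k l
    proof -
      have "x \<in> vec_of ` set (shape_codes (i, j, k, l)) \<longleftrightarrow>
        (\<exists>p\<in>set (magnitude_codes i). \<exists>q\<in>set (magnitude_codes j).
          \<exists>r\<in>set (magnitude_codes k). \<exists>s\<in>set (magnitude_codes l).
            x = vec_of (ZV (fst p) (snd p) (fst q) (snd q) (fst r) (snd r) (fst s) (snd s)))"
        unfolding shape_codes.simps set_concat set_map image_image image_UN
        by (simp only: UN_iff image_iff)
      also have "\<dots> \<longleftrightarrow> ?Q x (i, j, k, l)"
        unfolding vec_of.simps vec_4_eq_iff vector_4_nth image_iff case_prod_beta fst_conv snd_conv
        by blast
      finally show ?thesis .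
    qed
    then have "x \<in> vec_of ` set (shape_codes t) \<longleftrightarrow> ?Q x t" for t
      by (cases t) (simp only: case_prod_conv)
    then show ?thesis
      by (simp only: vertex_codes_def set_concat set_map set_remdups image_UN UN_iff bex_simps)
  qed
  ultimately show ?thesis by blast
qed

lemma length_vertex_codes: "length vertex_codes = 600"
  by code_simp

section \<open>Computations with vertices\<close>

text \<open>By \<open>golden^2 = golden + 1\<close>, the inner product of two coded vectors is
  \<open>zdot1 + zdot2 * golden\<close>.\<close>

fun zdot1 :: "zvec \<Rightarrow> zvec \<Rightarrow> int" where
  "zdot1 (ZV a b c d e f g h) (ZV a' b' c' d' e' f' g' h') =
     a * a' + b * b' + c * c' + d * d' + e * e' + f * f' + g * g' + h * h'"

fun zdot2 :: "zvec \<Rightarrow> zvec \<Rightarrow> int" where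
  "zdot2 (ZV a b c d e f g h) (ZV a' b' c' d' e' f' g' h') =
     a * b' + b * (a' + b') + c * d' + d * (c' + d') + e * f' + f * (e' + f') + g * h' + h * (g' + h')"

text \<open>Written with \<open>if\<close> so that \<open>zdot1\<close> need only be computed when
  \<open>zdot2\<close> vanishes.\<close>

definition zorthogonal :: "zvec \<Rightarrow> zvec \<Rightarrow> bool" where
  "zorthogonal v w \<longleftrightarrow> (if zdot2 v w = 0 then zdot1 v w = 0 else False)"

fun zneg :: "zvec \<Rightarrow> zvec" where
  "zneg (ZV a b c d e f g h) = ZV (-a) (-b) (-c) (-d) (-e) (-f) (-g) (-h)"

fun zsub_scaled :: "zvec \<Rightarrow> int \<Rightarrow> int \<Rightarrow> zvec \<Rightarrow> zvec" where
  "zsub_scaled (ZV a b c d e f g h) s t (ZV a' b' c' d' e' f' g' h') =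
     ZV (2 * a - (s * a' + t * b')) (2 * b - (s * b' + t * a' + t * b'))
        (2 * c - (s * c' + t * d')) (2 * d - (s * d' + t * c' + t * d'))
        (2 * e - (s * e' + t * f')) (2 * f - (s * f' + t * e' + t * f'))
        (2 * g - (s * g' + t * h')) (2 * h - (s * h' + t * g' + t * h'))"

text \<open>For \<open>r\<close> of squared length 4 this is twice the reflection
  \<open>x - ((r \<bullet> x) / 2) r\<close>; doubling keeps the entries integral.\<close>

definition double_refl :: "zvec \<Rightarrow> zvec \<Rightarrow> zvec" where
  "double_refl r x = zsub_scaled x (zdot1 r x) (zdot2 r x) r"

fun halve :: "zvec \<Rightarrow> zvec" where
  "halve (ZV a b c d e f g h) =
     ZV (a div 2) (b div 2) (c div 2) (d div 2) (e div 2) (f div 2) (g div 2) (h div 2)"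

fun zeven :: "zvec \<Rightarrow> bool" where
  "zeven (ZV a b c d e f g h) \<longleftrightarrow> even a \<and> even b \<and> even c \<and> even d \<and> even e \<and> even f \<and> even g \<and> even h"

definition zrefl :: "zvec \<Rightarrow> zvec \<Rightarrow> zvec" where
  "zrefl r x = halve (double_refl r x)"

text \<open>The doubles of the simple roots.\<close>

definition "root_a = ZV 2 0 0 0 0 0 0 0"
definition "root_b = ZV 0 (-1) (-1) 0 0 0 (-1) 1"
definition "root_c = ZV 0 0 0 1 (-1) 0 1 (-1)"
definition "root_d = ZV 0 0 0 0 2 0 0 0"

text \<open>\<open>magnitude_index a b\<close> inverts \<open>magnitude_codes\<close>, with a value outside 0 to 7 if there is
  no magnitude.\<close>

definition magnitude_index :: "int \<Rightarrow> int \<Rightarrow> int" where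
  "magnitude_index a b =
    (if b = 0 then (if a = 0 then 0 else if a = 1 then 2 else if a = -1 then 2
       else if a = 2 then 1 else if a = -2 then 1 else 8)
     else if b = 1 then (if a = 0 then 5 else if a = -1 then 6 else if a = 1 then 7 else if a = -2 then 4 else 8)
     else if b = -1 then (if a = 0 then 5 else if a = 1 then 6 else if a = -1 then 7 else if a = 2 then 4 else 8)
     else if b = 2 then (if a = -1 then 3 else 8)
     else if b = -2 then (if a = 1 then 3 else 8)
     else 8)"

text \<open>Four digits in base 9, since 8 marks a coordinate that is no magnitude. Membership among
  the shapes becomes a comparison of single integers.\<close>

definition shape_code :: "int \<Rightarrow> int \<Rightarrow> int \<Rightarrow> int \<Rightarrow> int" where
  "shape_code i j k l = 729 * i + 81 * j + 9 * k + l"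

definition shape_numbers :: "int list" where
  "shape_numbers = remdups (map (\<lambda>(i, j, k, l). shape_code i j k l) shapes)"

text \<open>Signs are arbitrary in every shape, so only magnitudes matter. The list of shapes is a
  parameter so that it can be evaluated once for all vectors.\<close>

fun is_vertex :: "int list \<Rightarrow> zvec \<Rightarrow> bool" where
  "is_vertex cs (ZV a b c d e f g h) \<longleftrightarrow>
     List.member cs (shape_code (magnitude_index a b) (magnitude_index c d) (magnitude_index e f)
       (magnitude_index g h))"

text \<open>The rows are the pentadecagons in the order of the paper, each starting from its first
  vertex.\<close>

definition reps :: "zvec list list" where
  "reps =
   [[ZV 2 (-1) (-1) 0 0 0 (-1) (-1),
     ZV 1 0 0 (-1) 1 (-1) (-2) 0,
     ZV 0 1 (-2) 0 1 (-1) (-1) 0,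
     ZV (-1) 2 0 (-1) 1 (-1) 0 0,
     ZV (-1) 2 (-1) 0 (-1) 0 1 0,
     ZV 0 1 1 (-1) (-1) 0 2 0,
     ZV 1 0 0 0 (-2) 1 1 1,
     ZV 2 (-1) 1 0 0 0 1 1,
     ZV 1 (-1) 0 1 0 0 (-1) 2,
     ZV 0 (-1) 0 1 2 (-1) 0 1,
     ZV (-2) 0 0 1 1 0 (-1) 1,
     ZV (-2) 0 0 1 1 0 1 (-1),
     ZV (-2) 0 1 0 (-1) 1 0 (-1),
     ZV 0 (-1) 0 0 (-1) 1 1 (-2),
     ZV 1 (-1) 1 (-1) (-1) 1 (-1) (-1)],
    [ZV (-1) 1 1 (-1) (-1) 1 (-1) (-1),
     ZV 1 0 (-1) 0 (-1) 0 1 (-2),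
     ZV 1 0 1 (-2) (-1) 0 (-1) 0,
     ZV 2 0 (-2) 0 0 0 0 0,
     ZV 1 1 1 (-1) 1 (-1) (-1) 1,
     ZV 0 1 (-2) 1 0 (-1) 0 1,
     ZV (-1) 1 1 (-1) 1 (-1) 1 1,
     ZV (-1) 1 (-1) 1 (-1) 1 1 1,
     ZV 0 0 2 0 0 0 2 0,
     ZV 0 (-1) 0 1 (-2) 1 0 1,
     ZV 1 (-2) 1 0 1 0 1 0,
     ZV 0 (-1) 0 1 0 1 (-2) 1,
     ZV 0 (-1) 0 1 2 (-1) 0 (-1),
     ZV (-2) 0 0 0 0 0 (-2) 0,
     ZV (-1) 0 (-1) 0 1 0 1 (-2)],
    [ZV (-1) 1 1 (-1) 1 (-1) (-1) (-1),
     ZV (-1) 1 (-2) 0 (-1) 0 0 (-1),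
     ZV 0 1 1 (-2) 0 0 1 (-1),
     ZV 1 1 (-1) 0 (-2) 1 0 0,
     ZV 2 0 1 (-1) 0 (-1) 1 0,
     ZV 1 0 (-1) 0 (-1) 0 (-1) 2,
     ZV 1 0 0 0 2 (-1) 1 1,
     ZV (-1) 1 0 1 0 0 (-1) 2,
     ZV (-1) 0 0 1 1 (-1) 2 0,
     ZV (-2) 0 1 0 (-1) 1 0 1,
     ZV 0 (-1) 0 1 0 1 2 (-1),
     ZV 0 (-1) 2 0 (-1) 1 (-1) 0,
     ZV 1 (-2) (-1) 1 0 0 0 (-1),
     ZV 0 (-1) 1 (-1) 1 0 (-2) 0,
     ZV 0 0 (-2) 1 1 0 (-1) (-1)],
    [ZV 0 0 (-2) 1 (-1) 0 (-1) (-1),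
     ZV 0 0 1 (-2) 1 (-1) 0 (-1),
     ZV 0 1 (-2) 0 (-1) 1 (-1) 0,
     ZV 1 1 1 (-1) 1 (-1) 1 (-1),
     ZV 0 1 (-1) 0 (-2) 0 (-1) 1,
     ZV 1 0 0 (-1) 1 (-1) 2 0,
     ZV 0 1 0 0 (-1) 1 (-1) 2,
     ZV 1 0 0 1 1 (-1) 2 0,
     ZV (-1) 0 1 0 (-1) 0 (-1) 2,
     ZV 0 (-1) (-1) 1 1 0 2 0,
     ZV (-1) 0 2 0 0 1 (-1) 1,
     ZV 0 (-1) (-1) 2 0 0 1 (-1),
     ZV (-1) (-1) 2 (-1) 0 0 (-1) 0,
     ZV 0 (-1) (-2) 1 0 1 0 (-1),
     ZV 0 0 2 (-1) 1 0 (-1) (-1)],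
    [ZV 1 0 0 0 2 (-1) (-1) (-1),
     ZV (-1) 1 (-1) 0 0 (-1) (-2) 0,
     ZV (-1) 1 (-1) (-1) 1 (-1) 1 (-1),
     ZV (-1) 2 0 (-1) (-1) 1 0 0,
     ZV 1 1 0 0 (-1) 0 2 (-1),
     ZV 1 0 1 (-1) (-2) 0 0 1,
     ZV 2 (-1) (-1) 0 0 0 1 1,
     ZV 1 0 1 0 1 0 (-1) 2,
     ZV 0 0 (-1) 2 1 (-1) 0 1,
     ZV (-2) 0 1 0 1 (-1) 0 1,
     ZV (-2) 0 (-1) 1 0 1 1 0,
     ZV (-1) 0 2 0 0 1 1 (-1),
     ZV 0 (-1) 0 1 (-2) 1 0 (-1),
     ZV 1 (-2) 1 (-1) 0 0 0 (-1),
     ZV 1 (-1) (-1) 0 0 1 (-2) 0],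
    [ZV 1 0 0 0 (-2) 1 (-1) (-1),
     ZV 2 (-1) 0 (-1) 0 (-1) 0 (-1),
     ZV 1 0 (-1) (-1) 0 0 (-2) 1,
     ZV 1 1 (-1) 0 2 (-1) 0 0,
     ZV (-1) 2 0 0 0 (-1) (-1) 1,
     ZV (-1) 1 (-1) 0 0 (-1) 2 0,
     ZV (-1) 1 1 (-1) (-1) 1 1 1,
     ZV 1 0 0 1 (-1) 1 2 0,
     ZV 1 (-1) 2 0 (-1) 0 0 1,
     ZV 1 (-2) (-1) 1 0 0 0 1,
     ZV 0 (-1) 1 0 2 0 (-1) 1,
     ZV (-1) 0 (-1) 2 1 0 (-1) 0,
     ZV (-2) 0 1 0 1 (-1) 0 (-1),
     ZV (-2) 0 (-1) 0 (-1) 1 0 (-1),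
     ZV 0 0 1 (-1) 0 1 1 (-2)],
    [ZV (-1) 1 (-1) 0 0 1 (-2) 0,
     ZV 0 1 0 0 1 (-1) 1 (-2),
     ZV (-1) 1 0 (-1) (-2) 0 (-1) 0,
     ZV 1 0 (-1) (-1) 0 0 2 (-1),
     ZV 1 1 1 (-1) (-1) 1 (-1) 1,
     ZV 2 0 (-1) 1 0 (-1) 1 0,
     ZV 0 0 1 (-1) 0 (-1) (-1) 2,
     ZV 0 0 (-2) 1 1 0 1 1,
     ZV (-1) 1 2 0 1 0 0 1,
     ZV (-1) 0 (-1) 2 (-1) 0 1 0,
     ZV (-1) (-1) 2 (-1) 0 0 1 0,
     ZV 0 (-1) (-1) 1 (-1) 2 0 0,
     ZV 1 (-1) 2 0 1 0 0 (-1),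
     ZV 0 (-1) (-1) 1 (-1) 0 (-2) 0,
     ZV 0 (-1) 0 (-1) 2 (-1) 0 (-1)],
    [ZV 0 0 1 (-1) 0 (-1) 1 (-2),
     ZV 0 0 (-1) (-1) (-2) 1 (-1) 0,
     ZV 2 0 0 (-1) 1 0 1 (-1),
     ZV 1 1 0 0 (-1) 0 (-2) 1,
     ZV 1 0 (-1) 0 1 (-2) 1 0,
     ZV (-1) 1 0 (-1) 0 0 (-1) 2,
     ZV 0 1 (-1) 1 1 0 2 0,
     ZV (-1) 1 2 0 (-1) 0 0 1,
     ZV 0 (-1) (-1) 1 (-1) 0 2 0,
     ZV 0 (-1) 2 (-1) 0 1 0 1,
     ZV 1 (-1) (-1) 2 0 1 0 0,
     ZV 0 (-1) 2 0 1 (-1) (-1) 0,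
     ZV (-1) (-1) (-2) 1 0 0 (-1) 0,
     ZV (-1) 0 1 (-1) 2 0 0 (-1),
     ZV (-1) 1 (-1) 1 (-1) 1 (-1) (-1)],
    [ZV 1 (-1) (-1) 0 0 (-1) (-2) 0,
     ZV 0 0 (-1) (-1) 2 (-1) (-1) 0,
     ZV (-1) 2 (-1) 0 1 0 (-1) 0,
     ZV (-1) 2 0 0 0 (-1) 1 (-1),
     ZV (-1) 1 0 (-1) (-2) 0 1 0,
     ZV 1 0 0 (-1) (-1) 1 2 0,
     ZV 2 0 1 0 (-1) 1 0 1,
     ZV 2 (-1) 0 1 0 (-1) 0 1,
     ZV 0 (-1) 0 0 1 (-1) (-1) 2,
     ZV (-1) 0 (-1) 1 2 0 0 1,
     ZV (-2) 1 1 1 1 0 0 0,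
     ZV (-2) 0 0 1 (-1) 0 1 (-1),
     ZV (-1) (-1) 1 (-1) (-1) 1 1 (-1),
     ZV 1 (-1) 0 0 (-1) 2 0 (-1),
     ZV 2 (-1) 1 0 0 0 (-1) (-1)],
    [ZV 2 (-1) 0 (-1) 0 1 0 (-1),
     ZV 2 0 0 0 0 0 (-2) 0,
     ZV 1 0 (-1) 0 1 (-2) (-1) 0,
     ZV (-1) 1 (-1) (-1) 1 (-1) (-1) 1,
     ZV (-1) 2 (-1) 0 1 0 1 0,
     ZV (-1) 2 1 0 (-1) 0 1 0,
     ZV 0 0 0 0 (-2) 0 2 0,
     ZV 1 (-1) 1 (-1) (-1) 1 1 1,
     ZV 2 (-1) 0 1 0 1 0 1,
     ZV 1 (-1) 1 1 1 (-1) (-1) 1,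
     ZV (-1) (-1) (-1) 1 1 (-1) (-1) 1,
     ZV (-2) 0 0 0 2 0 0 0,
     ZV (-2) 1 0 1 0 1 0 (-1),
     ZV (-1) 0 1 0 (-1) 0 1 (-2),
     ZV 0 (-1) 0 (-1) (-2) 1 0 (-1)],
    [ZV 1 0 1 (-1) 2 0 0 (-1),
     ZV 0 1 (-1) 1 (-1) 0 (-2) 0,
     ZV 0 0 0 (-1) 1 (-2) 1 (-1),
     ZV (-1) 1 (-1) (-1) (-1) 1 (-1) 1,
     ZV 1 1 0 0 1 0 2 (-1),
     ZV 0 1 1 0 (-2) 0 (-1) 1,
     ZV 1 (-1) (-1) 0 0 (-1) 2 0,
     ZV 0 0 1 (-1) 0 1 (-1) 2,
     ZV 1 0 (-1) 2 1 0 1 0,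
     ZV (-1) 0 2 0 0 (-1) (-1) 1,
     ZV (-1) (-1) (-2) 1 0 0 1 0,
     ZV (-1) 0 2 (-1) 1 1 0 0,
     ZV 0 0 (-1) 2 (-1) 1 0 (-1),
     ZV 0 (-1) 2 (-1) 0 (-1) 0 (-1),
     ZV 0 (-1) (-2) 0 (-1) 1 (-1) 0],
    [ZV 0 0 0 0 (-2) 0 (-2) 0,
     ZV 1 (-1) (-1) (-1) 1 (-1) 1 (-1),
     ZV 0 1 0 (-1) 0 1 (-2) 1,
     ZV 1 1 (-1) 1 1 (-1) 1 (-1),
     ZV (-1) 1 1 (-1) (-1) (-1) (-1) 1,
     ZV 0 0 (-2) 0 0 0 2 0,
     ZV 0 1 2 (-1) 0 1 0 1,
     ZV 1 0 (-1) 2 (-1) 0 1 0,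
     ZV 0 (-1) 2 (-1) 0 (-1) 0 1,
     ZV 0 (-1) (-2) 1 0 1 0 1,
     ZV 0 0 2 0 2 0 0 0,
     ZV (-1) 0 (-1) 2 (-1) 0 (-1) 0,
     ZV (-1) (-1) 1 (-1) 1 (-1) 1 (-1),
     ZV (-1) 0 (-1) 0 (-1) 2 (-1) 0,
     ZV 1 0 1 0 1 0 1 (-2)],
    [ZV 1 0 1 0 (-1) 0 1 (-2),
     ZV 1 (-1) 0 (-1) (-2) 0 (-1) 0,
     ZV 2 (-1) (-1) (-1) 1 0 0 0,
     ZV 1 1 0 0 1 0 (-2) 1,
     ZV 0 1 (-1) 1 1 (-2) 0 0,
     ZV (-2) 1 0 (-1) 0 (-1) 0 1,
     ZV (-1) 1 (-1) 0 0 1 2 0,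
     ZV 0 1 2 0 (-1) 1 1 0,
     ZV 1 (-1) 0 1 (-2) 0 1 0,
     ZV 1 (-2) 1 (-1) 0 0 0 1,
     ZV 1 (-1) (-1) 1 1 1 (-1) 1,
     ZV 0 0 1 1 2 (-1) (-1) 0,
     ZV (-2) 0 (-1) 1 0 (-1) (-1) 0,
     ZV (-2) 0 0 (-1) 1 0 1 (-1),
     ZV (-1) 1 0 0 (-1) 2 0 (-1)],
    [ZV 0 1 (-1) 1 1 0 (-2) 0,
     ZV (-1) 1 0 0 1 (-2) 0 (-1),
     ZV (-2) 1 (-1) (-1) (-1) 0 0 0,
     ZV 0 1 0 (-1) 0 1 2 (-1),
     ZV 1 1 1 0 (-2) 1 0 0,
     ZV 2 (-1) 0 0 (-1) (-1) 1 0,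
     ZV 1 (-1) 0 (-1) 0 0 (-1) 2,
     ZV 1 0 (-1) 1 2 0 0 1,
     ZV (-1) 1 1 1 1 (-1) (-1) 1,
     ZV (-2) 0 (-1) 1 0 (-1) 1 0,
     ZV (-2) 0 1 (-1) 0 1 1 0,
     ZV 0 0 0 1 (-1) 2 1 (-1),
     ZV 1 (-1) 2 0 (-1) 0 0 (-1),
     ZV 1 (-2) (-1) 0 (-1) 0 (-1) 0,
     ZV 1 (-1) 0 (-1) 2 0 (-1) 0],
    [ZV (-1) 1 1 0 0 (-1) (-2) 0,
     ZV (-1) 0 (-2) 0 0 (-1) 1 (-1),
     ZV (-1) 1 1 (-2) 0 1 0 0,
     ZV 1 1 (-1) 1 (-1) 1 1 (-1),
     ZV 1 0 2 (-1) (-1) (-1) 0 0,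
     ZV 1 (-1) (-2) 0 (-1) 0 0 1,
     ZV 1 0 1 (-1) 2 0 0 1,
     ZV 0 1 (-1) 2 0 0 (-1) 1,
     ZV (-1) 0 1 0 1 (-2) 1 0,
     ZV (-2) 0 (-1) 0 (-1) 1 0 1,
     ZV 0 0 1 0 1 1 2 (-1),
     ZV 0 0 1 1 (-2) 1 (-1) 0,
     ZV 1 (-2) 0 0 0 (-1) 1 (-1),
     ZV 0 (-1) 0 (-1) 0 1 (-2) 1,
     ZV 1 0 (-1) 1 2 0 0 (-1)],
    [ZV 0 1 2 (-1) 0 1 0 (-1),
     ZV 1 0 (-1) 1 (-2) 0 0 (-1),
     ZV 1 (-1) 1 (-2) 0 (-1) 0 0,
     ZV 1 0 (-2) 0 0 1 (-1) 1,
     ZV 1 1 1 0 2 (-1) 0 0,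
     ZV (-1) 1 (-1) 1 (-1) (-1) (-1) 1,
     ZV (-1) 0 0 (-1) 1 (-1) 2 0,
     ZV (-1) 1 0 0 (-1) 2 0 1,
     ZV 1 0 1 1 0 0 2 (-1),
     ZV 0 (-1) 1 0 (-2) 0 (-1) 1,
     ZV 1 (-2) (-1) 0 1 0 1 0,
     ZV 0 0 1 0 1 1 (-2) 1,
     ZV 0 0 (-1) 2 1 (-1) 0 (-1),
     ZV (-2) 0 1 (-1) 0 (-1) (-1) 0,
     ZV (-1) 0 (-2) 0 0 1 1 (-1)],
    [ZV 0 0 0 (-1) (-1) 2 1 (-1),
     ZV 2 0 1 0 (-1) 1 0 (-1),
     ZV 2 (-1) 0 0 (-1) (-1) (-1) 0,
     ZV 1 (-1) (-1) (-1) 1 (-1) (-1) 1,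
     ZV 0 1 (-1) 0 2 0 (-1) 1,
     ZV (-1) 2 0 1 1 (-1) 0 0,
     ZV (-2) 1 0 0 (-1) (-1) 1 0,
     ZV (-1) 0 0 (-1) (-1) 1 2 0,
     ZV 1 0 1 0 (-1) 2 1 0,
     ZV 2 (-1) 1 1 (-1) 0 0 0,
     ZV 1 (-2) 0 0 0 (-1) (-1) 1,
     ZV 0 (-1) (-1) 0 2 0 (-1) 1,
     ZV (-1) 1 0 1 2 0 (-1) 0,
     ZV (-2) 1 0 1 0 (-1) 0 (-1),
     ZV (-2) 0 0 (-1) (-1) 0 1 (-1)],
    [ZV 0 (-1) 0 (-1) 0 (-1) (-2) 1,
     ZV 0 0 (-2) 0 2 0 0 0,
     ZV (-1) 2 1 0 1 0 (-1) 0,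
     ZV (-1) 1 (-1) 1 (-1) (-1) 1 (-1),
     ZV (-1) 0 1 (-2) (-1) 0 1 0,
     ZV 1 0 (-1) 0 (-1) 2 1 0,
     ZV 2 0 2 0 0 0 0 0,
     ZV 1 (-1) (-1) 1 (-1) (-1) (-1) 1,
     ZV 0 (-1) 0 (-1) 2 (-1) 0 1,
     ZV (-1) 1 (-1) 1 1 1 (-1) 1,
     ZV (-1) 1 1 1 1 (-1) 1 (-1),
     ZV (-2) 0 0 0 (-2) 0 0 0,
     ZV 0 (-1) 0 (-1) 0 1 2 (-1),
     ZV 1 0 1 0 (-1) 2 (-1) 0,
     ZV 2 (-1) 0 1 0 (-1) 0 (-1)],
    [ZV 1 (-1) 1 (-2) 0 1 0 0,
     ZV 2 0 (-1) 1 0 1 (-1) 0,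
     ZV 1 0 1 0 1 (-2) (-1) 0,
     ZV (-1) 0 (-2) 0 0 (-1) (-1) 1,
     ZV (-1) 1 0 (-1) 2 0 1 0,
     ZV (-1) 2 0 1 (-1) 1 0 0,
     ZV 0 0 1 0 (-1) (-1) 2 (-1),
     ZV 0 (-1) 0 (-1) (-2) 1 0 1,
     ZV 2 (-1) 0 0 1 1 1 0,
     ZV 1 0 1 1 0 0 (-2) 1,
     ZV 0 (-1) (-1) 1 1 (-2) 0 0,
     ZV (-2) 0 0 (-1) 1 0 (-1) 1,
     ZV (-1) 1 (-1) 1 1 1 1 (-1),
     ZV (-1) 1 2 0 (-1) 0 0 (-1),
     ZV 0 (-1) (-1) 0 (-2) 0 1 (-1)],
    [ZV 0 (-1) 1 (-2) 0 0 (-1) 1,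
     ZV 1 0 (-2) 1 1 1 0 0,
     ZV 0 1 2 0 1 (-1) (-1) 0,
     ZV (-1) 0 (-2) 1 (-1) (-1) 0 0,
     ZV (-1) 0 1 (-2) 1 0 1 0,
     ZV 0 1 (-1) 1 (-1) 2 0 0,
     ZV 1 0 2 0 0 (-1) 1 (-1),
     ZV 0 (-1) (-1) 0 (-2) 0 (-1) 1,
     ZV 1 (-1) 0 (-1) 2 0 1 0,
     ZV 0 1 0 1 0 1 (-2) 1,
     ZV 0 0 0 1 1 (-2) 1 (-1),
     ZV (-2) 0 0 (-1) (-1) 0 (-1) 1,
     ZV 0 0 (-1) 0 1 1 2 (-1),
     ZV 0 1 2 0 (-1) 1 (-1) 0,
     ZV 1 (-1) (-1) 1 (-1) (-1) 1 (-1)]]"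

fun check_reflections :: "int list \<Rightarrow> zvec list \<Rightarrow> bool" where
  "check_reflections cs [] \<longleftrightarrow> True"
| "check_reflections cs (x # xs) \<longleftrightarrow> is_vertex cs x \<and> zdot1 x x = 8 \<and> zdot2 x x = 0 \<and>
     list_all (\<lambda>y. zeven y \<and> is_vertex cs (halve y)) (map (\<lambda>r. double_refl r x) [root_a, root_b, root_c, root_d]) \<and>
     check_reflections cs xs"

text \<open>Reflections commute with negation, so one vertex of each antipodal pair suffices. The
  squared length 8 later separates the rays.\<close>

lemma check_reflections: "check_reflections shape_numbers (concat reps)"
  by code_simp

text \<open>The roots \<open>root_a\<close> and \<open>root_d\<close> lie on coordinate axes, so
  their reflections only change the sign of the first or the third coordinate.\<close>

fun flip1 :: "zvec \<Rightarrow> zvec" where "flip1 (ZV a b c d e f g h) = ZV (-a) (-b) c d e f g h"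
fun flip3 :: "zvec \<Rightarrow> zvec" where "flip3 (ZV a b c d e f g h) = ZV a b c d (-e) (-f) g h"

text \<open>Encodes \<open>c x = y\<close>. Since reflections are involutions,
  \<open>y = s_a s_b s_c s_d x\<close> is the same as \<open>s_b s_a y = s_c s_d x\<close>; each
  side then has one reflection that is not a sign change, and doubling both sides avoids
  halving.\<close>

definition coxeter_rel :: "zvec \<Rightarrow> zvec \<Rightarrow> bool" where
  "coxeter_rel x y \<longleftrightarrow> double_refl root_b (flip1 y) = double_refl root_c (flip3 x)"

text \<open>A turn by 12 degrees is a turn by 8 * 24 degrees followed by negation.\<close>

lemma check_coxeter:
  "list_all (\<lambda>row. list_all2 coxeter_rel row (map zneg (drop 8 row @ take 8 row))) reps"
  by code_simp

lemma length_reps: "length reps = 20" "list_all (\<lambda>row. length row = 15) reps"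
  by (simp_all add: reps_def)

datatype entry = Entry (index: int) (rep: zvec)

fun entries :: "int \<Rightarrow> zvec list \<Rightarrow> entry list" where
  "entries n [] = []"
| "entries n (x # xs) = Entry n x # entries (n + 1) xs"

fun adjacent :: "entry \<Rightarrow> entry \<Rightarrow> bool" where
  "adjacent (Entry m x) (Entry n y) \<longleftrightarrow> zorthogonal x y"

text \<open>All representatives have squared length 8, so vectors equal up to sign would have inner
  product 8 or -8.\<close>

fun different :: "entry \<Rightarrow> entry \<Rightarrow> bool" where
  "different (Entry m x) (Entry n y) \<longleftrightarrow>
     (if zdot2 x y = 0 then if zdot1 x y = 8 then m = n else zdot1 x y \<noteq> - 8 else True)"

text \<open>The first ray of each pentadecagon. Rotation carries any pair of rays to one that begins
  with a leader, so 20 * 300 pairs replace 300 * 300.\<close>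

fun leaders :: "entry list \<Rightarrow> entry list" where
  "leaders [] = []"
| "leaders (x # xs) = (if index x mod 15 = 1 then x # leaders xs else leaders xs)"

text \<open>The translates of generators through the leader \<open>n\<close>: each generator ray in
  its pentadecagon is shifted to the first place.\<close>

definition aligned :: "int \<Rightarrow> int list list" where
  "aligned n = [map (shift_int (15 - (x - 1) mod 15)) (generator_list l). l \<leftarrow> letters,
     x \<leftarrow> generator_list l, (x - 1) div 15 = (n - 1) div 15]"

text \<open>Here \<open>N\<close> consists of the rays orthogonal to a leader. For each
  \<open>x\<close> in \<open>N\<close>, a single basis of the table through the leader contains
  \<open>x\<close> and everything orthogonal to both; hence no other basis contains the leader and
  \<open>x\<close>.\<close>

fun check_neighbours :: "int list list \<Rightarrow> entry list \<Rightarrow> bool" where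
  "check_neighbours Qs N \<longleftrightarrow> list_all (\<lambda>x. list_ex (\<lambda>Q. List.member Q (index x) \<and>
     list_all (\<lambda>y. List.member Q (index y)) (filter (adjacent x) N)) Qs) N"

fun check_leader :: "entry list \<Rightarrow> entry \<Rightarrow> bool" where
  "check_leader es x \<longleftrightarrow> check_neighbours (aligned (index x)) (filter (adjacent x) es)"

fun check_leaders :: "entry list \<Rightarrow> bool" where
  "check_leaders es \<longleftrightarrow> list_all (check_leader es) (leaders es)"

lemma check_bases: "check_leaders (entries 1 (concat reps))"
  by code_simp

fun check_distinct :: "entry list \<Rightarrow> bool" where
  "check_distinct es \<longleftrightarrow> list_all (\<lambda>x. list_all (different x) es) (leaders es)"

lemma check_distinct: "check_distinct (entries 1 (concat reps))"
  by code_simp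

fun nth_int :: "'a list \<Rightarrow> int \<Rightarrow> 'a" where
  "nth_int (x # xs) n = (if n = 0 then x else nth_int xs (n - 1))"
| "nth_int [] n = undefined"

fun pairwise_orthogonal :: "zvec list \<Rightarrow> bool" where
  "pairwise_orthogonal [] \<longleftrightarrow> True"
| "pairwise_orthogonal (x # xs) \<longleftrightarrow> list_all (\<lambda>y. zorthogonal x y) xs \<and> pairwise_orthogonal xs"

lemma check_generators:
  "list_all (\<lambda>l. pairwise_orthogonal
     (map (\<lambda>n. nth_int (nth_int reps ((n - 1) div 15)) ((n - 1) mod 15)) (generator_list l))) letters"
  by code_simp

section \<open>Reflections\<close>

lemma zphi_add: "zphi a b + zphi c d = zphi (a + c) (b + d)"
  by (simp add: zphi_def algebra_simps)

lemma zphi_diff: "zphi a b - zphi c d = zphi (a - c) (b - d)"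
  by (simp add: zphi_def algebra_simps)

lemma zphi_uminus: "- zphi a b = zphi (-a) (-b)"
  by (simp add: zphi_def)

lemma zphi_mult: "zphi a b * zphi c d = zphi (a * c + b * d) (a * d + b * (c + d))"
proof -
  have "zphi a b * zphi c d = of_int (a * c) + of_int (a * d + b * c) * golden + of_int (b * d) * (golden * golden)"
    by (simp add: zphi_def algebra_simps)
  then show ?thesis unfolding golden_sq by (simp add: zphi_def algebra_simps)
qed

text \<open>Irrationality of \<open>sqrt 5\<close>: otherwise
  \<open>(2 * a + b)^2 = 5 * b^2\<close>, where 5 divides the left side to an even power and the
  right side to an odd one.\<close>

lemma zphi_eq_0_iff: "zphi a b = 0 \<longleftrightarrow> a = 0 \<and> b = 0"
proof
  assume *: "zphi a b = 0"
  have "b = 0"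
  proof (rule ccontr)
    assume "b \<noteq> 0"
    have "real_of_int (2 * a + b) = - (of_int b * sqrt 5)"
      using * by (simp add: zphi_def golden_def field_simps)
    then have "(real_of_int (2 * a + b))^2 = (of_int b * sqrt 5)^2" by simp
    then have "real_of_int ((2 * a + b)^2) = real_of_int (5 * b^2)"
      by (simp add: power_mult_distrib)
    then have eq: "(2 * a + b)^2 = 5 * b^2" by linarith
    then have "2 * a + b \<noteq> 0" using \<open>b \<noteq> 0\<close> by auto
    have p: "prime_elem (5::int)" by simp
    have "multiplicity 5 ((2 * a + b)^2) = 2 * multiplicity 5 (2 * a + b)"
      using p \<open>2 * a + b \<noteq> 0\<close> by (simp add: prime_elem_multiplicity_power_distrib)
    moreover have "multiplicity 5 (5 * b^2) = Suc (2 * multiplicity 5 b)"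
      using p \<open>b \<noteq> 0\<close> by (simp add: prime_elem_multiplicity_mult_distrib
          prime_elem_multiplicity_power_distrib)
    ultimately have "2 * multiplicity 5 (2 * a + b) = Suc (2 * multiplicity 5 b)"
      using eq by simp
    then have "even (Suc (2 * multiplicity 5 b))" by (metis dvd_triv_left)
    then show False by simp
  qed
  then show "a = 0 \<and> b = 0" using * by (simp add: zphi_def)
qed (simp add: zphi_def)

lemma inner_4: "(x :: real^4) \<bullet> y = x $ 1 * y $ 1 + x $ 2 * y $ 2 + x $ 3 * y $ 3 + x $ 4 * y $ 4"
  by (simp add: inner_vec_def sum_4)

lemma inner_vec_of: "vec_of v \<bullet> vec_of w = zphi (zdot1 v w) (zdot2 v w)"
  by (cases v; cases w) (simp add: inner_4 zphi_mult zphi_add algebra_simps)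

lemma zorthogonal_iff: "zorthogonal v w \<longleftrightarrow> vec_of v \<bullet> vec_of w = 0"
  by (auto simp: zorthogonal_def inner_vec_of zphi_eq_0_iff)

lemma vec_of_zneg: "vec_of (zneg v) = - vec_of v"
  by (cases v) (simp add: vec_4_eq_iff zphi_uminus)

lemma vec_of_zsub_scaled: "vec_of (zsub_scaled v s t w) = 2 *\<^sub>R vec_of v - zphi s t *\<^sub>R vec_of w"
  by (cases v; cases w) (simp add: vec_4_eq_iff zphi_def[of "2 * _" "2 * _"] zphi_def[of "2 * _ - _" "2 * _ - _"]
    zphi_mult, simp add: zphi_def algebra_simps)

lemma vec_of_halve: "zeven v \<Longrightarrow> vec_of v = 2 *\<^sub>R vec_of (halve v)"
  by (cases v) (auto simp: vec_4_eq_iff zphi_def elim!: evenE)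

definition is_root :: "zvec \<Rightarrow> bool" where
  "is_root r \<longleftrightarrow> zdot1 r r = 4 \<and> zdot2 r r = 0"

abbreviation half :: "zvec \<Rightarrow> real^4" where
  "half r \<equiv> (1/2) *\<^sub>R vec_of r"

lemma half_unit: "is_root r \<Longrightarrow> half r \<bullet> half r = 1"
  by (simp add: is_root_def inner_vec_of zphi_def)

lemma reflection_unit: "r \<bullet> r = 1 \<Longrightarrow> reflection r x = x - (2 * (r \<bullet> x)) *\<^sub>R r"
  by (simp add: reflection_def)

lemma vec_of_double_refl:
  assumes "is_root r"
  shows "vec_of (double_refl r x) = 2 *\<^sub>R reflection (half r) (vec_of x)"
proof -
  have "2 *\<^sub>R reflection (half r) (vec_of x) = 2 *\<^sub>R vec_of x - (vec_of r \<bullet> vec_of x) *\<^sub>R vec_of r"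
    by (simp add: reflection_unit[OF half_unit[OF assms]] algebra_simps)
  then show ?thesis by (simp add: double_refl_def vec_of_zsub_scaled inner_vec_of)
qed

lemma vec_of_zrefl:
  assumes "is_root r" "zeven (double_refl r x)"
  shows "reflection (half r) (vec_of x) = vec_of (zrefl r x)"
  using vec_of_double_refl[OF assms(1), of x] vec_of_halve[OF assms(2)] by (simp add: zrefl_def)

lemma roots: "is_root root_a" "is_root root_b" "is_root root_c" "is_root root_d"
  by (simp_all add: is_root_def root_a_def root_b_def root_c_def root_d_def)

lemma linear_reflection: "linear (reflection r)"
  by (rule linearI) (simp_all add: reflection_def inner_add_right add_divide_distrib algebra_simps)

lemma reflection_involution: "r \<bullet> r = 1 \<Longrightarrow> reflection r (reflection r x) = x"
  by (simp add: reflection_unit inner_diff_right)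

lemma reflection_adjoint: "r \<bullet> r = 1 \<Longrightarrow> reflection r x \<bullet> y = x \<bullet> reflection r y"
  by (simp add: reflection_unit inner_diff_right inner_diff_left inner_commute)

lemma orthogonal_reflection: "r \<bullet> r = 1 \<Longrightarrow> orthogonal_transformation (reflection r)"
  by (simp add: orthogonal_transformation_def linear_reflection reflection_adjoint reflection_involution)

lemma flip1: "reflection (half root_a) (vec_of x) = vec_of (flip1 x)"
  by (cases x) (simp add: reflection_def inner_4 vec_4_eq_iff zphi_def root_a_def field_simps)

lemma flip3: "reflection (half root_d) (vec_of x) = vec_of (flip3 x)"
  by (cases x) (simp add: reflection_def inner_4 vec_4_eq_iff zphi_def root_d_def field_simps)

definition coxeter :: "real^4 \<Rightarrow> real^4" where
  "coxeter = reflection (half root_a) \<circ> reflection (half root_b) \<circ> reflection (half root_c) \<circ>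
     reflection (half root_d)"

definition coxeter_inv :: "real^4 \<Rightarrow> real^4" where
  "coxeter_inv = reflection (half root_d) \<circ> reflection (half root_c) \<circ> reflection (half root_b) \<circ>
     reflection (half root_a)"

lemma coxeter_inverse: "coxeter (coxeter_inv x) = x" "coxeter_inv (coxeter x) = x"
  by (simp_all add: coxeter_def coxeter_inv_def reflection_involution[OF half_unit] roots)

lemma coxeter_adjoint: "coxeter x \<bullet> y = x \<bullet> coxeter_inv y" "coxeter_inv x \<bullet> y = x \<bullet> coxeter y"
  by (simp_all add: coxeter_def coxeter_inv_def reflection_adjoint[OF half_unit] roots)

lemma linear_coxeter: "linear coxeter" "linear coxeter_inv"
  unfolding coxeter_def coxeter_inv_def by (intro linear_compose linear_reflection)+

lemma orthogonal_coxeter: "orthogonal_transformation coxeter"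
  by (simp add: orthogonal_transformation_def linear_coxeter coxeter_adjoint coxeter_inverse)

lemma coxeter_rel: "coxeter_rel x y \<Longrightarrow> coxeter (vec_of x) = vec_of y"
proof -
  assume "coxeter_rel x y"
  then have "vec_of (double_refl root_b (flip1 y)) = vec_of (double_refl root_c (flip3 x))"
    by (simp add: coxeter_rel_def)
  then have "reflection (half root_b) (reflection (half root_a) (vec_of y)) =
      reflection (half root_c) (reflection (half root_d) (vec_of x))"
    by (simp add: vec_of_double_refl roots flip1 flip3)
  \<comment> \<open>Applying \<open>s_a s_b\<close> to both sides completes the right one to
    \<open>coxeter\<close>.\<close>
  then have "reflection (half root_a) (reflection (half root_b) (reflection (half root_b) (reflection (half root_a) (vec_of y)))) =
      coxeter (vec_of x)"
    by (simp add: coxeter_def)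
  then show ?thesis by (simp add: reflection_involution[OF half_unit] roots)
qed


section \<open>The Coxeter plane\<close>

text \<open>For this angle the cosines of its double and its triple agree. The resulting cubic has
  the root 1, and dividing it out leaves \<open>4 * x^2 + 2 * x - 1\<close>.\<close>

lemma cos_2pi_5: "cos (2 * pi / 5) = (golden - 1) / 2"
proof -
  define x where "x = cos (2 * pi / 5)"
  have "0 < x" unfolding x_def using pi_gt_zero by (intro cos_gt_zero) simp_all
  have "x \<noteq> 1"
    unfolding x_def using cos_monotone_0_pi[of 0 "2 * pi / 5"] by simp
  have "cos (3 * (2 * pi / 5)) = cos (2 * (2 * pi / 5))"
    using cos_minus_pi[of "4 * pi / 5 - pi"] cos_periodic[of "- (4 * pi / 5)"]
    by (simp add: cos_2pi_minus field_simps flip: cos_2pi_minus[of "4 * pi / 5"])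
  then have "4 * x^3 - 3 * x = 2 * x^2 - 1"
    unfolding x_def cos_treble_cos cos_double_cos .
  then have "(x - 1) * (4 * x^2 + 2 * x - 1) = 0"
    by (simp add: algebra_simps power2_eq_square power3_eq_cube)
  then have "4 * x^2 + 2 * x - 1 = 0" using \<open>x \<noteq> 1\<close> by simp
  then have "(4 * x + 1)^2 = 5" by (simp add: power2_eq_square algebra_simps)
  then have "sqrt 5 = 4 * x + 1" using \<open>0 < x\<close> by (intro real_sqrt_unique) auto
  then show ?thesis unfolding x_def by (simp add: golden_def field_simps)
qed

lemma cos_4pi_5: "cos (4 * pi / 5) = - golden / 2"
proof -
  have "cos (2 * (2 * pi / 5)) = - golden / 2"
    unfolding cos_double_cos cos_2pi_5 using golden_sq by (simp add: power2_eq_square field_simps)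
  then show ?thesis by simp
qed

lemma cos_pi_5: "cos (pi / 5) = golden / 2"
  using cos_minus_pi[of "pi / 5"] cos_4pi_5 cos_pi_minus[of "pi / 5"] by (simp add: field_simps)

text \<open>The exponents of \<open>H_4\<close> are 1, 11, 19, 29 and its Coxeter number is 30, so
  \<open>c + c^-1\<close> has the double eigenvalues \<open>mu\<close> and \<open>nu\<close>. They
  are the roots of \<open>t^2 - (golden - 1) * t - (golden + 1)\<close>.\<close>

definition mu :: real where "mu = 2 * cos (pi / 15)"
definition nu :: real where "nu = 2 * cos (11 * pi / 15)"

lemma mu_plus_nu: "mu + nu = golden - 1"
proof -
  have "cos (pi / 15) + cos (11 * pi / 15) = 2 * cos (2 * pi / 5) * cos (- (pi / 3))"
    unfolding cos_plus_cos by (rule arg_cong2[of _ _ _ _ "\<lambda>a b. 2 * cos a * cos b"]) (simp_all add: field_simps)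
  then show ?thesis by (simp add: mu_def nu_def cos_2pi_5 cos_60)
qed

lemma mu_nu: "mu * nu = - (golden + 1)"
proof -
  have "cos (pi / 15) * cos (11 * pi / 15) = (cos (- (2 * pi / 3)) + cos (4 * pi / 5)) / 2"
    unfolding cos_times_cos by (rule arg_cong2[of _ _ _ _ "\<lambda>a b. (cos a + cos b) / 2"]) (simp_all add: field_simps)
  then have "mu * nu = 2 * (cos (- (2 * pi / 3)) + cos (4 * pi / 5))"
    unfolding mu_def nu_def by linarith
  then show ?thesis unfolding cos_minus cos_120 cos_4pi_5 by simp
qed

lemma nu_sq: "nu * nu = (golden - 1) * nu + golden + 1"
proof -
  have "nu * nu = (mu + nu) * nu - mu * nu" by (simp add: algebra_simps)
  then show ?thesis unfolding mu_plus_nu mu_nu by simp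
qed

lemma golden_bounds: "1.6180 < golden" "golden < 1.6181"
proof -
  have "2.2360 < sqrt 5" "sqrt 5 < 2.2362"
    by (rule real_less_rsqrt, simp add: power2_eq_square)
      (rule real_less_lsqrt, simp_all add: power2_eq_square)
  then show "1.6180 < golden" "golden < 1.6181" by (simp_all add: golden_def)
qed

lemma nu_bounds: "-1.3383 < nu" "nu < -1.3382"
proof -
  have "mu > 0" unfolding mu_def using cos_gt_zero[of "pi / 15"] by simp
  then have "nu < 0" using mu_nu golden_pos by (smt (verit) mult_nonneg_nonneg)
  \<comment> \<open>The quadratic polynomial of \<open>nu\<close> at \<open>t\<close>, up to sign,
    in factored form. At the two decimal bounds the second factor is negative, so the sign of the
    right side tells on which side of \<open>t\<close> the number \<open>nu\<close> lies.\<close>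
  have fac: "(nu - t) * (nu + t - (golden - 1)) = golden + 1 + t * golden - t - t * t" for t
    using nu_sq by (simp add: algebra_simps)
  show "-1.3383 < nu"
  proof (rule ccontr)
    assume "\<not> -1.3383 < nu"
    then have "0 \<le> (nu - (-1.3383)) * (nu + (-1.3383) - (golden - 1))"
      using golden_bounds by (intro mult_nonpos_nonpos) auto
    then show False unfolding fac using golden_bounds by (simp add: field_simps)
  qed
  show "nu < -1.3382"
  proof (rule ccontr)
    assume "\<not> nu < -1.3382"
    then have "(nu - (-1.3382)) * (nu + (-1.3382) - (golden - 1)) \<le> 0"
      using golden_bounds \<open>nu < 0\<close> by (intro mult_nonneg_nonpos) auto
    then show False unfolding fac using golden_bounds by simp
  qed
qed


lemma golden_nu_bounds: "-2.1656 < golden * nu" "golden * nu < -2.1651"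
proof -
  have "golden * - nu < 1.6181 * 1.3383" "1.6180 * 1.3382 < golden * - nu"
    using golden_bounds nu_bounds by (intro mult_strict_mono; simp)+
  then show "-2.1656 < golden * nu" "golden * nu < -2.1651" by simp_all
qed

text \<open>The numbers \<open>a + b * golden + (c + d * golden) * nu\<close> form a ring since
  \<open>nu^2 = golden^2 + (golden - 1) * nu\<close>. In \<open>nmul_aux\<close>, \<open>s + t * golden\<close> is the coefficient of
  \<open>nu^2\<close>.\<close>

datatype znum = ZN int int int int

fun num_of :: "znum \<Rightarrow> real" where
  "num_of (ZN a b c d) = zphi a b + zphi c d * nu"

fun nadd :: "znum \<Rightarrow> znum \<Rightarrow> znum" where
  "nadd (ZN a b c d) (ZN a' b' c' d') = ZN (a + a') (b + b') (c + c') (d + d')"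

fun nneg :: "znum \<Rightarrow> znum" where
  "nneg (ZN a b c d) = ZN (-a) (-b) (-c) (-d)"

fun nmul_aux :: "int \<Rightarrow> int \<Rightarrow> int \<Rightarrow> int \<Rightarrow> int \<Rightarrow> int \<Rightarrow> znum" where
  "nmul_aux a b c d s t = ZN (a + s + t) (b + s + 2 * t) (c - s + t) (d + s)"

fun nmul :: "znum \<Rightarrow> znum \<Rightarrow> znum" where
  "nmul (ZN a b c d) (ZN a' b' c' d') =
     nmul_aux (a * a' + b * b') (a * b' + b * (a' + b'))
       (a * c' + b * d' + (c * a' + d * b')) (a * d' + b * (c' + d') + (c * b' + d * (a' + b')))
       (c * c' + d * d') (c * d' + d * (c' + d'))"

lemma num_of_nadd: "num_of (nadd x y) = num_of x + num_of y"
  by (cases x; cases y) (simp add: zphi_def algebra_simps)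

lemma num_of_nneg: "num_of (nneg x) = - num_of x"
  by (cases x) (simp add: zphi_def algebra_simps)

lemma num_of_nmul_aux: "num_of (nmul_aux a b c d s t) = zphi a b + zphi c d * nu + zphi s t * (nu * nu)"
proof -
  have "zphi s t * (nu * nu) = zphi s t * (zphi 1 1) + zphi s t * zphi (-1) 1 * nu"
    unfolding nu_sq by (simp add: zphi_def algebra_simps)
  then show ?thesis unfolding zphi_mult by (simp add: zphi_def algebra_simps)
qed

lemma num_of_nmul: "num_of (nmul x y) = num_of x * num_of y"
proof (cases x; cases y)
  fix a b c d a' b' c' d' assume x: "x = ZN a b c d" "y = ZN a' b' c' d'"
  have "num_of x * num_of y = zphi a b * zphi a' b' + (zphi a b * zphi c' d' + zphi c d * zphi a' b') * nu
      + zphi c d * zphi c' d' * (nu * nu)"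
    by (simp add: x algebra_simps)
  then show ?thesis
    unfolding x nmul.simps num_of_nmul_aux zphi_mult zphi_add by simp
qed

text \<open>A sufficient criterion for positivity, from the bounds on \<open>golden\<close>, \<open>nu\<close> and \<open>golden * nu\<close>
  above, scaled by 10000.\<close>

fun npos :: "znum \<Rightarrow> bool" where
  "npos (ZN a b c d) \<longleftrightarrow> 0 < 10000 * a + (if 0 \<le> b then 16180 * b else 16181 * b) +
     (if 0 \<le> c then - 13383 * c else - 13382 * c) + (if 0 \<le> d then - 21656 * d else - 21651 * d)"

lemma interval_scale:
  fixes x :: real
  assumes "of_int l \<le> 10000 * x" "10000 * x \<le> of_int h"
  shows "of_int (if 0 \<le> b then l * b else h * b) \<le> 10000 * x * of_int b"
proof (cases "0 \<le> b")
  case True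
  then show ?thesis using mult_right_mono[OF assms(1), of "of_int b"] by simp
next
  case False
  then show ?thesis using mult_right_mono_neg[OF assms(2), of "of_int b"] by simp
qed

lemma npos: "npos x \<Longrightarrow> 0 < num_of x"
proof (cases x)
  fix a b c d assume x: "x = ZN a b c d" and "npos x"
  then have "0 < real_of_int (10000 * a + (if 0 \<le> b then 16180 * b else 16181 * b) +
     (if 0 \<le> c then - 13383 * c else - 13382 * c) + (if 0 \<le> d then - 21656 * d else - 21651 * d))"
    unfolding of_int_0_less_iff by simp
  also have "\<dots> \<le> 10000 * of_int a + 10000 * golden * of_int b + 10000 * nu * of_int c +
      10000 * (golden * nu) * of_int d"
    unfolding of_int_add using golden_bounds nu_bounds golden_nu_bounds
    by (intro add_mono interval_scale) simp_all
  also have "\<dots> = 10000 * num_of x" by (simp add: x zphi_def algebra_simps)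
  finally show "0 < num_of x" by simp
qed

section \<open>An orthonormal frame of the Coxeter plane\<close>

definition "code_1 = ZV (-1) 1 0 (-1) 0 0 1 0"
definition "code_2 = ZV 1 0 0 0 0 (-1) (-1) 1"
definition "code_m1 = ZV (-1) 1 (-1) 0 0 (-1) 0 0"
definition "code_m2 = ZV 1 0 0 (-1) (-1) 1 0 0"

lemma coxeter_codes:
  "coxeter (vec_of root_a) = vec_of code_1" "coxeter (vec_of code_1) = vec_of code_2"
  "coxeter_inv (vec_of root_a) = vec_of code_m1" "coxeter_inv (vec_of code_m1) = vec_of code_m2"
proof -
  have rel: "coxeter_rel root_a code_1" "coxeter_rel code_1 code_2" "coxeter_rel code_m1 root_a"
    "coxeter_rel code_m2 code_m1"
    by (simp_all add: coxeter_rel_def double_refl_def root_a_def root_b_def root_c_def code_1_def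
        code_2_def code_m1_def code_m2_def)
  show "coxeter (vec_of root_a) = vec_of code_1" "coxeter (vec_of code_1) = vec_of code_2"
    "coxeter_inv (vec_of root_a) = vec_of code_m1" "coxeter_inv (vec_of code_m1) = vec_of code_m2"
    using coxeter_rel[OF rel(1)] coxeter_rel[OF rel(2)] coxeter_rel[OF rel(3)] coxeter_rel[OF rel(4)]
      coxeter_inverse by metis+
qed

text \<open>This is \<open>(c + c^-1 - nu) root_a\<close>. The operator kills the
  \<open>nu\<close>-eigenspace, so the result is the projection of \<open>root_a\<close> to the
  Coxeter plane, up to a factor.\<close>

definition eigen :: "real^4" where
  "eigen = vec_of code_1 + vec_of code_m1 - nu *\<^sub>R vec_of root_a"

lemma coxeter_eigen: "coxeter eigen + coxeter_inv eigen = mu *\<^sub>R eigen"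
proof -
  have "coxeter eigen + coxeter_inv eigen =
      (vec_of code_2 + 2 *\<^sub>R vec_of root_a + vec_of code_m2) - nu *\<^sub>R (vec_of code_1 + vec_of code_m1)"
    using coxeter_codes coxeter_inverse(1)[of "vec_of root_a"] coxeter_inverse(2)[of "vec_of root_a"]
    by (simp add: eigen_def linear_add[OF linear_coxeter(1)] linear_add[OF linear_coxeter(2)]
        linear_diff[OF linear_coxeter(1)] linear_diff[OF linear_coxeter(2)]
        linear_scale[OF linear_coxeter(1)] linear_scale[OF linear_coxeter(2)] scaleR_2 algebra_simps)
  \<comment> \<open>The equation \<open>(t - mu) * (t - nu) = 0\<close> for
    \<open>t = c + c^-1\<close>, applied to \<open>root_a\<close>.\<close>
  also have "vec_of code_2 + 2 *\<^sub>R vec_of root_a + vec_of code_m2 =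
      (mu + nu) *\<^sub>R (vec_of code_1 + vec_of code_m1) - (mu * nu) *\<^sub>R vec_of root_a"
    unfolding mu_plus_nu mu_nu
    by (simp add: vec_4_eq_iff code_1_def code_2_def code_m1_def code_m2_def root_a_def zphi_def
        algebra_simps golden_sq)
  finally show ?thesis by (simp add: eigen_def algebra_simps)
qed

lemma eigen_nonzero: "eigen \<noteq> 0"
proof
  assume "eigen = 0"
  then have "eigen $ 4 = 0" by simp
  then show False by (simp add: eigen_def code_1_def code_m1_def root_a_def zphi_def)
qed

definition frame_q :: "real^4" where "frame_q = (1 / norm eigen) *\<^sub>R eigen"

text \<open>Chosen so that \<open>c^-1 q = sin (pi / 15) p + cos (pi / 15) q\<close>, which makes
  \<open>c\<close> turn counterclockwise. With \<open>eigen\<close> on the y-axis, the side of the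
  x-axis on which a vertex lies is decided within the ring.\<close>

definition frame_p :: "real^4" where
  "frame_p = (1 / sin (pi / 15)) *\<^sub>R (coxeter_inv frame_q - cos (pi / 15) *\<^sub>R frame_q)"

lemma sin_pos: "sin (pi / 15) > 0"
  by (rule sin_gt_zero) (auto simp: field_simps)

lemma frame_q_eq: "coxeter frame_q + coxeter_inv frame_q = (2 * cos (pi / 15)) *\<^sub>R frame_q"
  using coxeter_eigen
  by (simp add: frame_q_def linear_scale[OF linear_coxeter(1)] linear_scale[OF linear_coxeter(2)] mu_def
      flip: scaleR_add_right)

lemma norm_frame_q: "frame_q \<bullet> frame_q = 1"
  using eigen_nonzero by (simp add: frame_q_def power2_norm_eq_inner[symmetric] power2_eq_square)

lemma coxeter_inv_frame_q:
  "coxeter_inv frame_q = sin (pi / 15) *\<^sub>R frame_p + cos (pi / 15) *\<^sub>R frame_q"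
  using sin_pos by (simp add: frame_p_def)

lemma frame_q_coxeter_inv: "frame_q \<bullet> coxeter_inv frame_q = cos (pi / 15)"
proof -
  have "frame_q \<bullet> (coxeter frame_q + coxeter_inv frame_q) = 2 * cos (pi / 15)"
    unfolding frame_q_eq by (simp add: norm_frame_q)
  moreover have "frame_q \<bullet> coxeter frame_q = frame_q \<bullet> coxeter_inv frame_q"
    using coxeter_adjoint(1)[of frame_q frame_q] by (simp add: inner_commute)
  ultimately show ?thesis by (simp add: inner_add_right)
qed

lemma frame_pq: "frame_p \<bullet> frame_q = 0"
proof -
  have "frame_q \<bullet> frame_p = 0"
    by (simp add: frame_p_def inner_diff_right norm_frame_q frame_q_coxeter_inv)
  then show ?thesis by (simp add: inner_commute)
qed

lemma norm_frame_p: "frame_p \<bullet> frame_p = 1"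
proof -
  have "coxeter_inv frame_q \<bullet> coxeter_inv frame_q = 1"
    by (simp add: coxeter_adjoint(2) coxeter_inverse norm_frame_q)
  then have "(sin (pi / 15))^2 * (frame_p \<bullet> frame_p) + (cos (pi / 15))^2 = 1"
    unfolding coxeter_inv_frame_q
    by (simp add: inner_add_left inner_add_right frame_pq norm_frame_q inner_commute[of frame_q frame_p]
        power2_eq_square)
  then have "(sin (pi / 15))^2 * (frame_p \<bullet> frame_p) = (sin (pi / 15))^2"
    using sin_cos_squared_add[of "pi / 15"] by linarith
  then show ?thesis using sin_pos by simp
qed

text \<open>Applying \<open>c^-1\<close> to \<open>c q + c^-1 q = 2 cos (pi / 15) q\<close>
  expresses \<open>c^-2 q\<close> by \<open>c^-1 q\<close> and \<open>q\<close>, which determines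
  \<open>c^-1 p\<close>.\<close>

lemma coxeter_inv_frame_p:
  "coxeter_inv frame_p = cos (pi / 15) *\<^sub>R frame_p - sin (pi / 15) *\<^sub>R frame_q"
proof -
  let ?c = "cos (pi / 15)" and ?s = "sin (pi / 15)"
  have "coxeter_inv (coxeter frame_q + coxeter_inv frame_q) = coxeter_inv ((2 * ?c) *\<^sub>R frame_q)"
    using frame_q_eq by simp
  then have 1: "coxeter_inv (coxeter_inv frame_q) = (2 * ?c) *\<^sub>R coxeter_inv frame_q - frame_q"
    by (simp add: linear_add[OF linear_coxeter(2)] linear_scale[OF linear_coxeter(2)] coxeter_inverse
        algebra_simps)
  have "?s *\<^sub>R coxeter_inv frame_p = coxeter_inv (?s *\<^sub>R frame_p)"
    by (simp add: linear_scale[OF linear_coxeter(2)])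
  also have "?s *\<^sub>R frame_p = coxeter_inv frame_q - ?c *\<^sub>R frame_q"
    using coxeter_inv_frame_q by simp
  also have "coxeter_inv \<dots> = ?c *\<^sub>R coxeter_inv frame_q - frame_q"
    unfolding linear_diff[OF linear_coxeter(2)] linear_scale[OF linear_coxeter(2)] 1
    by (simp add: vec_eq_iff)
  also have "\<dots> = (?c * ?s) *\<^sub>R frame_p + (?c^2 - 1) *\<^sub>R frame_q"
    unfolding coxeter_inv_frame_q by (simp add: algebra_simps power2_eq_square)
  also have "?c^2 - 1 = - (?s * ?s)" using sin_cos_squared_add[of "pi / 15"] by (simp add: power2_eq_square)
  also have "(?c * ?s) *\<^sub>R frame_p + (- (?s * ?s)) *\<^sub>R frame_q = ?s *\<^sub>R (?c *\<^sub>R frame_p - ?s *\<^sub>R frame_q)"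
    by (simp add: algebra_simps)
  finally show ?thesis using sin_pos by simp
qed

lemma proj_coxeter: "plane_proj frame_p frame_q (coxeter x) = cis (pi / 15) * plane_proj frame_p frame_q x"
proof -
  have "frame_p \<bullet> coxeter x = coxeter_inv frame_p \<bullet> x" "frame_q \<bullet> coxeter x = coxeter_inv frame_q \<bullet> x"
    by (simp_all add: coxeter_adjoint)
  then show ?thesis
    by (simp add: plane_proj_def complex_eq_iff coxeter_inv_frame_p coxeter_inv_frame_q inner_add_left
        inner_diff_left algebra_simps)
qed

text \<open>The y-coordinate of the projection times \<open>norm eigen\<close>; omitting the
  normalisation keeps it in the ring.\<close>

fun height :: "zvec \<Rightarrow> znum" where
  "height v = ZN (zdot1 code_1 v + zdot1 code_m1 v) (zdot2 code_1 v + zdot2 code_m1 v)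
     (- zdot1 root_a v) (- zdot2 root_a v)"

lemma height: "eigen \<bullet> vec_of v = num_of (height v)"
  by (simp add: eigen_def inner_add_left inner_diff_left inner_vec_of zphi_def algebra_simps)

lemma frame_q_inner: "norm eigen * (frame_q \<bullet> vec_of v) = num_of (height v)"
  using eigen_nonzero unfolding height[symmetric] by (simp add: frame_q_def)

text \<open>If \<open>y\<close> is the image of \<open>-x\<close> under the Coxeter element, then \<open>squared_radius x y\<close> is the square
  of the length of the projection of \<open>x\<close>, up to a common factor.\<close>

definition squared_radius :: "zvec \<Rightarrow> zvec \<Rightarrow> znum" where
  "squared_radius x y = nadd (nadd (nmul (height x) (height x)) (nmul (height y) (height y)))
     (nmul (ZN (-1) 1 (-1) 0) (nmul (height x) (height y)))"

text \<open>For \<open>a = Im z\<close> and \<open>b = Im (cis t * z)\<close> one has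
  \<open>(sin t * cmod z)^2 = a^2 + b^2 - 2 * cos t * a * b\<close>. Here
  \<open>t = pi / 15\<close>, and the minus sign becomes plus because \<open>y\<close> is the
  negative of the image of \<open>x\<close>. The radius thus needs heights only.\<close>

lemma squared_radius:
  assumes "coxeter (vec_of x) = - vec_of y"
  shows "num_of (squared_radius x y) =
    (norm eigen * sin (pi / 15) * cmod (plane_proj frame_p frame_q (vec_of x)))^2"
proof -
  let ?c = "cos (pi / 15)" and ?s = "sin (pi / 15)" and ?x = "vec_of x"
  have "num_of (ZN (-1) 1 (-1) 0) = mu"
    using mu_plus_nu by (simp add: zphi_def algebra_simps)
  then have N: "num_of (squared_radius x y) =
      (norm eigen)^2 * ((frame_q \<bullet> ?x)^2 + (frame_q \<bullet> vec_of y)^2 + mu * (frame_q \<bullet> ?x) * (frame_q \<bullet> vec_of y))"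
    unfolding squared_radius_def num_of_nadd num_of_nmul frame_q_inner[symmetric]
    by (simp add: algebra_simps power2_eq_square)
  have y: "frame_q \<bullet> vec_of y = - (?s * (frame_p \<bullet> ?x) + ?c * (frame_q \<bullet> ?x))"
  proof -
    have "frame_q \<bullet> coxeter ?x = coxeter_inv frame_q \<bullet> ?x" by (simp add: coxeter_adjoint)
    then show ?thesis using assms by (simp add: coxeter_inv_frame_q inner_add_left)
  qed
  have "(frame_q \<bullet> ?x)^2 + (frame_q \<bullet> vec_of y)^2 + mu * (frame_q \<bullet> ?x) * (frame_q \<bullet> vec_of y) =
      ?s^2 * (frame_p \<bullet> ?x)^2 + (1 - ?c^2) * (frame_q \<bullet> ?x)^2"
    unfolding y mu_def by (simp add: algebra_simps power2_eq_square)
  also have "1 - ?c^2 = ?s^2" using sin_cos_squared_add[of "pi / 15"] by linarith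
  finally show ?thesis unfolding N
    by (simp add: cmod_power2 plane_proj_def power_mult_distrib algebra_simps)
qed

text \<open>The first vertex is on or above the x-axis and the last one, 24 degrees behind it, is
  strictly below. This confines the argument of the first to the required sector.\<close>

fun check_row :: "zvec list \<Rightarrow> bool" where
  "check_row xs \<longleftrightarrow> (height (xs ! 0) = ZN 0 0 0 0 \<or> npos (height (xs ! 0))) \<and>
     npos (nneg (height (xs ! 14)))"

lemma check_angles: "list_all check_row reps"
  by code_simp

fun check_radius :: "int \<times> znum \<Rightarrow> int \<times> znum \<Rightarrow> bool" where
  "check_radius (c, x) (c', y) \<longleftrightarrow> (if c = c' then x = y else if c < c' then npos (nadd x (nneg y)) else True)"

fun check_radii :: "(int \<times> znum) list \<Rightarrow> bool" where
  "check_radii xs \<longleftrightarrow> list_all (\<lambda>x. list_all (check_radius x) xs) xs"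

text \<open>The partner of entry 0 is entry 8, to whose negative \<open>c\<close> sends it.\<close>

lemma check_radii:
  "check_radii (zip [0, 1, 1, 2, 3, 3, 4, 4, 5, 5, 6, 6, 7, 7, 8, 8, 9, 10, 10, 11]
     (map (\<lambda>xs. squared_radius (xs ! 0) (xs ! 8)) reps))"
  by code_simp

section \<open>The numbering of the rays\<close>

lemma zphi_inject: "zphi a b = zphi c d \<longleftrightarrow> a = c \<and> b = d"
  using zphi_eq_0_iff[of "a - c" "b - d"] by (simp flip: zphi_diff)

lemma length_concat_reps: "length (concat reps) = 300"
  by (simp add: reps_def)

lemma nth_concat_rows:
  assumes "\<forall>xs\<in>set xss. length xs = m" "k < length xss" "i < m"
  shows "concat xss ! (m * k + i) = xss ! k ! i"
  using assms by (induction xss arbitrary: k) (auto simp: nth_append nth_Cons split: nat.splits)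

definition vertex_code :: "nat \<Rightarrow> zvec" where
  "vertex_code n = concat reps ! (n - 1)"

definition rep_vertex :: "nat \<Rightarrow> real^4" where
  "rep_vertex n = vec_of (vertex_code n)"

lemma vertex_code_in_reps: "n \<in> {1..300} \<Longrightarrow> vertex_code n \<in> set (concat reps)"
  unfolding vertex_code_def by (rule nth_mem) (auto simp: length_concat_reps)

lemma vertex_code_eq:
  assumes "k < 20" "i < 15"
  shows "vertex_code (15 * k + i + 1) = reps ! k ! i"
  using nth_concat_rows[of reps 15 k i] assms length_reps by (simp add: vertex_code_def list_all_iff)

lemma shift_index: "i < 15 \<Longrightarrow> shift m (15 * k + i + 1) = 15 * k + (i + m) mod 15 + 1"
  by (simp add: shift_def pent_def)

lemma index_cases:
  fixes n :: nat
  assumes "n \<in> {1..300}"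
  obtains k i where "k < 20" "i < 15" "n = 15 * k + i + 1"
proof
  show "n = 15 * pent n + (n - 1) mod 15 + 1"
    using assms div_mult_mod_eq[of "n - 1" 15] by (simp add: pent_def)
qed (use assms in \<open>auto simp: pent_def\<close>)

lemma coxeter_rep: "n \<in> {1..300} \<Longrightarrow> coxeter (rep_vertex n) = - rep_vertex (shift 8 n)"
proof -
  assume "n \<in> {1..300}"
  then obtain k i where n: "k < 20" "i < 15" "n = 15 * k + i + 1" by (rule index_cases)
  define xs where "xs = reps ! k"
  have len: "length xs = 15"
    using length_reps(2) n(1) unfolding xs_def list_all_length length_reps(1) by simp
  have "drop 8 xs @ take 8 xs = rotate 8 xs" using len by (simp add: rotate_drop_take)
  moreover have "list_all2 coxeter_rel xs (map zneg (drop 8 xs @ take 8 xs))"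
    using check_coxeter n(1) unfolding xs_def list_all_length length_reps(1) by simp
  ultimately have "coxeter_rel (xs ! i) (zneg (rotate 8 xs ! i))"
    using n(2) len by (auto simp: list_all2_conv_all_nth)
  moreover have "rotate 8 xs ! i = xs ! ((i + 8) mod 15)"
    using n(2) len by (simp add: nth_rotate add.commute)
  ultimately have "coxeter (vec_of (xs ! i)) = - vec_of (xs ! ((i + 8) mod 15))"
    by (simp add: coxeter_rel vec_of_zneg)
  then show ?thesis
    unfolding n(3) rep_vertex_def shift_index[OF n(2)] using n(1,2) by (simp add: vertex_code_eq[simplified] xs_def)
qed

definition rotation :: "real^4 \<Rightarrow> real^4" where
  "rotation = coxeter \<circ> coxeter"

lemma linear_rotation: "linear rotation"
  unfolding rotation_def by (intro linear_compose linear_coxeter)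

lemma orthogonal_rotation: "orthogonal_transformation rotation"
  unfolding rotation_def by (intro orthogonal_transformation_compose orthogonal_coxeter)

lemma rotation_inner: "rotation x \<bullet> rotation y = x \<bullet> y"
  using orthogonal_rotation by (simp add: orthogonal_transformation_def)

text \<open>The two negations in \<open>c^2\<close> cancel, and 8 + 8 is 1 modulo 15.\<close>

lemma rotation_rep: "n \<in> {1..300} \<Longrightarrow> rotation (rep_vertex n) = rep_vertex (shift 1 n)"
  using shift_in[of n 8] shift_mod[of 16 n]
  by (simp add: rotation_def coxeter_rep linear_neg[OF linear_coxeter(1)] shift_shift del: One_nat_def)
    (simp add: shift_def)

lemma rotation_iterate: "n \<in> {1..300} \<Longrightarrow> (rotation ^^ m) (rep_vertex n) = rep_vertex (shift m n)"
proof (induction m)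
  case (Suc m)
  then show ?case using rotation_rep[OF shift_in[OF Suc.prems]] by (simp add: shift_shift)
qed (simp add: shift_0)

lemma inner_shift:
  assumes "m \<in> {1..300}" "n \<in> {1..300}"
  shows "rep_vertex (shift d m) \<bullet> rep_vertex (shift d n) = rep_vertex m \<bullet> rep_vertex n"
proof -
  have "(rotation ^^ d) x \<bullet> (rotation ^^ d) y = x \<bullet> y" for x y
    by (induction d) (simp_all add: rotation_inner)
  from this[of "rep_vertex m" "rep_vertex n"] show ?thesis
    unfolding rotation_iterate[OF assms(1)] rotation_iterate[OF assms(2)] .
qed

lemma magnitude_index_range: "0 \<le> magnitude_index a b \<and> magnitude_index a b < 9"
  by (simp add: magnitude_index_def)

lemma magnitude_index: "magnitude_index a b < 8 \<Longrightarrow> (a, b) \<in> set (magnitude_codes (magnitude_index a b))"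
proof -
  have "magnitude_codes 0 = [(0,0)]" "magnitude_codes 1 = [(2,0), (-2,0)]" "magnitude_codes 2 = [(1,0), (-1,0)]"
    "magnitude_codes 3 = [(-1,2), (1,-2)]" "magnitude_codes 4 = [(2,-1), (-2,1)]"
    "magnitude_codes 5 = [(0,1), (0,-1)]" "magnitude_codes 6 = [(-1,1), (1,-1)]" "magnitude_codes 7 = [(1,1), (-1,-1)]"
    by (simp_all add: magnitude_codes_def)
  then show "magnitude_index a b < 8 \<Longrightarrow> (a, b) \<in> set (magnitude_codes (magnitude_index a b))"
    unfolding magnitude_index_def by (simp split: if_split_asm)
qed

lemma magnitude_index_uminus: "magnitude_index (- a) (- b) = magnitude_index a b"
  by (auto simp: magnitude_index_def)

lemma shape_code_inject:
  assumes "shape_code i j k l = shape_code i' j' k' l'"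
    "{i, j, k, l, i', j', k', l'} \<subseteq> {0..<9}"
  shows "i = i' \<and> j = j' \<and> k = k' \<and> l = l'"
proof -
  have b: "0 \<le> i" "i < 9" "0 \<le> j" "j < 9" "0 \<le> k" "k < 9" "0 \<le> l" "l < 9"
    "0 \<le> i'" "i' < 9" "0 \<le> j'" "j' < 9" "0 \<le> k'" "k' < 9" "0 \<le> l'" "l' < 9"
    using assms(2) by simp_all
  have eq: "729 * i + 81 * j + 9 * k + l = 729 * i' + 81 * j' + 9 * k' + l'"
    using assms(1) by (simp add: shape_code_def)
  have i: "i = i'" using eq b by linarith
  have j: "j = j'" using eq b unfolding i by linarith
  have k: "k = k'" using eq b unfolding i j by linarith
  show ?thesis using eq i j k by simp
qed

lemma shapes_range: "\<forall>(i, j, k, l)\<in>set shapes. {i, j, k, l} \<subseteq> {0..<8}"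
  by (simp add: shapes_def arrangements_def even_arrangements_def)

lemma is_vertex: "is_vertex shape_numbers v \<Longrightarrow> v \<in> set vertex_codes"
proof (cases v)
  fix a b c d e f g h assume v: "v = ZV a b c d e f g h" and "is_vertex shape_numbers v"
  then have "shape_code (magnitude_index a b) (magnitude_index c d) (magnitude_index e f) (magnitude_index g h) \<in>
      (\<lambda>(i, j, k, l). shape_code i j k l) ` set shapes"
    by (simp only: is_vertex.simps shape_numbers_def List.member_iff set_remdups set_map)
  then obtain t where t: "t \<in> set shapes"
    "shape_code (magnitude_index a b) (magnitude_index c d) (magnitude_index e f) (magnitude_index g h) =
     (case t of (i, j, k, l) \<Rightarrow> shape_code i j k l)" by blast
  obtain i j k l where tup: "t = (i, j, k, l)" by (cases t)
  have s: "(i, j, k, l) \<in> set shapes" and eq: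
    "shape_code (magnitude_index a b) (magnitude_index c d) (magnitude_index e f) (magnitude_index g h) =
     shape_code i j k l"
    using t unfolding tup case_prod_conv by blast+
  have r: "{i, j, k, l} \<subseteq> {0..<8}" using bspec[OF shapes_range s] unfolding case_prod_conv .
  have "magnitude_index a b = i \<and> magnitude_index c d = j \<and> magnitude_index e f = k \<and> magnitude_index g h = l"
    by (rule shape_code_inject[OF eq]) (use r magnitude_index_range in auto)
  then have "(a, b) \<in> set (magnitude_codes i)" "(c, d) \<in> set (magnitude_codes j)"
    "(e, f) \<in> set (magnitude_codes k)" "(g, h) \<in> set (magnitude_codes l)"
    using r magnitude_index[of a b] magnitude_index[of c d] magnitude_index[of e f] magnitude_index[of g h]
    by auto
  then have "v \<in> set (shape_codes (i, j, k, l))"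
    unfolding v shape_codes.simps set_concat set_map image_image by force
  then show ?thesis using s unfolding vertex_codes_def set_concat set_map set_remdups by blast
qed

lemma is_vertex_zneg: "is_vertex cs (zneg v) = is_vertex cs v"
  by (cases v) (simp add: magnitude_index_uminus)

lemma is_vertex_in_vertices: "is_vertex shape_numbers v \<Longrightarrow> vec_of v \<in> vertices"
  unfolding vertices_eq by (intro imageI is_vertex)

lemma check_reflections_iff:
  "check_reflections cs xs \<longleftrightarrow> (\<forall>x\<in>set xs. is_vertex cs x \<and> zdot1 x x = 8 \<and> zdot2 x x = 0 \<and>
     (\<forall>r\<in>{root_a, root_b, root_c, root_d}. zeven (double_refl r x) \<and> is_vertex cs (zrefl r x)))"
  by (induction xs) (auto simp: zrefl_def)

lemma rep_check:
  assumes "n \<in> {1..300}"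
  shows "is_vertex shape_numbers (vertex_code n)" "zdot1 (vertex_code n) (vertex_code n) = 8" "zdot2 (vertex_code n) (vertex_code n) = 0"
    "r \<in> {root_a, root_b, root_c, root_d} \<Longrightarrow> zeven (double_refl r (vertex_code n)) \<and> is_vertex shape_numbers (zrefl r (vertex_code n))"
  using check_reflections vertex_code_in_reps[OF assms] unfolding check_reflections_iff by blast+

lemma rep_vertex_in: "n \<in> {1..300} \<Longrightarrow> rep_vertex n \<in> vertices"
  unfolding rep_vertex_def by (rule is_vertex_in_vertices) (rule rep_check)

lemma neg_rep_vertex_in: "n \<in> {1..300} \<Longrightarrow> - rep_vertex n \<in> vertices"
  unfolding rep_vertex_def vec_of_zneg[symmetric]
  by (rule is_vertex_in_vertices) (simp add: is_vertex_zneg rep_check)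

lemma rep_inner_self: "n \<in> {1..300} \<Longrightarrow> rep_vertex n \<bullet> rep_vertex n = 8"
  using rep_check[of n] by (simp add: rep_vertex_def inner_vec_of zphi_def)

section \<open>The representatives account for all vertices and rays\<close>

abbreviation "all_entries \<equiv> entries 1 (concat reps)"

lemma set_entries: "set (entries m xs) = (\<lambda>i. Entry (m + int i) (xs ! i)) ` {..<length xs}"
proof (induction xs arbitrary: m)
  case (Cons x xs)
  have "{..<length (x # xs)} = insert 0 (Suc ` {..<length xs})"
    by (simp add: lessThan_Suc_eq_insert_0)
  then show ?case by (simp add: Cons image_image add.assoc)
qed simp

lemma set_all_entries: "set all_entries = (\<lambda>n. Entry (int n) (vertex_code n)) ` {1..300}"
proof -
  have "{1..300} = Suc ` {..<300}" by (simp add: image_Suc_lessThan)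
  then show ?thesis unfolding set_entries length_concat_reps by (simp add: image_image vertex_code_def)
qed

lemma set_leaders: "set (leaders es) = {x \<in> set es. index x mod 15 = 1}"
  by (induction es) auto

lemma leader_in: "n \<in> {1..300} \<Longrightarrow> n mod 15 = 1 \<Longrightarrow> Entry (int n) (vertex_code n) \<in> set (leaders all_entries)"
proof -
  assume n: "n \<in> {1..300}" "n mod 15 = 1"
  then have "int n mod 15 = 1" by (metis of_nat_1 of_nat_mod of_nat_numeral)
  then show ?thesis using n unfolding set_leaders set_all_entries by auto
qed

lemma leader_distinct:
  assumes "n \<in> {1..300}" "n mod 15 = 1" "m \<in> {1..300}" "rep_vertex n = rep_vertex m \<or> rep_vertex n = - rep_vertex m"
  shows "n = m"
proof -
  have "Entry (int m) (vertex_code m) \<in> set all_entries" using assms(3) unfolding set_all_entries by blast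
  then have diff: "different (Entry (int n) (vertex_code n)) (Entry (int m) (vertex_code m))"
    using check_distinct leader_in[OF assms(1,2)] unfolding check_distinct.simps list_all_iff by blast
  have "rep_vertex n \<bullet> rep_vertex m = 8 \<or> rep_vertex n \<bullet> rep_vertex m = -8"
    using assms(4) rep_inner_self[OF assms(3)] by auto
  moreover have "8 = zphi 8 0" "-8 = zphi (-8) 0" by (simp_all add: zphi_def)
  ultimately have "zdot2 (vertex_code n) (vertex_code m) = 0 \<and> (zdot1 (vertex_code n) (vertex_code m) = 8 \<or> zdot1 (vertex_code n) (vertex_code m) = -8)"
    unfolding rep_vertex_def inner_vec_of by (metis zphi_inject)
  then show ?thesis using diff by (auto split: if_splits)
qed

text \<open>The value is 15 rather than 0 at a leader, which is the same shift.\<close>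

definition to_leader :: "nat \<Rightarrow> nat" where
  "to_leader n = 15 - (n - 1) mod 15"

lemma shift_to_leader: "shift (to_leader n) n = 15 * pent n + 1"
proof -
  have "(n - 1) mod 15 < 15" by simp
  then have "(n - 1) mod 15 + to_leader n = 15" unfolding to_leader_def by linarith
  then show ?thesis by (simp add: shift_def)
qed

text \<open>Rotating both vertices until the first is a leader reduces this to the evaluated
  case.\<close>

lemma rep_vertex_distinct:
  assumes "n \<in> {1..300}" "m \<in> {1..300}" "rep_vertex n = rep_vertex m \<or> rep_vertex n = - rep_vertex m"
  shows "n = m"
proof -
  let ?d = "to_leader n"
  have neg: "(rotation ^^ d) (- x) = - (rotation ^^ d) x" for d x
    by (induction d) (simp_all add: linear_neg[OF linear_rotation])
  have "rep_vertex (shift ?d n) = rep_vertex (shift ?d m) \<or> rep_vertex (shift ?d n) = - rep_vertex (shift ?d m)"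
    using assms(3) neg[of ?d "rep_vertex m"]
    unfolding rotation_iterate[OF assms(1), symmetric] rotation_iterate[OF assms(2), symmetric] by metis
  moreover have "shift ?d n mod 15 = 1" by (simp add: shift_to_leader)
  ultimately have "shift ?d n = shift ?d m"
    using leader_distinct shift_in[OF assms(1)] shift_in[OF assms(2)] by blast
  then show ?thesis using inj_onD[OF inj_shift] assms(1,2) by fastforce
qed

text \<open>By counting: the representatives and their negatives are 600 distinct vertices, and
  there are at most 600.\<close>

lemma vertices_reps: "vertices = rep_vertex ` {1..300} \<union> uminus ` rep_vertex ` {1..300}"
proof -
  let ?W = "rep_vertex ` {1..300} \<union> uminus ` rep_vertex ` {1..300}"
  have inj: "inj_on rep_vertex {1..300}" by (intro inj_onI) (blast intro: rep_vertex_distinct)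
  have disj: "rep_vertex ` {1..300} \<inter> uminus ` rep_vertex ` {1..300} = {}"
  proof -
    have False if nm: "n \<in> {1..300}" "m \<in> {1..300}" "rep_vertex n = - rep_vertex m" for n m
    proof -
      have "n = m" by (rule rep_vertex_distinct[OF nm(1,2)]) (use nm(3) in blast)
      then have "rep_vertex n \<bullet> rep_vertex n = - (rep_vertex n \<bullet> rep_vertex n)"
        using nm(3) by (metis inner_minus_right)
      then show False using rep_inner_self[OF nm(1)] by simp
    qed
    then show ?thesis by blast
  qed
  have "card ?W = 600"
    using disj inj by (simp add: card_Un_disjoint card_image inj_on_def)
  moreover have "card vertices \<le> 600"
    unfolding vertices_eq length_vertex_codes[symmetric]
    by (rule order_trans[OF card_image_le card_length]) simp
  moreover have "?W \<subseteq> vertices" using rep_vertex_in neg_rep_vertex_in by blast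
  moreover have "finite vertices" unfolding vertices_eq by simp
  ultimately show ?thesis by (metis card_seteq)
qed

lemma reflection_in_vertices:
  assumes "r \<in> {root_a, root_b, root_c, root_d}" "x \<in> vertices"
  shows "reflection (half r) x \<in> vertices"
proof -
  have root: "is_root r" using assms(1) roots by blast
  have *: "reflection (half r) (rep_vertex n) \<in> vertices" if "n \<in> {1..300}" for n
    using rep_check(4)[OF that assms(1)] unfolding rep_vertex_def
    by (simp add: vec_of_zrefl[OF root] is_vertex_in_vertices)
  have neg: "- y \<in> vertices" if "y \<in> vertices" for y using that unfolding vertices_reps by auto
  from assms(2) obtain n where "n \<in> {1..300}" "x = rep_vertex n \<or> x = - rep_vertex n"
    unfolding vertices_reps by blast
  then show ?thesis using * neg by (auto simp: linear_neg[OF linear_reflection])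
qed

lemma symmetry_reflection:
  assumes "r \<in> {root_a, root_b, root_c, root_d}"
  shows "symmetry (reflection (half r))"
proof -
  have root: "half r \<bullet> half r = 1" using assms roots half_unit by blast
  have "x \<in> reflection (half r) ` vertices" if "x \<in> vertices" for x
    using reflection_in_vertices[OF assms that] reflection_involution[OF root, of x] by (metis imageI)
  then show ?thesis
    unfolding symmetry_def using orthogonal_reflection[OF root] reflection_in_vertices[OF assms] by blast
qed

lemma symmetry_compose: "symmetry f \<Longrightarrow> symmetry g \<Longrightarrow> symmetry (f \<circ> g)"
  unfolding symmetry_def by (metis image_comp orthogonal_transformation_compose)

lemma symmetry_coxeter: "symmetry coxeter"
  unfolding coxeter_def by (intro symmetry_compose symmetry_reflection) simp_all

lemma simple_roots_half: "simple_roots (half root_a) (half root_b) (half root_c) (half root_d)"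
proof -
  have "norm (half r) = 1 \<and> symmetry (reflection (half r))" if "r \<in> {root_a, root_b, root_c, root_d}" for r
  proof -
    have "half r \<bullet> half r = 1" using that roots half_unit by blast
    then show ?thesis using symmetry_reflection[OF that] unfolding norm_eq_1 by blast
  qed
  then show ?thesis
    unfolding simple_roots_def cos_pi_5 cos_60
    by (simp add: inner_vec_of) (simp add: root_a_def root_b_def root_c_def root_d_def zphi_def)
qed

lemma coxeter_frame: "coxeter_frame frame_p frame_q"
proof -
  have "\<forall>x. plane_proj frame_p frame_q ((reflection (half root_a) \<circ> reflection (half root_b) \<circ>
      reflection (half root_c) \<circ> reflection (half root_d)) x) =
      cis (2 * pi / 30) * plane_proj frame_p frame_q x"
    using proj_coxeter unfolding coxeter_def by simp
  then show ?thesis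
    unfolding coxeter_frame_def using simple_roots_half norm_frame_p norm_frame_q frame_pq
    by (auto simp: norm_eq_1)
qed

lemma proj_rotation:
  "plane_proj frame_p frame_q (rotation x) = cis (2 * pi / 15) * plane_proj frame_p frame_q x"
  by (simp add: rotation_def proj_coxeter cis_mult flip: mult.assoc)

lemma ray_eq: "ray x = range (\<lambda>t. t *\<^sub>R x)"
  unfolding ray_def by (rule span_singleton)

lemma ray_uminus: "ray (- x) = ray x"
proof -
  have "t *\<^sub>R - x = (- t) *\<^sub>R x" "t *\<^sub>R x = (- t) *\<^sub>R - x" for t by simp_all
  then show ?thesis unfolding ray_eq by (intro set_eqI iffI; elim rangeE) (metis rangeI)+
qed

lemma ray_rep_inj: "inj_on (\<lambda>n. ray (rep_vertex n)) {1..300}"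
proof (rule inj_onI)
  fix m n assume mn: "m \<in> {1..300}" "n \<in> {1..300}" "ray (rep_vertex m) = ray (rep_vertex n)"
  have "rep_vertex m \<in> ray (rep_vertex m)" unfolding ray_def by (simp add: span_base)
  then obtain t where t: "rep_vertex m = t *\<^sub>R rep_vertex n" using mn(3) unfolding ray_eq by blast
  then have "8 = t * t * 8" using rep_inner_self[OF mn(1)] rep_inner_self[OF mn(2)] by simp
  then have "t = 1 \<or> t = -1" by (simp add: square_eq_1_iff)
  then show "m = n" using t mn(1,2) by (intro rep_vertex_distinct) auto
qed

lemma rays_reps: "rays = (\<lambda>n. ray (rep_vertex n)) ` {1..300}"
  unfolding rays_def vertices_reps image_Un image_image ray_uminus by simp

lemma orthogonal_rays_iff: "orthogonal_rays (ray x) (ray y) \<longleftrightarrow> x \<bullet> y = 0"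
proof
  assume "orthogonal_rays (ray x) (ray y)"
  then show "x \<bullet> y = 0" unfolding orthogonal_rays_def ray_def orthogonal_def by (simp add: span_base)
next
  assume "x \<bullet> y = 0"
  then show "orthogonal_rays (ray x) (ray y)" unfolding orthogonal_rays_def ray_eq orthogonal_def by auto
qed


section \<open>The bases\<close>

lemma linear_image_ray: "linear f \<Longrightarrow> f ` ray x = ray (f x)"
  unfolding ray_eq by (simp add: image_image linear_scale)

lemma rotation_ray: "n \<in> {1..300} \<Longrightarrow> rotation ` ray (rep_vertex n) = ray (rep_vertex (shift 1 n))"
  unfolding linear_image_ray[OF linear_rotation] by (simp only: rotation_rep)

lemma bij_rep_vertex: "bij_betw (\<lambda>n. ray (rep_vertex n)) {1..300} rays"
  unfolding bij_betw_def using ray_rep_inj rays_reps by simp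

lemma nth_int: "k < length xs \<Longrightarrow> nth_int xs (int k) = xs ! k"
  by (induction xs arbitrary: k) (auto simp: nth_Cons split: nat.splits)

lemma pairwise_orthogonal:
  "pairwise_orthogonal (map f xs) \<Longrightarrow> x \<in> set xs \<Longrightarrow> y \<in> set xs \<Longrightarrow> x \<noteq> y \<Longrightarrow> zorthogonal (f x) (f y)"
proof (induction xs)
  case (Cons z xs)
  have "zorthogonal v w = zorthogonal w v" for v w
    by (simp add: zorthogonal_iff inner_commute)
  then show ?case using Cons by (auto simp: list_all_iff)
qed simp

lemma generator_orthogonal:
  assumes "a \<in> generator l" "b \<in> generator l" "a \<noteq> b"
  shows "rep_vertex a \<bullet> rep_vertex b = 0"
proof -
  let ?f = "\<lambda>n. nth_int (nth_int reps ((n - 1) div 15)) ((n - 1) mod 15)"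
  have f: "?f (int c) = vertex_code c" if "c \<in> generator l" for c
  proof -
    have "c \<in> {1..300}" using that generator_range by blast
    then obtain k i where c: "k < 20" "i < 15" "c = 15 * k + i + 1" by (rule index_cases)
    have "length (reps ! k) = 15" using length_reps(2) c(1) unfolding list_all_length length_reps(1) by simp
    moreover have "(int c - 1) div 15 = int k" "(int c - 1) mod 15 = int i" using c(2) by (simp_all add: c(3))
    ultimately show ?thesis
      using vertex_code_eq[OF c(1,2), folded c(3)] c(1,2) by (simp add: nth_int length_reps(1))
  qed
  have "pairwise_orthogonal (map ?f (generator_list l))"
    using check_generators unfolding list_all_iff set_letters by blast
  moreover have "int a \<in> set (generator_list l)" "int b \<in> set (generator_list l)"
    using assms(1,2) unfolding generator_list[symmetric] by blast+
  ultimately have "zorthogonal (?f (int a)) (?f (int b))"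
    using assms(3) by (intro pairwise_orthogonal) simp_all
  then show ?thesis using f assms(1,2) by (simp add: zorthogonal_iff rep_vertex_def)
qed

lemma card_generator: "card (generator l) = 4"
  by (cases l) simp_all

lemma in_aligned:
  assumes "Q \<in> set (aligned (int n))" "n mod 15 = 1"
  obtains l m where "set Q = int ` shift m ` generator l" "n \<in> shift m ` generator l"
proof -
  obtain l z where Q: "Q = map (shift_int (15 - (z - 1) mod 15)) (generator_list l)"
    and z: "z \<in> set (generator_list l)" "(z - 1) div 15 = (int n - 1) div 15"
    using assms(1) unfolding aligned_def by auto
  have "z \<in> int ` generator l" using z(1) by (simp add: generator_list)
  then obtain b where b: "b \<in> generator l" "z = int b" by blast
  have "0 < b" "0 < n" using generator_pos[OF b(1)] assms(2) by (auto intro: Nat.gr0I)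
  then have "int (pent b) = int (pent n)"
    using z(2) unfolding b(2) by (simp add: pent_def zdiv_int of_nat_diff)
  then have pent: "pent b = pent n" by simp
  have "15 - (z - 1) mod 15 = int (to_leader b)"
  proof -
    have "(b - 1) mod 15 \<le> 15" using mod_less_divisor[of 15 "b - 1"] by linarith
    then have "int (to_leader b) = 15 - int ((b - 1) mod 15)" unfolding to_leader_def by (simp add: of_nat_diff)
    then show ?thesis using \<open>0 < b\<close> unfolding b(2) by (simp add: zmod_int of_nat_diff)
  qed
  then have "set Q = shift_int (int (to_leader b)) ` int ` generator l"
    by (simp add: Q generator_list)
  also have "\<dots> = int ` shift (to_leader b) ` generator l"
    unfolding image_image using generator_pos[of _ l] by (intro image_cong refl) (simp add: int_shift)
  finally have "set Q = int ` shift (to_leader b) ` generator l" .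
  moreover have "n = shift (to_leader b) b"
  proof -
    have "n = 15 * (n div 15) + 1" using assms(2) div_mult_mod_eq[of n 15] by simp
    moreover from this have "pent n = n div 15" unfolding pent_def by (metis add_diff_cancel_right' nonzero_mult_div_cancel_left zero_neq_numeral)
    ultimately show ?thesis by (simp add: shift_to_leader pent)
  qed
  ultimately show ?thesis using that b(1) by blast
qed

lemma adjacent_iff: "adjacent (Entry i (vertex_code m)) (Entry j (vertex_code n)) \<longleftrightarrow> rep_vertex m \<bullet> rep_vertex n = 0"
  by (simp add: zorthogonal_iff rep_vertex_def)

text \<open>Take another member \<open>x\<close> of \<open>A\<close>. The remaining members are
  orthogonal to \<open>n\<close> and to \<open>x\<close>, so the basis of the table that the check
  provides for \<open>x\<close> contains all of \<open>A\<close>; both have four elements.\<close>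

lemma orthogonal_leader_orbit:
  assumes A: "A \<subseteq> {1..300}" "card A = 4" "\<forall>a\<in>A. \<forall>b\<in>A. a \<noteq> b \<longrightarrow> rep_vertex a \<bullet> rep_vertex b = 0"
    and n: "n \<in> A" "n mod 15 = 1"
  shows "\<exists>l m. A = shift m ` generator l"
proof -
  let ?E = "\<lambda>n. Entry (int n) (vertex_code n)"
  let ?N = "filter (adjacent (?E n)) all_entries"
  have fin: "finite A" using A(2) by (intro card_ge_0_finite) simp
  have "n \<in> {1..300}" using n(1) A(1) by blast
  then have "?E n \<in> set (leaders all_entries)" using n(2) by (rule leader_in)
  with check_bases[unfolded check_leaders.simps list_all_iff] have "check_leader all_entries (?E n)"
    by (rule bspec)
  then have N: "\<forall>x\<in>set ?N. \<exists>Q\<in>set (aligned (int n)). index x \<in> set Q \<and>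
      (\<forall>y\<in>set (filter (adjacent x) ?N). index y \<in> set Q)"
    by (simp only: check_leader.simps check_neighbours.simps list_all_iff list_ex_iff List.member_iff entry.sel)
  have in_N: "?E y \<in> set ?N" if "y \<in> A" "y \<noteq> n" for y
  proof -
    have "y \<in> {1..300}" using that(1) A(1) by blast
    then have "?E y \<in> set all_entries" unfolding set_all_entries by (rule imageI)
    moreover have "rep_vertex n \<bullet> rep_vertex y = 0" using A(3) n(1) that by metis
    ultimately show ?thesis unfolding set_filter mem_Collect_eq adjacent_iff by (rule conjI)
  qed
  have "A - {n} \<noteq> {}"
  proof
    assume "A - {n} = {}"
    then have "card A \<le> card {n}" by (intro card_mono) auto
    then show False using A(2) by simp
  qed
  then obtain x where x: "x \<in> A" "x \<noteq> n" by blast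
  obtain Q where Q: "Q \<in> set (aligned (int n))" "int x \<in> set Q"
    "\<forall>y\<in>set (filter (adjacent (?E x)) ?N). index y \<in> set Q"
    using bspec[OF N in_N[OF x]] unfolding entry.sel by blast
  obtain l m where lm: "set Q = int ` shift m ` generator l" "n \<in> shift m ` generator l"
    using Q(1) n(2) by (rule in_aligned)
  have "A \<subseteq> shift m ` generator l"
  proof
    fix y assume y: "y \<in> A"
    have "int y \<in> set Q" if "y \<noteq> n"
    proof (cases "y = x")
      case False
      then have "rep_vertex x \<bullet> rep_vertex y = 0" using A(3) x(1) y by metis
      with in_N[OF y that] have "?E y \<in> set (filter (adjacent (?E x)) ?N)"
        unfolding set_filter[of "adjacent (?E x)"] mem_Collect_eq adjacent_iff by (rule conjI)
      from bspec[OF Q(3) this] show ?thesis unfolding entry.sel .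
    qed (use Q(2) in simp)
    then show "y \<in> shift m ` generator l"
      using lm(2) inj_image_mem_iff[OF inj_of_nat[where 'a = int], of y] unfolding lm(1) by (cases "y = n") simp_all
  qed
  moreover have "card (shift m ` generator l) \<le> card A"
    using card_image_le[of "generator l" "shift m"] by (simp add: A(2) card_generator)
  ultimately have "A = shift m ` generator l" by (intro card_seteq) simp_all
  then show ?thesis by blast
qed

text \<open>Some member is rotated to a leader, and the rotation is undone by 14 further
  repetitions.\<close>

lemma orthogonal_orbit:
  assumes A: "A \<subseteq> {1..300}" "card A = 4" "\<forall>a\<in>A. \<forall>b\<in>A. a \<noteq> b \<longrightarrow> rep_vertex a \<bullet> rep_vertex b = 0"
  shows "\<exists>l. A \<in> index_orbit l"
proof -
  obtain n where n: "n \<in> A" using A(2) by fastforce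
  let ?d = "to_leader n"
  have inj: "inj_on (shift ?d) A" using A(1) by (intro inj_on_subset[OF inj_shift]) auto
  have "\<exists>l m. shift ?d ` A = shift m ` generator l"
  proof (rule orthogonal_leader_orbit)
    show "shift ?d ` A \<subseteq> {1..300}" using A(1) shift_in by blast
    show "card (shift ?d ` A) = 4" using A(2) inj by (simp add: card_image)
    show "shift ?d n \<in> shift ?d ` A" using n by blast
    show "shift ?d n mod 15 = 1" by (simp add: shift_to_leader)
    show "\<forall>a\<in>shift ?d ` A. \<forall>b\<in>shift ?d ` A. a \<noteq> b \<longrightarrow> rep_vertex a \<bullet> rep_vertex b = 0"
    proof (intro ballI impI)
      fix a b assume "a \<in> shift ?d ` A" "b \<in> shift ?d ` A" "a \<noteq> b"
      then obtain a' b' where ab: "a' \<in> A" "b' \<in> A" "a' \<noteq> b'" "a = shift ?d a'" "b = shift ?d b'" by blast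
      have "rep_vertex a' \<bullet> rep_vertex b' = 0" using A(3) ab(1-3) by blast
      moreover have "a' \<in> {1..300}" "b' \<in> {1..300}" using A(1) ab(1,2) by blast+
      ultimately show "rep_vertex a \<bullet> rep_vertex b = 0" unfolding ab(4,5) by (simp only: inner_shift)
    qed
  qed
  then obtain l m where lm: "shift ?d ` A = shift m ` generator l" by blast
  have "shift (14 * ?d) ` shift ?d ` A = shift (15 * ?d mod 15) ` A"
    unfolding shift_image_shift shift_mod by simp
  also have "\<dots> = A" using A(1) by (force simp: shift_0)
  finally have "A = shift (14 * ?d + m) ` generator l" unfolding lm shift_image_shift by simp
  then show ?thesis unfolding index_orbit_eq by blast
qed

lemma bases_eq: "bases = word_bases rotation rep_vertex UNIV"
proof -
  let ?R = "ray_of rep_vertex"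
  have W: "word_bases rotation rep_vertex UNIV = (`) ?R ` \<Union> (index_orbit ` UNIV)"
    using word_bases_eq[OF bij_rep_vertex rotation_ray] by simp
  have inj: "inj_on ?R {1..300}" and rays: "rays = ?R ` {1..300}"
    using ray_rep_inj rays_reps by (simp_all add: ray_of_def[abs_def])
  show ?thesis
  proof (intro set_eqI iffI)
    fix B assume "B \<in> bases"
    then have B: "B \<subseteq> ?R ` {1..300}" "card B = 4" "pairwise orthogonal_rays B"
      unfolding bases_def rays by auto
    then obtain A where A: "A \<subseteq> {1..300}" "B = ?R ` A" by (auto simp: subset_image_iff)
    have "card A = 4" using B(2) A inj_on_subset[OF inj A(1)] by (simp add: card_image)
    moreover have "\<forall>a\<in>A. \<forall>b\<in>A. a \<noteq> b \<longrightarrow> rep_vertex a \<bullet> rep_vertex b = 0"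
    proof (intro ballI impI)
      fix a b assume ab: "a \<in> A" "b \<in> A" "a \<noteq> b"
      then have "?R a \<noteq> ?R b" using inj_onD[OF inj, of a b] A(1) by blast
      then have "orthogonal_rays (?R a) (?R b)" using B(3) ab A(2) by (auto simp: pairwise_def)
      then show "rep_vertex a \<bullet> rep_vertex b = 0" by (simp add: ray_of_def orthogonal_rays_iff)
    qed
    ultimately obtain l where "A \<in> index_orbit l" using orthogonal_orbit[OF A(1)] by blast
    then show "B \<in> word_bases rotation rep_vertex UNIV" unfolding W A(2) by blast
  next
    fix B assume "B \<in> word_bases rotation rep_vertex UNIV"
    then obtain l m where B: "B = ?R ` shift m ` generator l" unfolding W index_orbit_eq by blast
    have gen: "a \<in> {1..300}" if "a \<in> generator l" for a using that generator_range by blast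
    have sub: "shift m ` generator l \<subseteq> {1..300}" using gen shift_in by blast
    have "inj_on (shift m) (generator l)" using generator_pos by (intro inj_on_subset[OF inj_shift]) auto
    then have "card B = 4"
      unfolding B using inj_on_subset[OF inj sub] by (simp add: card_image card_generator)
    moreover have "orthogonal_rays (?R (shift m a)) (?R (shift m b))"
      if "a \<in> generator l" "b \<in> generator l" "a \<noteq> b" for a b
      unfolding ray_of_def orthogonal_rays_iff inner_shift[OF gen[OF that(1)] gen[OF that(2)]]
      by (rule generator_orthogonal[OF that])
    then have "pairwise orthogonal_rays B" unfolding B pairwise_def by blast
    moreover have "B \<subseteq> rays" unfolding B rays using sub by blast
    ultimately show "B \<in> bases" by (simp add: bases_def)
  qed
qed

section \<open>Parity proofs\<close>

abbreviation proj :: "real^4 \<Rightarrow> complex" where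
  "proj \<equiv> plane_proj frame_p frame_q"

definition first :: "nat \<Rightarrow> complex" where
  "first k = proj (rep_vertex (15 * k + 1))"

lemma proj_rep:
  assumes "k < 20" "i < 15"
  shows "proj (rep_vertex (15 * k + i + 1)) = cis (real i * (2 * pi / 15)) * first k"
proof -
  have "proj ((rotation ^^ m) x) = cis (real m * (2 * pi / 15)) * proj x" for m x
  proof (induction m)
    case (Suc m)
    have "cis (2 * pi / 15) * cis (real m * (2 * pi / 15)) = cis (real (Suc m) * (2 * pi / 15))"
      unfolding cis_mult by (rule arg_cong[of _ _ cis]) (simp add: distrib_right)
    then show ?case
      by (simp only: funpow.simps comp_apply proj_rotation Suc.IH mult.assoc[symmetric])
  qed simp
  from this[of i "rep_vertex (15 * k + 1)"] show ?thesis
    using rotation_iterate[of "15 * k + 1" i] assms shift_index[of 0 i k] by (simp add: first_def)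
qed

lemma Im_proj: "Im (proj x) = frame_q \<bullet> x"
  by (simp add: plane_proj_def)

lemma norm_eigen_pos: "norm eigen > 0"
  using eigen_nonzero by simp

lemma Im_proj_vec_of:
  "height v = ZN 0 0 0 0 \<or> npos (height v) \<Longrightarrow> 0 \<le> Im (proj (vec_of v))"
  "npos (nneg (height v)) \<Longrightarrow> Im (proj (vec_of v)) < 0"
proof -
  have *: "norm eigen * Im (proj (vec_of v)) = num_of (height v)"
    unfolding Im_proj by (rule frame_q_inner)
  show "0 \<le> Im (proj (vec_of v))" if "height v = ZN 0 0 0 0 \<or> npos (height v)"
  proof -
    have "0 \<le> num_of (height v)" using that npos[of "height v"] by (auto simp: zphi_def simp del: height.simps)
    then show ?thesis using * norm_eigen_pos by (metis zero_le_mult_iff not_le)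
  qed
  show "Im (proj (vec_of v)) < 0" if "npos (nneg (height v))"
  proof -
    have "num_of (height v) < 0" using npos[OF that] unfolding num_of_nneg by linarith
    then show ?thesis using * norm_eigen_pos by (metis mult_nonneg_nonneg less_imp_le not_le)
  qed
qed

lemma first_sector:
  assumes "k < 20"
  shows "0 \<le> Im (first k)" "Im (cis (14 * (2 * pi / 15)) * first k) < 0"
proof -
  have "check_row (reps ! k)"
    using check_angles assms unfolding list_all_length length_reps(1) by blast
  moreover have "vertex_code (15 * k + 1) = reps ! k ! 0" "vertex_code (15 * k + 14 + 1) = reps ! k ! 14"
    using vertex_code_eq[of k 0] vertex_code_eq[of k 14] assms by simp_all
  moreover have "proj (rep_vertex (15 * k + 14 + 1)) = cis (14 * (2 * pi / 15)) * first k"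
    using proj_rep[of k 14] assms by simp
  ultimately show "0 \<le> Im (first k)" "Im (cis (14 * (2 * pi / 15)) * first k) < 0"
    unfolding first_def check_row.simps rep_vertex_def using Im_proj_vec_of by metis+
qed

lemma Arg_first:
  assumes "k < 20"
  shows "first k \<noteq> 0" "0 \<le> Arg (first k)" "Arg (first k) < 2 * pi / 15"
proof -
  let ?z = "first k" and ?t = "Arg (first k)"
  show "?z \<noteq> 0" using first_sector(2)[OF assms] by auto
  then have pos: "0 < cmod ?z" by simp
  have z: "?z = rcis (cmod ?z) ?t" by (simp add: rcis_cmod_Arg)
  have t: "- pi < ?t" "?t \<le> pi" using Arg_bounded[of ?z] by auto
  have "Im ?z = cmod ?z * sin ?t" by (subst z) simp
  then have s: "0 \<le> sin ?t" using first_sector(1)[OF assms] pos by (simp add: zero_le_mult_iff)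
  show "0 \<le> ?t"
  proof (rule ccontr)
    assume "\<not> 0 \<le> ?t"
    then have "0 < sin (- ?t)" using t by (intro sin_gt_zero) auto
    then show False using s by simp
  qed
  have "cis (14 * (2 * pi / 15)) * ?z = rcis (cmod ?z) (14 * (2 * pi / 15) + ?t)"
    by (subst z) (simp add: rcis_def cis_mult)
  \<comment> \<open>Fourteen steps forward are one step back, up to a full turn.\<close>
  also have "14 * (2 * pi / 15) + ?t = (?t - 2 * pi / 15) + 2 * pi" by simp
  finally have "Im (cis (14 * (2 * pi / 15)) * ?z) = cmod ?z * sin (?t - 2 * pi / 15)"
    by (simp only: Im_rcis sin_periodic)
  then have s': "sin (?t - 2 * pi / 15) < 0"
    using first_sector(2)[OF assms] pos by (simp add: mult_less_0_iff)
  show "?t < 2 * pi / 15"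
  proof (rule ccontr)
    assume "\<not> ?t < 2 * pi / 15"
    moreover have "?t - 2 * pi / 15 \<le> pi" using t(2) pi_gt_zero by linarith
    ultimately have "0 \<le> sin (?t - 2 * pi / 15)" by (intro sin_ge_zero) auto
    then show False using s' by simp
  qed
qed

lemma first_radius:
  assumes "k < 20"
  shows "(norm eigen * sin (pi / 15) * cmod (first k))^2 =
    num_of (squared_radius (reps ! k ! 0) (reps ! k ! 8))"
proof -
  have "coxeter (rep_vertex (15 * k + 1)) = - rep_vertex (15 * k + 8 + 1)"
    using coxeter_rep[of "15 * k + 1"] shift_index[of 0 8 k] assms by simp
  then have "coxeter (vec_of (reps ! k ! 0)) = - vec_of (reps ! k ! 8)"
    using vertex_code_eq[of k 0] vertex_code_eq[of k 8] assms by (simp add: rep_vertex_def)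
  then show ?thesis
    using squared_radius vertex_code_eq[of k 0] assms by (simp add: first_def rep_vertex_def)
qed

lemma first_circle:
  assumes "k < 20" "l < 20"
  shows "circle k = circle l \<Longrightarrow> cmod (first k) = cmod (first l)"
    "circle k < circle l \<Longrightarrow> cmod (first l) < cmod (first k)"
proof -
  let ?C = "[0, 1, 1, 2, 3, 3, 4, 4, 5, 5, 6, 6, 7, 7, 8, 8, 9, 10, 10, 11] :: int list"
  let ?f = "\<lambda>xs. squared_radius (xs ! 0) (xs ! 8)"
  let ?r = "\<lambda>k. num_of (?f (reps ! k))"
  let ?zs = "zip ?C (map ?f reps)"
  have C: "?C ! m = int (circle m)" if "m < 20" for m
  proof -
    have "?C = map int [0, 1, 1, 2, 3, 3, 4, 4, 5, 5, 6, 6, 7, 7, 8, 8, 9, 10, 10, 11]" by simp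
    then show ?thesis unfolding circle_def using that by (simp only: nth_map length_Cons list.size)
  qed
  have z: "(int (circle m), ?f (reps ! m)) \<in> set ?zs" if "m < 20" for m
  proof -
    have len: "length ?C = 20" "length (map ?f reps) = 20" by (simp_all add: length_reps)
    then have "?zs ! m = (int (circle m), ?f (reps ! m))"
      using that C[OF that] length_reps(1) by (simp only: nth_zip nth_map)
    moreover have "?zs ! m \<in> set ?zs" using that len by (intro nth_mem) (simp only: length_zip min.idem)
    ultimately show ?thesis by (simp only:)
  qed
  have "\<forall>x\<in>set ?zs. \<forall>y\<in>set ?zs. check_radius x y"
    using check_radii unfolding check_radii.simps list_all_iff .
  from bspec[OF bspec[OF this z[OF assms(1)]] z[OF assms(2)]]
  have *: "if circle k = circle l then ?f (reps ! k) = ?f (reps ! l) else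
      if circle k < circle l then npos (nadd (?f (reps ! k)) (nneg (?f (reps ! l)))) else True"
    unfolding check_radius.simps of_nat_eq_iff of_nat_less_iff .
  have c: "?r k = ?r l" if "circle k = circle l"
    using * unfolding if_P[OF that] by (rule arg_cong)
  have c': "?r l < ?r k" if "circle k < circle l"
  proof -
    have "npos (nadd (?f (reps ! k)) (nneg (?f (reps ! l))))"
      using * that unfolding if_P[OF that] if_not_P[OF less_imp_neq[OF that]] by iprover
    from npos[OF this] show ?thesis unfolding num_of_nadd num_of_nneg by linarith
  qed
  let ?K = "norm eigen * sin (pi / 15)"
  have K: "0 < ?K" using norm_eigen_pos sin_pos by (rule mult_pos_pos)
  have nonneg: "0 \<le> ?K * cmod z" for z
    using less_imp_le[OF K] norm_ge_zero by (rule mult_nonneg_nonneg)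
  show "cmod (first k) = cmod (first l)" if "circle k = circle l"
  proof -
    have "(?K * cmod (first k))^2 = (?K * cmod (first l))^2"
      unfolding first_radius[OF assms(1)] first_radius[OF assms(2)] using c[OF that] .
    then have "?K * cmod (first k) = ?K * cmod (first l)" by (rule power2_eq_imp_eq[OF _ nonneg nonneg])
    then show ?thesis unfolding mult_cancel_left using K by linarith
  qed
  show "cmod (first l) < cmod (first k)" if "circle k < circle l"
  proof -
    have "(?K * cmod (first l))^2 < (?K * cmod (first k))^2"
      unfolding first_radius[OF assms(1)] first_radius[OF assms(2)] using c'[OF that] .
    then have "?K * cmod (first l) < ?K * cmod (first k)" by (rule power2_less_imp_less[OF _ nonneg])
    then show ?thesis unfolding mult_less_cancel_left_pos[OF K] .
  qed
qed

lemma triacontagonal: "triacontagonal_numbering frame_p frame_q rep_vertex"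
  unfolding triacontagonal_numbering_def
proof (intro conjI)
  show "coxeter_frame frame_p frame_q" by (rule coxeter_frame)
  show "rep_vertex ` {1..300} \<subseteq> vertices" using rep_vertex_in by blast
  show "bij_betw (\<lambda>n. ray (rep_vertex n)) {1..300} rays" by (rule bij_rep_vertex)
  show "\<exists>R \<theta>.
        (\<forall>k<20. 0 < R k \<and> 0 \<le> \<theta> k \<and> \<theta> k < 2 * pi / 15) \<and>
        (\<forall>k<20. \<forall>i<15. proj (rep_vertex (15 * k + i + 1)) = rcis (R k) (\<theta> k + real i * (2 * pi / 15))) \<and>
        (\<forall>k<20. \<forall>l<20. (circle k = circle l \<longrightarrow> R k = R l) \<and> (circle k < circle l \<longrightarrow> R l < R k))"
  proof (intro exI conjI allI impI)
    fix k i :: nat assume "k < 20" "i < 15"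
    have "rcis (cmod (first k)) (Arg (first k) + real i * (2 * pi / 15)) =
        cis (real i * (2 * pi / 15)) * rcis (cmod (first k)) (Arg (first k))"
      by (simp add: rcis_def cis_mult add.commute)
    then show "proj (rep_vertex (15 * k + i + 1)) =
        rcis (cmod (first k)) (Arg (first k) + real i * (2 * pi / 15))"
      unfolding proj_rep[OF \<open>k < 20\<close> \<open>i < 15\<close>] rcis_cmod_Arg by simp
  next
    fix k :: nat assume "k < 20"
    note Arg = Arg_first[OF this]
    show "0 < cmod (first k)" using Arg(1) by simp
    show "0 \<le> Arg (first k)" "Arg (first k) < 2 * pi / 15" by (rule Arg)+
  next
    fix k l :: nat assume kl: "k < 20" "l < 20"
    show "cmod (first k) = cmod (first l)" if "circle k = circle l" using kl that by (rule first_circle)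
    show "cmod (first l) < cmod (first k)" if "circle k < circle l" using kl that by (rule first_circle)
  qed
qed

lemma rotation_numbering: "numbering frame_p frame_q rep_vertex rotation"
  unfolding numbering_def rotation_symmetry_def
proof (intro conjI allI impI)
  show "triacontagonal_numbering frame_p frame_q rep_vertex" by (rule triacontagonal)
  show "symmetry rotation" unfolding rotation_def by (intro symmetry_compose symmetry_coxeter)
  show "proj (rotation x) = cis (2 * pi / 15) * proj x" for x by (rule proj_rotation)
  show "rotation ` ray (rep_vertex (15 * k + i + 1)) = ray (rep_vertex (15 * k + (i + 1) mod 15 + 1))"
    if "k < 20" "i < 15" for k i
    using rotation_ray[of "15 * k + i + 1"] that unfolding shift_index[OF that(2)] by simp
  show "bases = word_bases rotation rep_vertex UNIV" by (rule bases_eq)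
qed

text \<open>The assumptions under which the count was carried out, in the order in which the
  contexts require them.\<close>

lemma numberingD:
  assumes "numbering p q u g"
  shows "bij_betw (\<lambda>n. ray (u n)) {1..300} rays"
    "\<And>n. n \<in> {1..300} \<Longrightarrow> g ` ray (u n) = ray (u (shift 1 n))"
    "bases = word_bases g u UNIV"
proof -
  show "bij_betw (\<lambda>n. ray (u n)) {1..300} rays" "bases = word_bases g u UNIV"
    using assms by (simp_all add: numbering_def triacontagonal_numbering_def)
  fix n :: nat assume "n \<in> {1..300}"
  then obtain k i where n: "k < 20" "i < 15" "n = 15 * k + i + 1" by (rule index_cases)
  then show "g ` ray (u n) = ray (u (shift 1 n))"
    using assms unfolding n(3) shift_index[OF n(2)] numbering_def rotation_symmetry_def by blast
qed

theorem mainTheorem4: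
  shows "(\<exists>p q u g. numbering p q u g) \<and>
    (\<forall>p q u g. numbering p q u g \<longrightarrow>
       card {S. fifteen_fold_parity_proof g S} = 2 ^ 29 \<and>
       bij_betw algorithm_word (Pow even_words)
         {w. fifteen_fold_parity_proof g (word_bases g u w)} \<and>
       bij_betw (word_bases g u)
         {w. fifteen_fold_parity_proof g (word_bases g u w)}
         {S. fifteen_fold_parity_proof g S})"
proof (intro conjI allI impI)
  show "\<exists>p q u g. numbering p q u g" using rotation_numbering by blast
next
  fix p q u g assume "numbering p q u g"
  note num = numberingD[OF this]
  \<comment> \<open>The admissible words are the solutions of one fixed linear system, whatever the
    numbering.\<close>
  have words: "{w. fifteen_fold_parity_proof g (word_bases g u w)} = {w. parity_word w}"
    using fifteen_fold_word_bases[OF num] by simp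
  show alg: "bij_betw algorithm_word (Pow even_words) {w. fifteen_fold_parity_proof g (word_bases g u w)}"
    unfolding words by (rule bij_algorithm_word)
  show proofs: "bij_betw (word_bases g u) {w. fifteen_fold_parity_proof g (word_bases g u w)}
      {S. fifteen_fold_parity_proof g S}"
    unfolding words by (rule bij_word_bases[OF num])
  show "card {S. fifteen_fold_parity_proof g S} = 2 ^ 29"
    using bij_betw_same_card[OF bij_betw_trans[OF alg proofs]]
    by (simp add: card_Pow finite_even_words card_even_words)
qed

end
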